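(* Let $d\ge 2$ and $2<p\le\infty$. There is a constant $C=C(p,d)>0$ such that for all integers $m\ge 3$ $$ d_m(\mathbf W^{1/2}_p,L_\infty)\le C\,m^{-1/2}(\log m)^{d/2}(\log\log m)^{3/2}, $$ where $\log$ is the natural logarithm.
   Context: All functions are $2\pi$-periodic in each of $d$ variables, i.e. defined on $\mathbb T^d$; $L_p=L_p(\mathbb T^d)$ with norm $\|\cdot\|_p$ (normalized Lebesgue measure). Kolmogorov widths: for a subset $\mathbf F$ of a Banach space $X$ and $m\ge1$, $$d_m(\mathbf F,X):=\inf_{\{u_i\}_{i=1}^m\subset X}\ \sup_{f\in\mathbf F}\ \inf_{c_1,\dots,c_m}\Big\|f-\sum_{i=1}^m c_iu_i\Big\|_X ,$$ where the $c_i$ are scalars. The class $\mathbf W^r_p$ (used here with $r=1/2$): for $r>0$ let $F_r(x):=1+2\sum_{k=1}^\infty k^{-r}\cos(kx-r\pi/2)$ be the univariate Bernoulli kernel and $F_r(\mathbf x):=\prod_{j=1}^dF_r(x_j)$ its multivariate analog. Then $\mathbf W^r_p$ is the class of functions $f$ representable as $$f(\mathbf x)=(\varphi\ast F_r)(\mathbf x):=(2\pi)^{-d}\int_{\mathbb T^d}\varphi(\mathbf y)F_r(\mathbf x-\mathbf y)\,d\mathbf y,\qquad \varphi\in L_p,\ \|\varphi\|_p\le1.$$ *)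

theory Defs
  imports "HOL-Analysis.Analysis" "HOL-Probability.Essential_Supremum"
begin

text \<open>
  Functions on the torus are \<open>2 * pi\<close>-periodic functions on \<^typ>\<open>real ^ 'd\<close>, where
  \<open>d = CARD('d)\<close>. They are not identified when they agree almost everywhere; all norms below
  are insensitive to null sets. The scalar type \<open>'k\<close> ranges over
  \<open>{real_normed_field, euclidean_space}\<close>, whose instances are, up to isomorphism, the real and
  the complex numbers, so that both the real and the complex spaces are covered.
\<close>

definition torus :: "(real ^ 'd) measure" where
  "torus = uniform_measure lborel (cbox 0 (\<chi> i. 2 * pi))"

definition periodic :: "(real ^ 'd \<Rightarrow> 'k) \<Rightarrow> bool" where
  "periodic f \<longleftrightarrow> (\<forall>x j. f (x + axis j (2 * pi)) = f x)"

text \<open>The power \<open>1 / p\<close> is taken in the reals, hence the separate case of an infinite integral.\<close>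

definition Lp_norm ::
  "ennreal \<Rightarrow> (real ^ 'd \<Rightarrow> 'k::{real_normed_field, euclidean_space}) \<Rightarrow> ennreal" where
  "Lp_norm p f =
     (if p = \<infinity> then esssup torus (\<lambda>x. ennreal (norm (f x)))
      else let I = (\<integral>\<^sup>+ x. ennreal (norm (f x) powr enn2real p) \<partial>torus)
           in if I = \<infinity> then \<infinity> else ennreal (enn2real I powr (1 / enn2real p)))"

definition Lp_space ::
  "ennreal \<Rightarrow> (real ^ 'd \<Rightarrow> 'k::{real_normed_field, euclidean_space}) set" where
  "Lp_space p = {f. f \<in> borel_measurable borel \<and> periodic f \<and> Lp_norm p f < \<infinity>}"

text \<open>
  For \<open>r > 0\<close> the series converges (in general only conditionally) unless \<open>x\<close> is an integer
  multiple of \<open>2 * pi\<close>; the value on that null set plays no role in the convolutions below.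
\<close>

definition bernoulli_kernel1 :: "real \<Rightarrow> real \<Rightarrow> real" where
  "bernoulli_kernel1 r x =
     1 + 2 * (\<Sum>k. real (Suc k) powr (- r) * cos (real (Suc k) * x - r * pi / 2))"

definition bernoulli_kernel :: "real \<Rightarrow> real ^ 'd \<Rightarrow> real" where
  "bernoulli_kernel r x = (\<Prod>j\<in>UNIV. bernoulli_kernel1 r (x $ j))"

text \<open>The factor \<open>(2 * pi)\<close> to the power \<open>-d\<close> is part of the normalized measure \<^const>\<open>torus\<close>.\<close>

definition torus_convolution ::
  "(real ^ 'd \<Rightarrow> 'k::{real_normed_field, euclidean_space}) \<Rightarrow> (real ^ 'd \<Rightarrow> real) \<Rightarrow> real ^ 'd \<Rightarrow> 'k"
  where
  "torus_convolution \<phi> F x = (LINT y|torus. F (x - y) *\<^sub>R \<phi> y)"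

definition W_class ::
  "real \<Rightarrow> ennreal \<Rightarrow> (real ^ 'd \<Rightarrow> 'k::{real_normed_field, euclidean_space}) set" where
  "W_class r p =
     {torus_convolution \<phi> (bernoulli_kernel r) | \<phi>. \<phi> \<in> Lp_space p \<and> Lp_norm p \<phi> \<le> 1}"

text \<open>
  Widths of a set \<open>F\<close> in the function space with carrier \<open>X\<close> and norm \<open>N\<close>. They take values in
  \<^typ>\<open>ennreal\<close>, so that suprema and infima are the genuine ones.
\<close>

definition kolmogorov_width ::
  "('a \<Rightarrow> 'k::field) set \<Rightarrow> (('a \<Rightarrow> 'k) \<Rightarrow> ennreal) \<Rightarrow> nat \<Rightarrow> ('a \<Rightarrow> 'k) set \<Rightarrow> ennreal" where
  "kolmogorov_width X N m F =
     (INF u\<in>{u :: nat \<Rightarrow> 'a \<Rightarrow> 'k. \<forall>i\<in>{1..m}. u i \<in> X}.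
        SUP f\<in>F. INF c :: nat \<Rightarrow> 'k. N (\<lambda>x. f x - (\<Sum>i=1..m. c i * u i x)))"

end

theory Submission
  imports Defs "HOL-Probability.Probability_Measure"
begin

text \<open>
  Near \<open>0\<close> the kernel of order \<open>1/2\<close> behaves like a multiple of \<open>x\<close> to the power \<open>-1/2\<close>.
  Averaging over dyadic cells in \<open>x\<close> splits it into details \<open>k_s(x, y)\<close> of scale \<open>s\<close> with
  \<open>\<bar>k_s\<bar> \<le> C 2^(s/2)\<close> and \<open>\<integral> \<bar>k_s(x, y)\<bar> dy \<le> C 2^(-s/2)\<close>; hence details of different scales are
  almost orthogonal in \<open>y\<close>, and the tensor products over a set \<open>A\<close> of multi-indices form a
  kernel whose \<open>L_2\<close> norm in \<open>y\<close> is at most a constant times the square root of \<open>card A\<close>.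

  With \<open>n\<close> such that \<open>2^n n^(d-1)\<close> is about \<open>m\<close>, the indices with \<open>|s| \<le> n\<close> produce piecewise
  constant functions in a space of dimension at most \<open>m/2\<close>. For \<open>n < |s| \<le> n + J\<close>, where
  \<open>J\<close> is about \<open>log log m\<close>, the operator maps the unit ball of \<open>L_2\<close> to functions on a grid of
  \<open>M = m^O(1)\<close> points; the squared norm of point evaluation is at most \<open>D = O(J n^(d-1))\<close>, and
  the \<open>m\<close>-width of the image in the sup norm is \<open>O(sqrt (D log M / m))\<close>. This is the low \<open>M\<^sup>*\<close>
  estimate, proved with random signs, Maurey sampling and linear programming duality. For
  \<open>|s| > n + J\<close> the density is cut at height \<open>2^(J/4)\<close>: the bounded part is small because
  the \<open>L_1\<close> norms of the details decay, and the other part is small in \<open>L_2\<close> because \<open>p > 2\<close>;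
  all powers of \<open>log m\<close> lost there are absorbed by \<open>J\<close>.
\<close>

subsection \<open>Linear duality and Gram matrices\<close>

text \<open>Order 1/2 is critical in \<open>L_2\<close>: the sup bound of a detail grows like
  \<open>2^(s/2)\<close> exactly as its \<open>L_1\<close> bound decays, so the resulting
  \<open>L_2\<close> bound does not improve with the scale and a block norm merely counts
  multi-indices. Treating all indices up to the discretization level at once would mean about
  \<open>n^d\<close> of them and an error \<open>sqrt (n^d * n / m)\<close>, too large by a factor
  of about \<open>sqrt n\<close>. The cut into ranges lets the \<open>L_2\<close> argument pay at
  full price only for \<open>J\<close> levels with \<open>O(n^(d-1))\<close> indices each; a grid
  with logarithm \<open>O(n)\<close> then yields \<open>sqrt (J * n^d / m)\<close>, and
  \<open>n\<close> is at most of order \<open>log m\<close>. Beyond these levels the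
  \<open>L_1\<close> decay would suffice for bounded densities, which is why unbounded ones have to
  be truncated; once \<open>J\<close> is a large enough multiple of \<open>log n\<close>, the
  surviving factor \<open>2^(-J/4)\<close> outweighs every power of \<open>n\<close> that was lost.
  Passing to a finite grid makes everything elementary: expectations are finite averages over signs,
  and duality is a statement about finitely many linear inequalities.\<close>

inductive conic_comb :: "((nat \<Rightarrow> real) \<times> real) set \<Rightarrow> (nat \<Rightarrow> real) \<Rightarrow> real \<Rightarrow> bool" for S where
  base: "(a, b) \<in> S \<Longrightarrow> conic_comb S a b"
| add: "conic_comb S a b \<Longrightarrow> conic_comb S a' b' \<Longrightarrow> conic_comb S (\<lambda>i. a i + a' i) (b + b')"
| scale: "c \<ge> 0 \<Longrightarrow> conic_comb S a b \<Longrightarrow> conic_comb S (\<lambda>i. c * a i) (c * b)"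

lemma exists_real_between:
  fixes L U :: "'a \<Rightarrow> real"
  assumes "finite P" "finite Q" "\<And>p q. p \<in> P \<Longrightarrow> q \<in> Q \<Longrightarrow> L q \<le> U p"
  shows "\<exists>z. (\<forall>p\<in>P. z \<le> U p) \<and> (\<forall>q\<in>Q. L q \<le> z)"
proof (cases "Q = {}")
  case True
  show ?thesis
  proof (cases "P = {}")
    case False
    then show ?thesis using True assms by (intro exI[of _ "Min (U ` P)"]) auto
  qed (use True in auto)
next
  case False
  then show ?thesis using assms by (intro exI[of _ "Max (L ` Q)"]) auto
qed

text \<open>A pair \<open>(a, b)\<close> encodes the inequality
  \<open>(\<Sum>i<n. a i * w i) \<le> b\<close>. Eliminating the last unknown produces only conic
  combinations of \<open>S\<close> whose last coefficient vanishes, so a certificate of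
  infeasibility for the reduced system is already one for \<open>S\<close>. As combinations form an
  inductive predicate, this transfer is an induction on derivations.\<close>

lemma fourier_motzkin:
  assumes "finite S"
    and "\<And>a b. conic_comb S a b \<Longrightarrow> (\<forall>i<n. a i = 0) \<Longrightarrow> b \<ge> 0"
  shows "\<exists>w. \<forall>(a, b)\<in>S. (\<Sum>i<n. a i * w i) \<le> b"
  using assms
proof (induction n arbitrary: S)
  case 0
  then show ?case by (auto intro: conic_comb.base)
next
  case (Suc n)
  define P where "P = {p \<in> S. fst p n > 0}"
  define Q where "Q = {p \<in> S. fst p n < 0}"
  define Z where "Z = {p \<in> S. fst p n = 0}"
  define comb where "comb = (\<lambda>(p :: (nat \<Rightarrow> real) \<times> real, q :: (nat \<Rightarrow> real) \<times> real).
     (\<lambda>i. (- fst q n) * fst p i + fst p n * fst q i, (- fst q n) * snd p + fst p n * snd q))"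
  define S' where "S' = Z \<union> comb ` (P \<times> Q)"
  have fin: "finite P" "finite Q" "finite Z" using Suc.prems(1) by (auto simp: P_def Q_def Z_def)
  have S'1: "conic_comb S a b \<and> a n = 0" if ab: "(a, b) \<in> S'" for a b
  proof (cases "(a, b) \<in> Z")
    case True
    then show ?thesis by (auto simp: Z_def intro: conic_comb.base)
  next
    case False
    then obtain p q where pq: "p \<in> P" "q \<in> Q" "(a, b) = comb (p, q)"
      using ab unfolding S'_def by blast
    have "conic_comb S (fst p) (snd p)" "conic_comb S (fst q) (snd q)"
      using pq by (auto simp: P_def Q_def intro: conic_comb.base)
    moreover have "fst q n < 0" "fst p n > 0" using pq by (auto simp: P_def Q_def)
    ultimately have "conic_comb S (\<lambda>i. (- fst q n) * fst p i) ((- fst q n) * snd p)"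
      "conic_comb S (\<lambda>i. fst p n * fst q i) (fst p n * snd q)"
      by (intro conic_comb.scale; linarith)+
    from conic_comb.add[OF this] show ?thesis using pq(3) by (auto simp: comb_def)
  qed
  have S'2: "conic_comb S a b \<and> a n = 0" if "conic_comb S' a b" for a b
    using that by induction (auto intro: conic_comb.intros dest: S'1)
  have "\<exists>w. \<forall>(a, b)\<in>S'. (\<Sum>i<n. a i * w i) \<le> b"
  proof (rule Suc.IH)
    show "finite S'" using fin by (auto simp: S'_def)
    fix a b assume ab: "conic_comb S' a b" "\<forall>i<n. a i = 0"
    show "b \<ge> 0" using S'2[OF ab(1)] ab(2) by (intro Suc.prems(2)[of a b]) (auto simp: less_Suc_eq)
  qed
  then obtain w where w: "\<And>a b. (a, b) \<in> S' \<Longrightarrow> (\<Sum>i<n. a i * w i) \<le> b" by blast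
  \<comment> \<open>With the first \<open>n\<close> unknowns fixed, \<open>r p\<close> bounds the
    last unknown from above for \<open>p\<close> in \<open>P\<close> and from below for
    \<open>p\<close> in \<open>Q\<close>; the combined inequalities in \<open>S'\<close> say that
    these bounds are compatible.\<close>
  define r where "r = (\<lambda>p :: (nat \<Rightarrow> real) \<times> real. (snd p - (\<Sum>i<n. fst p i * w i)) / fst p n)"
  have LU: "r q \<le> r p" if pq: "p \<in> P" "q \<in> Q" for p q
  proof -
    have "comb (p, q) \<in> S'" using pq by (auto simp: S'_def)
    then have "(\<Sum>i<n. ((- fst q n) * fst p i + fst p n * fst q i) * w i) \<le> (- fst q n) * snd p + fst p n * snd q"
      unfolding comb_def prod.case by (rule w)
    moreover have "(\<Sum>i<n. ((- fst q n) * fst p i + fst p n * fst q i) * w i)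
       = (- fst q n) * (\<Sum>i<n. fst p i * w i) + fst p n * (\<Sum>i<n. fst q i * w i)"
      by (simp add: sum_distrib_left sum.distrib[symmetric] algebra_simps)
    ultimately show ?thesis using pq by (simp add: r_def P_def Q_def field_simps)
  qed
  have "\<exists>z. (\<forall>p\<in>P. z \<le> r p) \<and> (\<forall>q\<in>Q. r q \<le> z)"
    by (rule exists_real_between[OF fin(1,2)]) (rule LU)
  then obtain z where z: "(\<forall>p\<in>P. z \<le> r p) \<and> (\<forall>q\<in>Q. r q \<le> z)" by (elim exE)
  have "(\<Sum>i<Suc n. a i * (w(n := z)) i) \<le> b" if ab: "(a, b) \<in> S" for a b
  proof -
    have eq: "(\<Sum>i<Suc n. a i * (w(n := z)) i) = (\<Sum>i<n. a i * w i) + a n * z"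
      by simp
    consider "a n > 0" | "a n < 0" | "a n = 0" by linarith
    then show ?thesis
    proof cases
      case 1
      then have "z \<le> r (a, b)" using z ab by (auto simp: P_def)
      then show ?thesis using 1 unfolding eq by (simp add: r_def field_simps)
    next
      case 2
      then have "r (a, b) \<le> z" using z ab by (auto simp: Q_def)
      then show ?thesis using 2 unfolding eq by (simp add: r_def field_simps)
    next
      case 3
      then have "(a, b) \<in> S'" using ab by (auto simp: S'_def Z_def)
      from w[OF this] show ?thesis using 3 unfolding eq by simp
    qed
  qed
  then show ?case by (intro exI[of _ "w(n := z)"]) auto
qed

text \<open>Finite-dimensional duality: it will turn bounds on functionals that annihilate a span
  into an approximant from that span in the sup norm.\<close>

lemma farkas:
  fixes A :: "'j \<Rightarrow> nat \<Rightarrow> real" and B :: "'j \<Rightarrow> real"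
  assumes J: "finite J"
    and dual: "\<And>c. (\<forall>j\<in>J. c j \<ge> 0) \<Longrightarrow> (\<forall>i<n. (\<Sum>j\<in>J. c j * A j i) = 0) \<Longrightarrow> (\<Sum>j\<in>J. c j * B j) \<ge> 0"
  shows "\<exists>w. \<forall>j\<in>J. (\<Sum>i<n. A j i * w i) \<le> B j"
proof -
  define S where "S = (\<lambda>j. (A j, B j)) ` J"
  have comb: "\<exists>c. (\<forall>j\<in>J. c j \<ge> 0) \<and> (\<forall>i. a i = (\<Sum>j\<in>J. c j * A j i)) \<and> b = (\<Sum>j\<in>J. c j * B j)"
    if "conic_comb S a b" for a b
    using that
  proof induction
    case (base a b)
    then obtain j where "j \<in> J" "a = A j" "b = B j" by (auto simp: S_def)
    then show ?case using J
      by (intro exI[of _ "\<lambda>k. if k = j then 1 else 0"]) (auto simp: if_distrib[of "\<lambda>x. x * _"] cong: if_cong)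
  next
    case (add a b a' b')
    then obtain c c' where "\<forall>j\<in>J. c j \<ge> 0" "\<forall>i. a i = (\<Sum>j\<in>J. c j * A j i)" "b = (\<Sum>j\<in>J. c j * B j)"
      "\<forall>j\<in>J. c' j \<ge> 0" "\<forall>i. a' i = (\<Sum>j\<in>J. c' j * A j i)" "b' = (\<Sum>j\<in>J. c' j * B j)" by blast
    then show ?case by (intro exI[of _ "\<lambda>j. c j + c' j"]) (auto simp: algebra_simps sum.distrib)
  next
    case (scale d a b)
    then obtain c where "\<forall>j\<in>J. c j \<ge> 0" "\<forall>i. a i = (\<Sum>j\<in>J. c j * A j i)" "b = (\<Sum>j\<in>J. c j * B j)" by blast
    then show ?case using scale.hyps(1)
      by (intro exI[of _ "\<lambda>j. d * c j"]) (auto simp: algebra_simps sum_distrib_left)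
  qed
  have "\<exists>w. \<forall>(a, b)\<in>S. (\<Sum>i<n. a i * w i) \<le> b"
  proof (rule fourier_motzkin)
    show "finite S" using J by (simp add: S_def)
    fix a b assume "conic_comb S a b" "\<forall>i<n. a i = 0"
    then show "b \<ge> 0" using comb[of a b] dual by auto
  qed
  then show ?thesis by (auto simp: S_def)
qed

lemma quadratic_form_insert:
  fixes \<Gamma> :: "'k \<Rightarrow> 'k \<Rightarrow> real"
  assumes "finite K" "x \<notin> K" "\<And>k l. \<Gamma> k l = \<Gamma> l k"
  shows "(\<Sum>k\<in>insert x K. \<Sum>l\<in>insert x K. c k * c l * \<Gamma> k l) =
    (c x)\<^sup>2 * \<Gamma> x x + 2 * c x * (\<Sum>l\<in>K. c l * \<Gamma> x l) + (\<Sum>k\<in>K. \<Sum>l\<in>K. c k * c l * \<Gamma> k l)"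
proof -
  have "(\<Sum>k\<in>K. c k * c x * \<Gamma> k x) = c x * (\<Sum>l\<in>K. c l * \<Gamma> x l)"
    using assms(3) by (auto simp: sum_distrib_left intro!: sum.cong)
  moreover have "(\<Sum>l\<in>K. c x * c l * \<Gamma> x l) = c x * (\<Sum>l\<in>K. c l * \<Gamma> x l)"
    by (auto simp: sum_distrib_left intro!: sum.cong)
  ultimately show ?thesis using assms(1,2)
    by (simp add: sum.distrib power2_eq_square algebra_simps)
qed

text \<open>Cholesky elimination of one index at a time: a zero pivot forces its row to vanish, a
  positive pivot is removed by a Schur complement. The purpose is to replace kernel sections in
  \<open>L_2\<close> by vectors with finitely many coordinates, to which random signs can be
  attached.\<close>

lemma psd_imp_gram:
  fixes \<Gamma> :: "'k \<Rightarrow> 'k \<Rightarrow> real"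
  assumes "finite K" "\<And>k l. \<Gamma> k l = \<Gamma> l k"
    and "\<And>c. 0 \<le> (\<Sum>k\<in>K. \<Sum>l\<in>K. c k * c l * \<Gamma> k l)"
  shows "\<exists>(N::nat) b. \<forall>k\<in>K. \<forall>l\<in>K. \<Gamma> k l = (\<Sum>i<N. b k i * b l i)"
  using assms
proof (induction K arbitrary: \<Gamma> rule: finite_induct)
  case empty
  then show ?case by auto
next
  case (insert x K)
  note qf = quadratic_form_insert[OF insert.hyps(1,2), of \<Gamma>, OF insert.prems(1)]
  have psd: "0 \<le> (c x)\<^sup>2 * \<Gamma> x x + 2 * c x * (\<Sum>l\<in>K. c l * \<Gamma> x l) + (\<Sum>k\<in>K. \<Sum>l\<in>K. c k * c l * \<Gamma> k l)" for c
    using insert.prems(2)[of c] qf[of c] by simp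
  have psd': "0 \<le> t\<^sup>2 * \<Gamma> x x + 2 * t * (\<Sum>l\<in>K. c l * \<Gamma> x l) + (\<Sum>k\<in>K. \<Sum>l\<in>K. c k * c l * \<Gamma> k l)" for c t
  proof -
    have "(\<Sum>l\<in>K. (c(x := t)) l * \<Gamma> x l) = (\<Sum>l\<in>K. c l * \<Gamma> x l)"
      using insert.hyps(2) by (intro sum.cong) auto
    moreover have "(\<Sum>k\<in>K. \<Sum>l\<in>K. (c(x := t)) k * (c(x := t)) l * \<Gamma> k l) = (\<Sum>k\<in>K. \<Sum>l\<in>K. c k * c l * \<Gamma> k l)"
      using insert.hyps(2) by (intro sum.cong) auto
    ultimately show ?thesis using psd[of "c(x := t)"] by simp
  qed
  show ?case
  proof (cases "\<Gamma> x x = 0")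
    case True
    have z: "\<Gamma> x l = 0" if "l \<in> K" for l
    proof (rule ccontr)
      assume ne: "\<Gamma> x l \<noteq> 0"
      let ?c = "\<lambda>k. if k = l then 1 else (0::real)"
      have 1: "(\<Sum>k\<in>K. ?c k * \<Gamma> x k) = \<Gamma> x l"
        using that insert.hyps(1) by (simp add: if_distrib[of "\<lambda>x. x * _"] cong: if_cong)
      have 2: "0 \<le> 2 * t * \<Gamma> x l + (\<Sum>k\<in>K. \<Sum>j\<in>K. ?c k * ?c j * \<Gamma> k j)" for t
        using psd'[of t ?c] unfolding 1 using True by simp
      \<comment> \<open>At this \<open>t\<close> the affine function of \<open>t\<close> in fact
        \<open>2\<close> takes the value -1.\<close>
      show False using 2[of "- (1 + (\<Sum>k\<in>K. \<Sum>j\<in>K. ?c k * ?c j * \<Gamma> k j)) / (2 * \<Gamma> x l)"] ne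
        by (simp add: field_simps)
    qed
    have "0 \<le> (\<Sum>k\<in>K. \<Sum>l\<in>K. c k * c l * \<Gamma> k l)" for c using psd'[of 0 c] by simp
    from insert.IH[OF insert.prems(1) this] obtain N :: nat and b
      where b: "\<forall>k\<in>K. \<forall>l\<in>K. \<Gamma> k l = (\<Sum>i<N. b k i * b l i)" by blast
    have "\<forall>k\<in>insert x K. \<forall>l\<in>insert x K. \<Gamma> k l = (\<Sum>i<N. (b(x := \<lambda>_. 0)) k i * (b(x := \<lambda>_. 0)) l i)"
      using b z True insert.hyps(2) insert.prems(1) by auto
    then show ?thesis by blast
  next
    case False
    then have pos: "\<Gamma> x x > 0" using psd'[of 1 "\<lambda>_. 0"] by simp
    define \<Gamma>' where "\<Gamma>' = (\<lambda>k l. \<Gamma> k l - \<Gamma> x k * \<Gamma> x l / \<Gamma> x x)"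
    have "0 \<le> (\<Sum>k\<in>K. \<Sum>l\<in>K. c k * c l * \<Gamma>' k l)" for c
    proof -
      let ?s = "\<Sum>l\<in>K. c l * \<Gamma> x l"
      have "(\<Sum>k\<in>K. \<Sum>l\<in>K. c k * c l * \<Gamma>' k l) = (\<Sum>k\<in>K. \<Sum>l\<in>K. c k * c l * \<Gamma> k l) - ?s * ?s / \<Gamma> x x"
        unfolding sum_product sum_divide_distrib sum_subtractf[symmetric] \<Gamma>'_def
        by (intro sum.cong) (auto simp: algebra_simps)
      \<comment> \<open>The value of \<open>t\<close> that minimizes the quadratic
        polynomial.\<close>
      moreover have "0 \<le> (- ?s / \<Gamma> x x)\<^sup>2 * \<Gamma> x x + 2 * (- ?s / \<Gamma> x x) * ?s + (\<Sum>k\<in>K. \<Sum>l\<in>K. c k * c l * \<Gamma> k l)"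
        by (rule psd')
      moreover have "(- ?s / \<Gamma> x x)\<^sup>2 * \<Gamma> x x + 2 * (- ?s / \<Gamma> x x) * ?s = - (?s * ?s / \<Gamma> x x)"
        using pos by (simp add: power2_eq_square field_simps)
      ultimately show ?thesis by linarith
    qed
    moreover have "\<And>k l. \<Gamma>' k l = \<Gamma>' l k" using insert.prems(1) by (auto simp: \<Gamma>'_def)
    ultimately obtain N :: nat and b
      where b: "\<forall>k\<in>K. \<forall>l\<in>K. \<Gamma>' k l = (\<Sum>i<N. b k i * b l i)" using insert.IH[of \<Gamma>'] by blast
    \<comment> \<open>The extra coordinate \<open>N\<close> carries the rank-one part subtracted in
      \<open>\<Gamma>'\<close>.\<close>
    define b' where "b' = (\<lambda>k i. if i < N then (if k = x then 0 else b k i) else \<Gamma> x k / sqrt (\<Gamma> x x))"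
    have sumN: "(\<Sum>i<Suc N. b' k i * b' l i) =
       (\<Sum>i<N. (if k = x then 0 else b k i) * (if l = x then 0 else b l i)) + \<Gamma> x k * \<Gamma> x l / \<Gamma> x x" for k l
      using pos by (simp add: b'_def)
    have "\<Gamma> k l = (\<Sum>i<Suc N. b' k i * b' l i)" if "k \<in> insert x K" "l \<in> insert x K" for k l
    proof (cases "k = x \<or> l = x")
      case True
      then show ?thesis using pos insert.prems(1)[of k x] insert.prems(1)[of l x]
        unfolding sumN by auto
    next
      case False
      then have "\<Gamma>' k l = (\<Sum>i<N. b k i * b l i)" using b that by auto
      then show ?thesis using False unfolding sumN by (simp add: \<Gamma>'_def)
    qed
    then show ?thesis by blast
  qed
qed

section \<open>Averages over independent random signs\<close>

primrec sgn_avg :: "nat \<Rightarrow> ((nat \<Rightarrow> real) \<Rightarrow> real) \<Rightarrow> real" where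
  "sgn_avg 0 h = h (\<lambda>_. 0)"
| "sgn_avg (Suc n) h = (sgn_avg n (\<lambda>g. h (g(n := 1))) + sgn_avg n (\<lambda>g. h (g(n := - 1)))) / 2"

text \<open>Expectation over \<open>m\<close> independent rows of \<open>N\<close> signs. Recursion
  takes the place of a probability space, since linearity, monotonicity and independence of the rows
  suffice; entries outside the range stay 0.\<close>

primrec mat_avg :: "nat \<Rightarrow> nat \<Rightarrow> ((nat \<Rightarrow> nat \<Rightarrow> real) \<Rightarrow> real) \<Rightarrow> real" where
  "mat_avg N 0 h = h (\<lambda>_ _. 0)"
| "mat_avg N (Suc m) h = sgn_avg N (\<lambda>r. mat_avg N m (\<lambda>G. h (G(m := r))))"

lemma sgn_avg_add: "sgn_avg n (\<lambda>g. h g + k g) = sgn_avg n h + sgn_avg n k"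
  by (induction n arbitrary: h k) (simp_all add: field_simps)

lemma sgn_avg_cmult: "sgn_avg n (\<lambda>g. c * h g) = c * sgn_avg n h"
  by (induction n arbitrary: h) (simp_all add: field_simps)

lemma sgn_avg_Suc:
  "sgn_avg (Suc n) h = sgn_avg n (\<lambda>g. (h (g(n := 1)) + h (g(n := - 1))) / 2)"
  using sgn_avg_cmult[of n "1 / 2" "\<lambda>g. h (g(n := 1)) + h (g(n := - 1))"] by (simp add: sgn_avg_add)

lemma sgn_avg_const [simp]: "sgn_avg n (\<lambda>g. c) = c"
  by (induction n) simp_all

lemma sgn_avg_mono: "(\<And>g. h g \<le> k g) \<Longrightarrow> sgn_avg n h \<le> sgn_avg n k"
  by (induction n arbitrary: h k) (auto intro!: divide_right_mono add_mono)

lemma mat_avg_add: "mat_avg N m (\<lambda>g. h g + k g) = mat_avg N m h + mat_avg N m k"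
  by (induction m arbitrary: h k) (simp_all add: sgn_avg_add)

lemma mat_avg_cmult: "mat_avg N m (\<lambda>g. c * h g) = c * mat_avg N m h"
  by (induction m arbitrary: h) (simp_all add: sgn_avg_cmult)

lemma mat_avg_const [simp]: "mat_avg N m (\<lambda>g. c) = c"
  by (induction m) simp_all

lemma mat_avg_sum: "finite T \<Longrightarrow> mat_avg N m (\<lambda>g. \<Sum>t\<in>T. h t g) = (\<Sum>t\<in>T. mat_avg N m (h t))"
  by (induction T rule: finite_induct) (simp_all add: mat_avg_add)

lemma mat_avg_mono: "(\<And>g. h g \<le> k g) \<Longrightarrow> mat_avg N m h \<le> mat_avg N m k"
  by (induction m arbitrary: h k) (auto intro!: sgn_avg_mono)

lemma mat_avg_less_exists: "mat_avg N m h < c \<Longrightarrow> \<exists>G. h G < c"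
  using mat_avg_mono[of "\<lambda>_. c" h N m] by (force simp: not_less)

text \<open>Independence of the rows: the factor of row \<open>m\<close> does not see the earlier
  rows and can be pulled out of the inner average.\<close>

lemma mat_avg_prod: "mat_avg N m (\<lambda>G. \<Prod>i<m. f (G i)) = (sgn_avg N f) ^ m"
proof (induction m)
  case (Suc m)
  have "(\<Prod>i<Suc m. f ((G(m := r)) i)) = f r * (\<Prod>i<m. f (G i))" for G :: "nat \<Rightarrow> nat \<Rightarrow> real" and r
    by (simp add: mult.commute)
  then have "mat_avg N (Suc m) (\<lambda>G. \<Prod>i<Suc m. f (G i)) = sgn_avg N (\<lambda>r. f r * (sgn_avg N f) ^ m)"
    by (simp only: mat_avg.simps mat_avg_cmult Suc)
  also have "\<dots> = (sgn_avg N f) ^ m * sgn_avg N f"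
    using sgn_avg_cmult[of N "(sgn_avg N f) ^ m" f] by (simp add: mult.commute)
  finally show ?case by simp
qed simp

lemma sgn_avg_square:
  "sgn_avg n (\<lambda>g. (\<Sum>i<n. g i * y i)\<^sup>2) = (\<Sum>i<n. (y i)\<^sup>2)"
proof (induction n)
  case (Suc n)
  have "sgn_avg (Suc n) (\<lambda>g. (\<Sum>i<Suc n. g i * y i)\<^sup>2) =
     sgn_avg n (\<lambda>g. (((\<Sum>i<n. g i * y i) + y n)\<^sup>2 + ((\<Sum>i<n. g i * y i) - y n)\<^sup>2) / 2)"
    unfolding sgn_avg_Suc by simp
  also have "\<dots> = sgn_avg n (\<lambda>g. (\<Sum>i<n. g i * y i)\<^sup>2 + (y n)\<^sup>2)"
    by (rule arg_cong[where f = "sgn_avg n"]) (auto simp: power2_eq_square algebra_simps)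
  finally show ?case by (simp add: sgn_avg_add Suc)
qed simp

text \<open>Khinchine inequality for the fourth moment with the Gaussian constant 3; odd powers of
  the last sign cancel, which lets the induction complete a square.\<close>

lemma sgn_avg_power4:
  "sgn_avg n (\<lambda>g. (\<Sum>i<n. g i * y i) ^ 4) \<le> 3 * (\<Sum>i<n. (y i)\<^sup>2)\<^sup>2"
proof (induction n)
  case (Suc n)
  let ?Q = "\<Sum>i<n. (y i)\<^sup>2"
  have "sgn_avg (Suc n) (\<lambda>g. (\<Sum>i<Suc n. g i * y i) ^ 4) =
     sgn_avg n (\<lambda>g. (((\<Sum>i<n. g i * y i) + y n) ^ 4 + ((\<Sum>i<n. g i * y i) - y n) ^ 4) / 2)"
    unfolding sgn_avg_Suc by simp
  also have "\<dots> = sgn_avg n (\<lambda>g. (\<Sum>i<n. g i * y i) ^ 4 + (6 * (y n)\<^sup>2 * (\<Sum>i<n. g i * y i)\<^sup>2 + y n ^ 4))"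
    by (rule arg_cong[where f = "sgn_avg n"]) (auto simp: power2_eq_square power4_eq_xxxx algebra_simps)
  also have "\<dots> = sgn_avg n (\<lambda>g. (\<Sum>i<n. g i * y i) ^ 4) + (6 * (y n)\<^sup>2 * ?Q + y n ^ 4)"
    by (simp only: sgn_avg_add sgn_avg_cmult sgn_avg_square sgn_avg_const)
  also have "\<dots> \<le> 3 * ?Q\<^sup>2 + (6 * (y n)\<^sup>2 * ?Q + 3 * y n ^ 4)" 
    using Suc by (intro add_mono) auto
  also have "\<dots> = 3 * (?Q + (y n)\<^sup>2)\<^sup>2" by (simp add: power2_eq_square power4_eq_xxxx algebra_simps)
  finally show ?case by simp
qed simp

text \<open>The product of \<open>1 - x + x^2/2\<close> and \<open>1 + x + x^2/2\<close> is
  \<open>1 + x^4/4\<close>, so the Taylor lower bound for \<open>exp x\<close> becomes an upper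
  bound for its inverse.\<close>

lemma exp_minus_le_quadratic: "exp (- x) \<le> 1 - x + x\<^sup>2 / 2" if "x \<ge> (0::real)"
proof -
  have "1 + x + x\<^sup>2 / 2 \<le> exp x" using exp_lower_Taylor_quadratic[OF that] .
  moreover have "(1 - x + x\<^sup>2 / 2) * (1 + x + x\<^sup>2 / 2) = 1 + (x\<^sup>2)\<^sup>2 / 4"
    by (simp add: power2_eq_square algebra_simps)
  then have "1 \<le> (1 - x + x\<^sup>2 / 2) * (1 + x + x\<^sup>2 / 2)" by simp
  moreover have "0 < 1 - x + x\<^sup>2 / 2"
  proof -
    have "1 - x + x\<^sup>2 / 2 = (1 + (1 - x)\<^sup>2) / 2" by (simp add: power2_eq_square field_simps)
    also have "\<dots> > 0" by (intro divide_pos_pos add_pos_nonneg) auto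
    finally show ?thesis .
  qed
  ultimately have "1 \<le> (1 - x + x\<^sup>2 / 2) * exp x"
    by (meson mult_left_mono less_imp_le order_trans)
  then show ?thesis by (simp add: exp_minus field_simps)
qed

text \<open>Exponential moment for the lower tail. The quadratic bound for the exponential needs
  only the second and fourth moments and gives \<open>1 - 1/3 + 1/6 = 5/6\<close>; the shift
  \<open>1/12\<close> is small enough that the result stays below 1.\<close>

lemma sgn_avg_exp_neg_square:
  assumes Q: "Q = (\<Sum>i<n. (y i)\<^sup>2)" "Q > 0"
  shows "sgn_avg n (\<lambda>g. exp (1 / 12 - (\<Sum>i<n. g i * y i)\<^sup>2 / (3 * Q))) \<le> 10 / 11"
proof -
  let ?X = "\<lambda>g. \<Sum>i<n. g i * y i"
  have "sgn_avg n (\<lambda>g. exp (- ((?X g)\<^sup>2 / (3 * Q)))) \<le>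
    sgn_avg n (\<lambda>g. 1 + ((- 1 / (3 * Q)) * (?X g)\<^sup>2 + (1 / (18 * Q\<^sup>2)) * (?X g) ^ 4))"
  proof (rule sgn_avg_mono)
    fix g
    have "exp (- ((?X g)\<^sup>2 / (3 * Q))) \<le> 1 - ((?X g)\<^sup>2 / (3 * Q)) + ((?X g)\<^sup>2 / (3 * Q))\<^sup>2 / 2"
      using Q by (intro exp_minus_le_quadratic) auto
    also have "\<dots> = 1 + ((- 1 / (3 * Q)) * (?X g)\<^sup>2 + (1 / (18 * Q\<^sup>2)) * (?X g) ^ 4)"
      by (simp add: power2_eq_square power4_eq_xxxx)
    finally show "exp (- ((?X g)\<^sup>2 / (3 * Q))) \<le> \<dots>" .
  qed
  also have "\<dots> = 1 + ((- 1 / (3 * Q)) * Q + (1 / (18 * Q\<^sup>2)) * sgn_avg n (\<lambda>g. (?X g) ^ 4))"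
    unfolding sgn_avg_add sgn_avg_cmult sgn_avg_square sgn_avg_const Q(1) ..
  also have "\<dots> \<le> 1 + ((- 1 / (3 * Q)) * Q + (1 / (18 * Q\<^sup>2)) * (3 * Q\<^sup>2))"
    using sgn_avg_power4[of n y] Q(2) unfolding Q(1)[symmetric]
    by (intro add_left_mono mult_left_mono) auto
  also have "\<dots> = 5 / 6" using Q(2) by (simp add: power2_eq_square field_simps)
  finally have 1: "sgn_avg n (\<lambda>g. exp (- ((?X g)\<^sup>2 / (3 * Q)))) \<le> 5 / 6" .
  have "exp (1 / 12 :: real) \<le> 1 + 1 / 12 + (1 / 12)\<^sup>2" by (rule exp_bound) auto
  also have "\<dots> \<le> 12 / 11" by (simp add: power2_eq_square)
  finally have 2: "exp (1 / 12 :: real) \<le> 12 / 11" .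
  have "sgn_avg n (\<lambda>g. exp (1 / 12 - (?X g)\<^sup>2 / (3 * Q))) = exp (1 / 12) * sgn_avg n (\<lambda>g. exp (- ((?X g)\<^sup>2 / (3 * Q))))"
    by (simp add: sgn_avg_cmult[symmetric] exp_add[symmetric])
  also have "\<dots> \<le> 12 / 11 * (5 / 6)" by (rule mult_mono[OF 2 1]) (auto intro: order_trans[OF _ sgn_avg_mono[of "\<lambda>_. 0"]])
  finally show ?thesis by simp
qed

text \<open>Termwise comparison of the even power series, from
  \<open>2 ^ n * fact n \<le> fact (2 * n)\<close>.\<close>

lemma cosh_le_exp_square: "(exp x + exp (- x)) / 2 \<le> exp (x\<^sup>2 / 2)" for x :: real
proof -
  have fact_le: "2 ^ n * fact n \<le> (fact (2 * n) :: real)" for n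
  proof (induction n)
    case (Suc n)
    have "2 ^ Suc n * fact (Suc n) = (2 ^ n * fact n) * (2 * (real n + 1))" by (simp add: algebra_simps)
    also have "\<dots> \<le> fact (2 * n) * ((2 * real n + 2) * (2 * real n + 1))"
      using Suc by (intro mult_mono) (auto simp: algebra_simps)
    also have "\<dots> = fact (2 * Suc n)" by (simp add: algebra_simps)
    finally show ?case .
  qed simp
  have "(\<lambda>n. if even n then x ^ n /\<^sub>R fact n else 0) sums cosh x" by (rule cosh_converges)
  then have 1: "(\<lambda>n. x ^ (2 * n) /\<^sub>R fact (2 * n)) sums cosh x"
    using sums_mono_reindex[of "\<lambda>n. 2 * n" "\<lambda>n. if even n then x ^ n /\<^sub>R fact n else 0" "cosh x"]
    by (force simp: strict_mono_def image_iff elim!: evenE)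
  have 2: "(\<lambda>n. (x\<^sup>2 / 2) ^ n /\<^sub>R fact n) sums exp (x\<^sup>2 / 2)" by (rule exp_converges)
  have "x ^ (2 * n) /\<^sub>R fact (2 * n) \<le> (x\<^sup>2 / 2) ^ n /\<^sub>R fact n" for n
  proof -
    have "x ^ (2 * n) / fact (2 * n) \<le> x ^ (2 * n) / (2 ^ n * fact n)"
      using fact_le[of n] by (intro divide_left_mono) (auto simp: power_mult)
    also have "\<dots> = (x\<^sup>2 / 2) ^ n / fact n" by (simp add: power_mult power_divide)
    finally show ?thesis by (simp only: real_scaleR_def divide_inverse mult.commute)
  qed
  from sums_le[OF this 1 2] show ?thesis by (simp add: cosh_def)
qed

text \<open>Exponential moment for the upper tail. Averaging over the last sign gives a hyperbolic
  cosine, whose Gaussian bound amounts to replacing \<open>t\<close> by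
  \<open>t * (1 + 2 * t * (y n)^2)\<close>. The right-hand side, slightly larger than the Gaussian
  value \<open>(1 - 2 t Q)^(-1/2)\<close> with \<open>Q\<close> the sum of squares, is stable under
  this change of parameter.\<close>

lemma sgn_avg_exp_square:
  assumes "t \<ge> 0" "2 * t * (\<Sum>i<n. (y i)\<^sup>2) < 1"
  shows "sgn_avg n (\<lambda>g. exp (t * (\<Sum>i<n. g i * y i)\<^sup>2))
    \<le> exp (t * (\<Sum>i<n. (y i)\<^sup>2) / (1 - 2 * t * (\<Sum>i<n. (y i)\<^sup>2)))"
  using assms
proof (induction n arbitrary: t)
  case (Suc n)
  let ?Q = "\<Sum>i<n. (y i)\<^sup>2" and ?X = "\<lambda>g. \<Sum>i<n. g i * y i"
  define a b where "a = 2 * t * (y n)\<^sup>2" and "b = 2 * t * ?Q"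
  have ab: "a \<ge> 0" "b \<ge> 0" "a + b < 1"
    using Suc.prems by (auto simp: a_def b_def algebra_simps sum_nonneg)
  have "(1 - (a + b)) * (1 + a) > 0" using ab by (intro mult_pos_pos) auto
  moreover have "b * (1 + a) = 1 - a * a - (1 - (a + b)) * (1 + a)" by (simp add: algebra_simps)
  ultimately have b1: "b * (1 + a) < 1" using zero_le_square[of a] by linarith
  define t' where "t' = t * (1 + a)"
  have t': "t' \<ge> 0" "2 * t' * ?Q = b * (1 + a)" using Suc.prems ab by (auto simp: t'_def b_def)
  have IH: "sgn_avg n (\<lambda>g. exp (t' * (?X g)\<^sup>2)) \<le> exp (t' * ?Q / (1 - 2 * t' * ?Q))"
    using t' b1 by (intro Suc.IH) auto
  have "sgn_avg (Suc n) (\<lambda>g. exp (t * (\<Sum>i<Suc n. g i * y i)\<^sup>2)) =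
     sgn_avg n (\<lambda>g. (exp (t * (?X g + y n)\<^sup>2) + exp (t * (?X g - y n)\<^sup>2)) / 2)"
    unfolding sgn_avg_Suc by simp
  also have "\<dots> \<le> sgn_avg n (\<lambda>g. exp (t * (y n)\<^sup>2) * exp (t' * (?X g)\<^sup>2))"
  proof (rule sgn_avg_mono)
    fix g
    let ?u = "2 * t * ?X g * y n"
    have "(exp (t * (?X g + y n)\<^sup>2) + exp (t * (?X g - y n)\<^sup>2)) / 2
      = exp (t * (y n)\<^sup>2) * (exp (t * (?X g)\<^sup>2) * ((exp ?u + exp (- ?u)) / 2))"
      by (simp add: exp_add[symmetric] power2_eq_square field_simps)
    also have "\<dots> \<le> exp (t * (y n)\<^sup>2) * (exp (t * (?X g)\<^sup>2) * exp (?u\<^sup>2 / 2))"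
      by (intro mult_left_mono cosh_le_exp_square) auto
    also have "exp (t * (?X g)\<^sup>2) * exp (?u\<^sup>2 / 2) = exp (t' * (?X g)\<^sup>2)"
      by (simp add: exp_add[symmetric] t'_def a_def power2_eq_square algebra_simps)
    finally show "(exp (t * (?X g + y n)\<^sup>2) + exp (t * (?X g - y n)\<^sup>2)) / 2
        \<le> exp (t * (y n)\<^sup>2) * exp (t' * (?X g)\<^sup>2)" .
  qed
  also have "\<dots> = exp (t * (y n)\<^sup>2) * sgn_avg n (\<lambda>g. exp (t' * (?X g)\<^sup>2))" by (rule sgn_avg_cmult)
  also have "\<dots> \<le> exp (t * (y n)\<^sup>2) * exp (t' * ?Q / (1 - 2 * t' * ?Q))"
    using IH by (intro mult_left_mono) auto
  also have "\<dots> = exp ((a + b * (1 + a) / (1 - b * (1 + a))) / 2)"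
    using t'(2) by (simp add: exp_add[symmetric] a_def field_simps)
  also have "\<dots> \<le> exp (((a + b) / (1 - (a + b))) / 2)"
  proof -
    have pos: "0 < 1 - (a + b)" "0 < 1 - b * (1 + a)" using ab b1 by auto
    have "(1 - (a + b)) * (1 - b * (1 + a)) \<le> (1 - b) * 1"
      using ab pos by (intro mult_mono) auto
    then have "a * ((1 - (a + b)) * (1 - b * (1 + a))) \<le> a * (1 - b)"
      using ab by (intro mult_left_mono) auto
    also have "\<dots> = (a + b) * (1 - b * (1 + a)) - b * (1 + a) * (1 - (a + b))" by (simp add: algebra_simps)
    finally have "a + b * (1 + a) / (1 - b * (1 + a)) \<le> (a + b) / (1 - (a + b))"
      using pos by (simp add: divide_simps) (simp add: algebra_simps)
    then show ?thesis by (intro iffD2[OF exp_le_cancel_iff] divide_right_mono) auto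
  qed
  also have "((a + b) / (1 - (a + b))) / 2 = t * (\<Sum>i<Suc n. (y i)\<^sup>2) / (1 - 2 * t * (\<Sum>i<Suc n. (y i)\<^sup>2))"
  proof -
    have eq: "a + b = 2 * (t * (\<Sum>i<Suc n. (y i)\<^sup>2))" by (simp add: a_def b_def algebra_simps)
    have "2 * z / (1 - 2 * z) / 2 = z / (1 - 2 * z)" for z :: real by (cases "1 - 2 * z = 0") (auto simp: field_simps)
    then show ?thesis unfolding eq by (simp only: mult.assoc)
  qed
  finally show ?case .
qed simp

subsection \<open>Widths of Euclidean balls in the sup norm\<close>

lemma sgn_avg_nonneg: "(\<And>g. 0 \<le> h g) \<Longrightarrow> 0 \<le> sgn_avg n h"
  using sgn_avg_mono[of "\<lambda>_. 0" h n] by simp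

text \<open>Union bound in the form of exponential moments: all moments together have average below
  1, so for some matrix their sum is below 1, and then each single one yields its
  inequality.\<close>

lemma exists_sign_matrix:
  fixes y :: "'t \<Rightarrow> nat \<Rightarrow> real" and b :: "'k \<Rightarrow> nat \<Rightarrow> real"
  assumes T: "finite T" and K: "finite K" and D: "D > 0"
    and b: "\<And>k. k \<in> K \<Longrightarrow> (\<Sum>i<N. (b k i)\<^sup>2) \<le> D"
    and union_bound: "card T * exp (- real m / 11) + card K * exp (- real m) < 1"
  shows "\<exists>G. (\<forall>t\<in>T. real m / 4 * (\<Sum>i<N. (y t i)\<^sup>2) \<le> (\<Sum>j<m. (\<Sum>i<N. G j i * y t i)\<^sup>2)) \<and>
    (\<forall>k\<in>K. (\<Sum>j<m. (\<Sum>i<N. G j i * b k i)\<^sup>2) \<le> 6 * real m * D)"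
proof -
  define Q where "Q = (\<lambda>t. \<Sum>i<N. (y t i)\<^sup>2)"
  \<comment> \<open>Zero vectors are set aside because \<open>f1\<close> divides by
    \<open>Q t\<close>; for them the lower bound is trivial.\<close>
  define T' where "T' = {t \<in> T. Q t > 0}"
  \<comment> \<open>The average is at most \<open>10/11 \<le> exp (- 1/11)\<close> per row, and a
    product over \<open>m\<close> rows below 1 means that the sum of squares exceeds
    \<open>m / 4 * Q t\<close>.\<close>
  define f1 where "f1 = (\<lambda>t g. exp (1 / 12 - (\<Sum>i<N. g i * y t i)\<^sup>2 / (3 * Q t)))"
  \<comment> \<open>The weight \<open>1 / (4 * D)\<close> makes the exponential moment at most
    \<open>exp (1/2)\<close>, hence the average at most \<open>exp (- 1)\<close> per row; a product
    below 1 means a sum of squares below \<open>6 * m * D\<close>.\<close>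
  define f2 where "f2 = (\<lambda>k g. exp (- 3 / 2) * exp (1 / (4 * D) * (\<Sum>i<N. g i * b k i)\<^sup>2))"
  define h where "h = (\<lambda>G. (\<Sum>t\<in>T'. \<Prod>j<m. f1 t (G j)) + (\<Sum>k\<in>K. \<Prod>j<m. f2 k (G j)))"
  have T': "finite T'" "card T' \<le> card T" using T by (auto simp: T'_def intro: card_mono)
  have f1: "(sgn_avg N (f1 t)) ^ m \<le> exp (- real m / 11)" if "t \<in> T'" for t
  proof -
    have "sgn_avg N (f1 t) \<le> 10 / 11"
      using that unfolding f1_def T'_def by (intro sgn_avg_exp_neg_square) (auto simp: Q_def)
    also have "\<dots> \<le> exp (- 1 / 11)" using exp_ge_add_one_self[of "- 1 / 11"] by simp
    finally have "(sgn_avg N (f1 t)) ^ m \<le> exp (- 1 / 11) ^ m"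
      by (intro power_mono sgn_avg_nonneg) (auto simp: f1_def)
    also have "\<dots> = exp (- real m / 11)" by (simp add: exp_of_nat_mult[symmetric])
    finally show ?thesis .
  qed
  have f2: "(sgn_avg N (f2 k)) ^ m \<le> exp (- real m)" if "k \<in> K" for k
  proof -
    define z where "z = 1 / (4 * D) * (\<Sum>i<N. (b k i)\<^sup>2)"
    have z: "z \<le> 1 / 4" using b[OF that] D by (simp add: z_def field_simps)
    have "sgn_avg N (f2 k) = exp (- 3 / 2) * sgn_avg N (\<lambda>g. exp (1 / (4 * D) * (\<Sum>i<N. g i * b k i)\<^sup>2))"
      unfolding f2_def by (rule sgn_avg_cmult)
    also have "\<dots> \<le> exp (- 3 / 2) * exp (1 / (4 * D) * (\<Sum>i<N. (b k i)\<^sup>2) / (1 - 2 * (1 / (4 * D)) * (\<Sum>i<N. (b k i)\<^sup>2)))"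
      using D z by (intro mult_left_mono sgn_avg_exp_square) (auto simp: z_def)
    also have "\<dots> = exp (- 3 / 2) * exp (z / (1 - 2 * z))"
      by (simp add: z_def mult.assoc)
    also have "\<dots> \<le> exp (- 3 / 2) * exp (1 / 2)"
      using z by (intro mult_left_mono iffD2[OF exp_le_cancel_iff]) (auto simp: field_simps)
    also have "\<dots> = exp (- 1)" by (simp add: exp_add[symmetric])
    finally have "(sgn_avg N (f2 k)) ^ m \<le> exp (- 1) ^ m"
      by (intro power_mono sgn_avg_nonneg) (auto simp: f2_def)
    then show ?thesis by (simp add: exp_of_nat_mult[symmetric])
  qed
  have "mat_avg N m h = (\<Sum>t\<in>T'. (sgn_avg N (f1 t)) ^ m) + (\<Sum>k\<in>K. (sgn_avg N (f2 k)) ^ m)"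
    unfolding h_def mat_avg_add by (simp add: mat_avg_sum T' K mat_avg_prod)
  also have "\<dots> \<le> card T' * exp (- real m / 11) + card K * exp (- real m)"
    using f1 f2 by (intro add_mono sum_bounded_above) auto
  also have "\<dots> \<le> card T * exp (- real m / 11) + card K * exp (- real m)"
    using T' by (intro add_mono mult_right_mono) auto
  also have "\<dots> < 1" by (rule union_bound)
  finally obtain G where G: "h G < 1" using mat_avg_less_exists by blast
  have nn: "(\<Sum>t\<in>T'. \<Prod>j<m. f1 t (G j)) \<ge> 0" "(\<Sum>k\<in>K. \<Prod>j<m. f2 k (G j)) \<ge> 0"
    by (auto simp: f1_def f2_def intro!: sum_nonneg prod_nonneg)
  have "real m / 4 * Q t \<le> (\<Sum>j<m. (\<Sum>i<N. G j i * y t i)\<^sup>2)" if "t \<in> T" for t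
  proof (cases "t \<in> T'")
    case True
    then have Q: "Q t > 0" by (simp add: T'_def)
    have "(\<Prod>j<m. f1 t (G j)) \<le> (\<Sum>t\<in>T'. \<Prod>j<m. f1 t (G j))"
      using T' True by (intro member_le_sum) (auto simp: f1_def intro!: prod_nonneg)
    then have "(\<Prod>j<m. f1 t (G j)) < 1" using G nn by (simp add: h_def)
    then have "exp (\<Sum>j<m. 1 / 12 - (\<Sum>i<N. G j i * y t i)\<^sup>2 / (3 * Q t)) < 1"
      by (simp only: f1_def exp_sum[OF finite_lessThan])
    then have "real m / 12 < (\<Sum>j<m. (\<Sum>i<N. G j i * y t i)\<^sup>2) / (3 * Q t)"
      by (simp add: sum_subtractf sum_divide_distrib)
    then show ?thesis using Q by (simp add: field_simps)
  next
    case False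
    then have "Q t \<le> 0" using that by (auto simp: T'_def)
    then have "real m / 4 * Q t \<le> 0" by (intro mult_nonneg_nonpos) auto
    also have "\<dots> \<le> (\<Sum>j<m. (\<Sum>i<N. G j i * y t i)\<^sup>2)" by (intro sum_nonneg) auto
    finally show ?thesis .
  qed
  moreover have "(\<Sum>j<m. (\<Sum>i<N. G j i * b k i)\<^sup>2) \<le> 6 * real m * D" if "k \<in> K" for k
  proof -
    have "(\<Prod>j<m. f2 k (G j)) \<le> (\<Sum>k\<in>K. \<Prod>j<m. f2 k (G j))"
      using K that by (intro member_le_sum) (auto simp: f2_def intro!: prod_nonneg)
    then have "(\<Prod>j<m. f2 k (G j)) < 1" using G nn by (simp add: h_def)
    then have "exp (\<Sum>j<m. - 3 / 2 + 1 / (4 * D) * (\<Sum>i<N. G j i * b k i)\<^sup>2) < 1"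
      by (simp only: f2_def exp_sum[OF finite_lessThan] exp_add[symmetric])
    then have "1 / (4 * D) * (\<Sum>j<m. (\<Sum>i<N. G j i * b k i)\<^sup>2) < 3 / 2 * real m"
      by (simp only: sum.distrib sum_distrib_left[symmetric] exp_less_one_iff) simp
    then show ?thesis using D by (simp add: field_simps)
  qed
  ultimately show ?thesis unfolding Q_def by blast
qed

lemma exists_le_weighted_average:
  fixes f :: "'k \<Rightarrow> real"
  assumes "finite K" "\<And>k. k \<in> K \<Longrightarrow> c k \<ge> 0" "sum c K = 1" "(\<Sum>k\<in>K. c k * f k) \<le> r"
  shows "\<exists>k\<in>K. f k \<le> r"
proof (rule ccontr)
  assume "\<not> ?thesis"
  then have less: "\<And>k. k \<in> K \<Longrightarrow> r < f k" by auto
  obtain k where k: "k \<in> K" "c k > 0"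
    using assms(2,3) by (metis less_eq_real_def sum.neutral zero_neq_one)
  have "r = (\<Sum>k\<in>K. c k * r)" using assms(3) by (simp add: sum_distrib_right[symmetric])
  also have "\<dots> < (\<Sum>k\<in>K. c k * f k)"
  proof (rule sum_strict_mono_ex1[OF assms(1)])
    show "\<forall>k\<in>K. c k * r \<le> c k * f k" using assms(2) less by (meson mult_left_mono less_imp_le)
    show "\<exists>k\<in>K. c k * r < c k * f k" using less k by (intro bexI[of _ k]) auto
  qed
  finally show False using assms(4) by simp
qed

text \<open>Maurey sampling without probability: as \<open>y\<close> is the \<open>c\<close>-mean of
  the vectors \<open>B k\<close>, the cross term vanishes on average, so some next sample raises the
  squared error of the sum by at most \<open>R\<close>. Samples form a list because repetitions must
  be allowed.\<close>

lemma maurey_empirical: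
  fixes B :: "'k \<Rightarrow> 'i \<Rightarrow> real"
  assumes K: "finite K" and c: "\<And>k. k \<in> K \<Longrightarrow> c k \<ge> 0" "sum c K = 1"
    and R: "\<And>k. k \<in> K \<Longrightarrow> (\<Sum>i\<in>I. (B k i)\<^sup>2) \<le> R"
    and y: "\<And>i. y i = (\<Sum>k\<in>K. c k * B k i)"
  shows "\<exists>xs. length xs = s \<and> set xs \<subseteq> K \<and> (\<Sum>i\<in>I. (\<Sum>k\<leftarrow>xs. y i - B k i)\<^sup>2) \<le> real s * R"
proof (induction s)
  case 0
  then show ?case by auto
next
  case (Suc s)
  then obtain xs where xs: "length xs = s" "set xs \<subseteq> K"
    "(\<Sum>i\<in>I. (\<Sum>k\<leftarrow>xs. y i - B k i)\<^sup>2) \<le> real s * R" by blast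
  let ?w = "\<lambda>i. \<Sum>k\<leftarrow>xs. y i - B k i"
  have pt: "(\<Sum>k\<in>K. c k * (y i - B k i + ?w i)\<^sup>2) \<le> (?w i)\<^sup>2 + (\<Sum>k\<in>K. c k * (B k i)\<^sup>2)" for i
  proof -
    have e1: "(y i - B k i + ?w i)\<^sup>2 = (y i + ?w i)\<^sup>2 - 2 * (y i + ?w i) * B k i + (B k i)\<^sup>2" for k
      by (simp add: power2_eq_square algebra_simps)
    have "(\<Sum>k\<in>K. c k * (y i - B k i + ?w i)\<^sup>2) =
       (\<Sum>k\<in>K. (y i + ?w i)\<^sup>2 * c k - 2 * (y i + ?w i) * (c k * B k i) + c k * (B k i)\<^sup>2)"
      unfolding e1 by (intro sum.cong) (auto simp: algebra_simps)
    also have "\<dots> = (y i + ?w i)\<^sup>2 * sum c K - 2 * (y i + ?w i) * y i + (\<Sum>k\<in>K. c k * (B k i)\<^sup>2)"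
      unfolding sum.distrib sum_subtractf sum_distrib_left[symmetric] y ..
    also have "\<dots> = (?w i)\<^sup>2 - (y i)\<^sup>2 + (\<Sum>k\<in>K. c k * (B k i)\<^sup>2)"
      using c(2) by (simp add: power2_eq_square algebra_simps)
    finally show ?thesis by simp
  qed
  have "(\<Sum>k\<in>K. c k * (\<Sum>i\<in>I. (y i - B k i + ?w i)\<^sup>2)) = (\<Sum>i\<in>I. \<Sum>k\<in>K. c k * (y i - B k i + ?w i)\<^sup>2)"
    by (simp only: sum_distrib_left) (rule sum.swap)
  also have "\<dots> \<le> (\<Sum>i\<in>I. (?w i)\<^sup>2 + (\<Sum>k\<in>K. c k * (B k i)\<^sup>2))" by (intro sum_mono pt)
  also have "\<dots> = (\<Sum>i\<in>I. (?w i)\<^sup>2) + (\<Sum>k\<in>K. c k * (\<Sum>i\<in>I. (B k i)\<^sup>2))"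
    by (simp only: sum_distrib_left sum.distrib) (subst sum.swap, rule refl)
  also have "\<dots> \<le> real s * R + (\<Sum>k\<in>K. c k * R)"
    using c R xs(3) by (intro add_mono sum_mono mult_left_mono) auto
  also have "(\<Sum>k\<in>K. c k * R) = R" using c(2) by (simp flip: sum_distrib_right)
  also have "real s * R + R = real (Suc s) * R" by (simp flip: sum_distrib_right add: algebra_simps)
  finally have "\<exists>k\<in>K. (\<Sum>i\<in>I. (y i - B k i + ?w i)\<^sup>2) \<le> real (Suc s) * R"
    by (intro exists_le_weighted_average[where c = c] K c)
  then obtain k where k: "k \<in> K" "(\<Sum>i\<in>I. (y i - B k i + ?w i)\<^sup>2) \<le> real (Suc s) * R" by blast
  then show ?case using xs by (intro exI[of _ "k # xs"]) auto
qed

lemma sum_list_sum_swap: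
  fixes f :: "'a \<Rightarrow> 'b \<Rightarrow> real"
  shows "(\<Sum>k\<leftarrow>xs. \<Sum>l\<in>A. f k l) = (\<Sum>l\<in>A. \<Sum>k\<leftarrow>xs. f k l)"
  by (induction xs) (simp_all add: sum.distrib)

text \<open>
  Maurey sampling is applied to the vectors \<open>(b k, G (b k))\<close>, so that the kernel condition
  survives approximately for a sparse average, and on the finitely many sparse averages \<open>G\<close> is
  bounded from below.
\<close>

lemma kernel_section_short:
  fixes b :: "'k \<Rightarrow> nat \<Rightarrow> real"
  assumes K: "finite K" and D: "D > 0" and s: "s > 0" and m: "m > 0"
    and b: "\<And>k. k \<in> K \<Longrightarrow> (\<Sum>i<N. (b k i)\<^sup>2) \<le> D"
    and union_bound: "real (card K) ^ s * exp (- real m / 11) + card K * exp (- real m) < 1"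
  shows "\<exists>G. \<forall>c. (\<forall>k\<in>K. c k \<ge> 0) \<longrightarrow> sum c K = 1 \<longrightarrow>
     (\<forall>j<m. (\<Sum>k\<in>K. c k * (\<Sum>i<N. G j i * b k i)) = 0) \<longrightarrow>
     (\<Sum>i<N. (\<Sum>k\<in>K. c k * b k i)\<^sup>2) \<le> 100 * D / s"
proof -
  \<comment> \<open>All samples of size \<open>s\<close>: their number \<open>card K ^ s\<close> is
    what the union bound has to afford.\<close>
  define T where "T = {xs. set xs \<subseteq> K \<and> length xs = s}"
  have T: "finite T" "card T = card K ^ s"
    using K by (auto simp: T_def finite_lists_length_eq card_lists_length_eq)
  define z where "z = (\<lambda>xs i. \<Sum>k\<leftarrow>xs. b k i)"
  obtain G where G: "\<And>xs. xs \<in> T \<Longrightarrow> real m / 4 * (\<Sum>i<N. (z xs i)\<^sup>2) \<le> (\<Sum>j<m. (\<Sum>i<N. G j i * z xs i)\<^sup>2)"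
    "\<And>k. k \<in> K \<Longrightarrow> (\<Sum>j<m. (\<Sum>i<N. G j i * b k i)\<^sup>2) \<le> 6 * real m * D"
  proof -
    have "\<exists>G. (\<forall>xs\<in>T. real m / 4 * (\<Sum>i<N. (z xs i)\<^sup>2) \<le> (\<Sum>j<m. (\<Sum>i<N. G j i * z xs i)\<^sup>2)) \<and>
      (\<forall>k\<in>K. (\<Sum>j<m. (\<Sum>i<N. G j i * b k i)\<^sup>2) \<le> 6 * real m * D)"
      by (rule exists_sign_matrix) (use T K D b union_bound in auto)
    then show ?thesis using that by blast
  qed
  \<comment> \<open>Division by \<open>sqrt (6 * m)\<close> makes the squared norm of the
    \<open>G\<close>-part at most \<open>D\<close> as well, so the joint vector has squared norm at
    most \<open>2 * D\<close>.\<close>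
  define BB where "BB = (\<lambda>k i. case i of Inl i \<Rightarrow> b k i | Inr j \<Rightarrow> (\<Sum>i<N. G j i * b k i) / sqrt (6 * m))"
  have BB: "(\<Sum>i\<in>{..<N} <+> {..<m}. (BB k i)\<^sup>2) \<le> 2 * D" if "k \<in> K" for k
  proof -
    have "(\<Sum>j<m. (\<Sum>i<N. G j i * b k i)\<^sup>2) / (6 * m) \<le> D" using G(2)[OF that] m by (simp add: field_simps)
    then show ?thesis using b[OF that]
      by (simp add: sum.Plus BB_def power_divide sum_divide_distrib[symmetric])
  qed
  have "(\<Sum>i<N. (\<Sum>k\<in>K. c k * b k i)\<^sup>2) \<le> 100 * D / s"
    if c: "\<forall>k\<in>K. c k \<ge> 0" "sum c K = 1" "\<forall>j<m. (\<Sum>k\<in>K. c k * (\<Sum>i<N. G j i * b k i)) = 0" for c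
  proof -
    define y where "y = (\<lambda>i. \<Sum>k\<in>K. c k * BB k i)"
    obtain xs where xs: "length xs = s" "set xs \<subseteq> K"
      "(\<Sum>i\<in>{..<N} <+> {..<m}. (\<Sum>k\<leftarrow>xs. y i - BB k i)\<^sup>2) \<le> real s * (2 * D)"
    proof -
      have "\<exists>xs. length xs = s \<and> set xs \<subseteq> K \<and>
          (\<Sum>i\<in>{..<N} <+> {..<m}. (\<Sum>k\<leftarrow>xs. y i - BB k i)\<^sup>2) \<le> real s * (2 * D)"
        by (rule maurey_empirical[where c = c]) (use K c BB y_def in auto)
      then show ?thesis using that by blast
    qed
    have yr: "y (Inr j) = 0" if "j < m" for j
    proof -
      have "y (Inr j) = (\<Sum>k\<in>K. c k * (\<Sum>i<N. G j i * b k i)) / sqrt (6 * m)"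
        unfolding y_def BB_def sum.case sum_divide_distrib[of _ K] by simp
      then show ?thesis using c(3) that by simp
    qed
    have l: "(\<Sum>k\<leftarrow>xs. y (Inl i) - BB k (Inl i)) = s * y (Inl i) - z xs i" for i
      using xs(1) by (simp add: sum_list_subtractf BB_def z_def sum_list_triv)
    have zG: "(\<Sum>k\<leftarrow>xs. (\<Sum>i<N. G j i * b k i) / q) = (\<Sum>i<N. G j i * z xs i) / q" for j q
    proof -
      have "(\<Sum>k\<leftarrow>xs. (\<Sum>i<N. G j i * b k i) / q) = (\<Sum>k\<leftarrow>xs. \<Sum>i<N. G j i * b k i) / q"
        by (induction xs) (auto simp: add_divide_distrib)
      then show ?thesis by (simp add: sum_list_sum_swap z_def sum_list_const_mult)
    qed
    have r: "(\<Sum>k\<leftarrow>xs. y (Inr j) - BB k (Inr j)) = - ((\<Sum>i<N. G j i * z xs i) / sqrt (6 * m))" if "j < m" for j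
    proof -
      have "(\<Sum>k\<leftarrow>xs. - f k) = - (\<Sum>k\<leftarrow>xs. f k)" for f :: "'k \<Rightarrow> real"
        by (induction xs) auto
      then show ?thesis using yr[OF that] zG[of j "sqrt (6 * m)"] by (simp add: BB_def)
    qed
    have "(\<Sum>i<N. (s * y (Inl i) - z xs i)\<^sup>2) + (\<Sum>j<m. (\<Sum>i<N. G j i * z xs i)\<^sup>2) / (6 * m) \<le> s * (2 * D)"
      
    proof -
      have "(\<Sum>j<m. (\<Sum>k\<leftarrow>xs. y (Inr j) - BB k (Inr j))\<^sup>2) = (\<Sum>j<m. (\<Sum>i<N. G j i * z xs i)\<^sup>2 / (6 * m))"
        by (intro sum.cong refl) (simp only: lessThan_iff r power2_minus power_divide, simp)
      then show ?thesis using xs(3) by (simp add: sum.Plus l flip: sum_divide_distrib)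
    qed
    moreover have nn: "(\<Sum>i<N. (s * y (Inl i) - z xs i)\<^sup>2) \<ge> 0" "(\<Sum>j<m. (\<Sum>i<N. G j i * z xs i)\<^sup>2) / (6 * m) \<ge> 0"
      by (auto intro!: sum_nonneg divide_nonneg_nonneg)
    ultimately have 1: "(\<Sum>i<N. (s * y (Inl i) - z xs i)\<^sup>2) \<le> s * (2 * D)"
      and 2: "(\<Sum>j<m. (\<Sum>i<N. G j i * z xs i)\<^sup>2) / (6 * m) \<le> s * (2 * D)" by linarith+
    have "xs \<in> T" using xs by (auto simp: T_def)
    from G(1)[OF this] have "real m * (\<Sum>i<N. (z xs i)\<^sup>2) \<le> 4 * (\<Sum>j<m. (\<Sum>i<N. G j i * z xs i)\<^sup>2)"
      by simp
    also have "\<dots> \<le> 4 * (12 * real m * s * D)" using 2 m by (simp add: field_simps)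
    finally have "real m * (\<Sum>i<N. (z xs i)\<^sup>2) \<le> real m * (48 * s * D)" by (simp add: mult_ac)
    then have 3: "(\<Sum>i<N. (z xs i)\<^sup>2) \<le> 48 * s * D" using m by simp
    \<comment> \<open>The sample sum \<open>z\<close> is short because \<open>G\<close> is bounded
      below on it and nearly kills it; adding the sampling error gives
      \<open>2 * 2 + 2 * 48 = 100\<close>.\<close>
    have "s\<^sup>2 * (\<Sum>i<N. (y (Inl i))\<^sup>2) \<le> (\<Sum>i<N. 2 * (s * y (Inl i) - z xs i)\<^sup>2 + 2 * (z xs i)\<^sup>2)"
    proof -
      have "(s * y (Inl i))\<^sup>2 \<le> 2 * (s * y (Inl i) - z xs i)\<^sup>2 + 2 * (z xs i)\<^sup>2" for i
        using zero_le_power2[of "s * y (Inl i) - 2 * z xs i"] by (simp add: power2_eq_square algebra_simps)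
      then show ?thesis by (simp add: sum_distrib_left power_mult_distrib[symmetric] sum_mono)
    qed
    also have "\<dots> \<le> 100 * s * D" using 1 3 by (simp add: sum.distrib sum_distrib_left[symmetric])
    finally have "(\<Sum>i<N. (y (Inl i))\<^sup>2) \<le> 100 * D / s" using s by (simp add: power2_eq_square field_simps)
    then show ?thesis by (simp add: y_def BB_def)
  qed
  then show ?thesis by blast
qed

text \<open>The vectors \<open>v\<close> dominated by \<open>R^2\<close> times the quadratic form of
  \<open>\<Gamma>\<close> are the values on \<open>K\<close> of functions from an \<open>L_2\<close>
  ball of radius \<open>R\<close>. The random functionals \<open>u\<close> are fixed before
  \<open>v\<close> and \<open>R\<close>; the functionals on \<open>K\<close> that annihilate all
  \<open>u i\<close> have small \<open>\<Gamma>\<close>-norm by \<open>kernel_section_short\<close>,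
  and duality converts this into an approximant.\<close>

lemma gram_width:
  fixes \<Gamma> :: "'k \<Rightarrow> 'k \<Rightarrow> real"
  assumes K: "finite K" "K \<noteq> {}" and m: "m > 0" and D: "D > 0" "\<And>k. k \<in> K \<Longrightarrow> \<Gamma> k k \<le> D"
    and sym: "\<And>k l. \<Gamma> k l = \<Gamma> l k"
    and psd: "\<And>c. 0 \<le> (\<Sum>k\<in>K. \<Sum>l\<in>K. c k * c l * \<Gamma> k l)"
  shows "\<exists>u :: nat \<Rightarrow> 'k \<Rightarrow> real. \<forall>v R. R \<ge> 0 \<longrightarrow>
    (\<forall>c. (\<Sum>k\<in>K. c k * v k)\<^sup>2 \<le> R\<^sup>2 * (\<Sum>k\<in>K. \<Sum>l\<in>K. c k * c l * \<Gamma> k l)) \<longrightarrow>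
    (\<exists>w. \<forall>k\<in>K. \<bar>v k - (\<Sum>i<m. w i * u i k)\<bar> \<le> 70 * R * sqrt (D * ln (2 * real (card K)) / m))"
proof -
  define M where "M = card K"
  define L where "L = ln (2 * real M)"
  have M: "M \<ge> 1" using K by (simp add: M_def Suc_leI card_gt_0_iff)
  have L: "L > 0" "exp L = 2 * real M" using M by (auto simp: L_def)
  show ?thesis
  proof (cases "real m < 22 * L")
    case True
    \<comment> \<open>For few functions zero is good enough: testing with a unit vector gives
      \<open>\<bar>v k\<bar> \<le> R * sqrt D\<close>, and \<open>m < 22 * L\<close>.\<close>
    have "\<bar>v k - (\<Sum>i<m. 0 * 0)\<bar> \<le> 70 * R * sqrt (D * L / m)"
      if R: "R \<ge> 0" and v: "\<forall>c. (\<Sum>k\<in>K. c k * v k)\<^sup>2 \<le> R\<^sup>2 * (\<Sum>k\<in>K. \<Sum>l\<in>K. c k * c l * \<Gamma> k l)" and k: "k \<in> K"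
      for v R k
    proof -
      let ?c = "\<lambda>j. if j = k then 1 else (0::real)"
      have "(\<Sum>j\<in>K. ?c j * v j)\<^sup>2 \<le> R\<^sup>2 * (\<Sum>j\<in>K. \<Sum>l\<in>K. ?c j * ?c l * \<Gamma> j l)" using v by (rule spec)
      moreover have "(\<Sum>j\<in>K. ?c j * v j) = v k"
        using K(1) k by (simp add: if_distrib[of "\<lambda>x. x * _"] cong: if_cong)
      moreover have "(\<Sum>l\<in>K. ?c j * ?c l * \<Gamma> j l) = ?c j * \<Gamma> j k" for j
        using K(1) k by (simp add: if_distrib[of "\<lambda>x. x * _"] cong: if_cong)
      then have "(\<Sum>j\<in>K. \<Sum>l\<in>K. ?c j * ?c l * \<Gamma> j l) = \<Gamma> k k"
        using K(1) k by (simp add: if_distrib[of "\<lambda>x. x * _"] cong: if_cong)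
      ultimately have "(v k)\<^sup>2 \<le> R\<^sup>2 * \<Gamma> k k" by simp
      also have "\<dots> \<le> R\<^sup>2 * (D * (22 * L / m))"
      proof (rule mult_left_mono)
        have "D * 1 \<le> D * (22 * L / m)" using True m D(1) by (intro mult_left_mono) auto
        then show "\<Gamma> k k \<le> D * (22 * L / m)" using D(2)[OF k] by simp
      qed auto
      also have "\<dots> \<le> R\<^sup>2 * (4900 * (D * L / m))"
        using D L m by (intro mult_left_mono) (auto simp: field_simps intro!: divide_right_mono mult_left_mono)
      also have "\<dots> = (70 * R * sqrt (D * L / m))\<^sup>2"
        using D L by (simp add: power_mult_distrib)
      finally show ?thesis using R D L
        by (auto intro!: abs_le_square_iff[THEN iffD2, of "v k", simplified abs_of_nonneg] power2_le_imp_le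
              simp: abs_le_square_iff[symmetric])
    qed
    then show ?thesis unfolding L_def M_def by (intro exI[of _ "\<lambda>_ _. 0"]) fastforce
  next
    case False
    obtain N :: nat and b where b: "\<And>k l. k \<in> K \<Longrightarrow> l \<in> K \<Longrightarrow> \<Gamma> k l = (\<Sum>i<N. b k i * b l i)"
      using psd_imp_gram[OF K(1) sym psd] by blast
    \<comment> \<open>The largest sample size for which the \<open>(2 * M) ^ s = exp (s * L)\<close>
      samples use up at most half of the exponent \<open>m / 11\<close>.\<close>
    define s where "s = nat \<lfloor>real m / (22 * L)\<rfloor>"
    have ms: "1 \<le> real m / (22 * L)" using False L by (simp add: field_simps)
    have fl: "\<lfloor>real m / (22 * L)\<rfloor> \<ge> 1" using ms by linarith
    have s1: "s \<ge> 1" "real s = of_int \<lfloor>real m / (22 * L)\<rfloor>" using fl unfolding s_def by linarith+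
    have s2: "real s \<le> real m / (22 * L)" unfolding s1(2) by linarith
    have "real m / (22 * L) < real s + 1" unfolding s1(2) by linarith
    then have s3: "real m / (44 * L) \<le> real s" using s1(1) by (simp add: field_simps)
    \<comment> \<open>Signed copies of the vectors: convex combinations of
      \<open>\<plusminus>b k\<close> describe the whole \<open>l_1\<close> ball of functionals on
      \<open>K\<close>.\<close>
    define K' where "K' = K \<times> (UNIV :: bool set)"
    define sg where "sg = (\<lambda>p :: 'k \<times> bool. if snd p then 1 else - 1 :: real)"
    define b' where "b' = (\<lambda>p i. sg p * b (fst p) i)"
    have sg2: "sg p * sg p = 1" for p by (simp add: sg_def)
    have K': "finite K'" "card K' = 2 * M" using K by (auto simp: K'_def M_def card_cartesian_product)
    have b': "(\<Sum>i<N. (b' p i)\<^sup>2) \<le> D" if "p \<in> K'" for p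
    proof -
      have "(\<Sum>i<N. (b' p i)\<^sup>2) = (\<Sum>i<N. b (fst p) i * b (fst p) i)"
        by (intro sum.cong) (auto simp: b'_def sg_def power2_eq_square)
      also have "\<dots> = \<Gamma> (fst p) (fst p)" using that by (subst b) (auto simp: K'_def)
      also have "\<dots> \<le> D" using that D(2) by (auto simp: K'_def)
      finally show ?thesis .
    qed
    have ub: "real (card K') ^ s * exp (- real m / 11) + card K' * exp (- real m) < 1"
    proof -
      have "real (card K') ^ s = exp (s * L)" using L(2) K'(2) by (simp add: exp_of_nat_mult)
      then have "real (card K') ^ s * exp (- real m / 11) = exp (s * L - m / 11)"
        by (simp add: exp_add[symmetric])
      also have "\<dots> \<le> exp (- L)"
      proof -
        have "s * L \<le> m / 22" using s2 L by (simp add: field_simps)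
        moreover have "L \<le> m / 22" using False by simp
        ultimately show ?thesis by simp
      qed
      finally have 1: "real (card K') ^ s * exp (- real m / 11) \<le> 1 / (2 * real M)"
        using L(2) by (simp add: exp_minus field_simps)
      have "card K' * exp (- real m) = exp (L - real m)" using L(2) K'(2) by (simp add: exp_diff exp_minus field_simps)
      also have "\<dots> \<le> exp (- (2 * L))" using False L(1) by simp
      also have "\<dots> = 1 / (2 * real M)\<^sup>2" 
        using L(2) by (simp only: exp_minus exp_double inverse_eq_divide)
      also have "\<dots> \<le> 1 / (2 * real M) * (1 / 2)" using M by (simp add: power2_eq_square field_simps)
      finally have 2: "card K' * exp (- real m) \<le> 1 / (2 * real M) * (1 / 2)" .
      have 3: "1 / (2 * real M) \<le> 1 / 2" using M by (simp add: field_simps)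
      have "x + y < 1" if "x \<le> z" "y \<le> z * (1 / 2)" "z \<le> 1 / 2" for x y z :: real using that by linarith
      from this[OF 1 2 3] show ?thesis .
    qed
    have s0: "s > 0" using s1 by simp
    obtain G where G: "\<And>c. (\<forall>p\<in>K'. c p \<ge> 0) \<Longrightarrow> sum c K' = 1 \<Longrightarrow>
     (\<forall>j<m. (\<Sum>p\<in>K'. c p * (\<Sum>i<N. G j i * b' p i)) = 0) \<Longrightarrow>
     (\<Sum>i<N. (\<Sum>p\<in>K'. c p * b' p i)\<^sup>2) \<le> 100 * D / s"
    proof -
      have "\<exists>G. \<forall>c. (\<forall>p\<in>K'. c p \<ge> 0) \<longrightarrow> sum c K' = 1 \<longrightarrow>
        (\<forall>j<m. (\<Sum>p\<in>K'. c p * (\<Sum>i<N. G j i * b' p i)) = 0) \<longrightarrow>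
        (\<Sum>i<N. (\<Sum>p\<in>K'. c p * b' p i)\<^sup>2) \<le> 100 * D / s"
        by (rule kernel_section_short[OF K'(1) D(1) s0 m]) (use b' ub in auto)
      then show ?thesis using that by blast
    qed
    define u where "u = (\<lambda>j k. \<Sum>i<N. G j i * b k i)"
    have "\<exists>w. \<forall>k\<in>K. \<bar>v k - (\<Sum>i<m. w i * u i k)\<bar> \<le> 70 * R * sqrt (D * L / m)"
      if R: "R \<ge> 0" and v: "\<forall>c. (\<Sum>k\<in>K. c k * v k)\<^sup>2 \<le> R\<^sup>2 * (\<Sum>k\<in>K. \<Sum>l\<in>K. c k * c l * \<Gamma> k l)" for v R
    proof -
      define \<epsilon> where "\<epsilon> = 70 * R * sqrt (D * L / m)"
      have eps: "R\<^sup>2 * (100 * D / s) \<le> \<epsilon>\<^sup>2" "\<epsilon> \<ge> 0"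
      proof -
        have "100 * D / s \<le> 100 * D / (m / (44 * L))" using s3 s0 m L D by (intro divide_left_mono) auto
        \<comment> \<open>The constant 70 of the statement: \<open>100 * 44\<close> is at most
          \<open>70^2 = 4900\<close>.\<close>
        also have "\<dots> \<le> 4900 * (D * L / m)" using D L m by (simp add: field_simps)
        finally have "R\<^sup>2 * (100 * D / s) \<le> R\<^sup>2 * (4900 * (D * L / m))" by (intro mult_left_mono) auto
        also have "\<dots> = \<epsilon>\<^sup>2" using D L by (simp add: \<epsilon>_def power_mult_distrib)
        finally show "R\<^sup>2 * (100 * D / s) \<le> \<epsilon>\<^sup>2" .
        show "\<epsilon> \<ge> 0" using R D L by (simp add: \<epsilon>_def)
      qed
      \<comment> \<open>Each signed point gives one inequality for the coefficients
        \<open>w\<close>. Multipliers that annihilate all \<open>u i\<close> are, after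
        normalization, convex weights in the kernel section, so they cannot violate the dual
        inequality.\<close>
      have "\<exists>w. \<forall>p\<in>K'. (\<Sum>i<m. sg p * u i (fst p) * w i) \<le> \<epsilon> + sg p * v (fst p)"
      proof (rule farkas[OF K'(1)])
        fix c :: "'k \<times> bool \<Rightarrow> real"
        assume c: "\<forall>p\<in>K'. 0 \<le> c p" "\<forall>i<m. (\<Sum>p\<in>K'. c p * (sg p * u i (fst p))) = 0"
        define S where "S = sum c K'"
        have S: "S \<ge> 0" unfolding S_def using c by (intro sum_nonneg) auto
        have "\<bar>\<Sum>p\<in>K'. c p * (sg p * v (fst p))\<bar> \<le> \<epsilon> * S"
        proof (cases "S = 0")
          case True
          then have "\<forall>p\<in>K'. c p = 0" using c K'(1) by (simp add: S_def sum_nonneg_eq_0_iff)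
          then show ?thesis using True by simp
        next
          case False
          then have Sp: "S > 0" using S by simp
          define d where "d = (\<lambda>p. c p / S)"
          define e where "e = (\<lambda>k. d (k, True) - d (k, False))"
          have K'sum: "(\<Sum>p\<in>K'. d p * (sg p * f (fst p))) = (\<Sum>k\<in>K. e k * f k)" for f
            unfolding K'_def sum.cartesian_product[symmetric, of "\<lambda>k t. d (k, t) * (sg (k, t) * f k)", simplified case_prod_unfold prod.collapse]
            by (simp add: UNIV_bool sg_def e_def algebra_simps)
          have "(\<Sum>i<N. (\<Sum>p\<in>K'. d p * b' p i)\<^sup>2) \<le> 100 * D / s"
          proof (rule G)
            show "\<forall>p\<in>K'. d p \<ge> 0" using c S by (simp add: d_def)
            show "sum d K' = 1" using Sp by (simp add: d_def sum_divide_distrib[symmetric] S_def)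
            have "(\<Sum>p\<in>K'. d p * (\<Sum>i<N. G j i * b' p i)) = (\<Sum>p\<in>K'. c p * (sg p * u j (fst p))) / S" for j
              unfolding sum_divide_distrib
              by (intro sum.cong) (auto simp: d_def b'_def u_def sum_distrib_left sum_divide_distrib mult_ac)
            then show "\<forall>j<m. (\<Sum>p\<in>K'. d p * (\<Sum>i<N. G j i * b' p i)) = 0" using c(2) by simp
          qed
          moreover have "(\<Sum>p\<in>K'. d p * b' p i) = (\<Sum>k\<in>K. e k * b k i)" for i
            unfolding b'_def by (rule K'sum)
          ultimately have "(\<Sum>i<N. (\<Sum>k\<in>K. e k * b k i)\<^sup>2) \<le> 100 * D / s" by simp
          moreover have "(\<Sum>i<N. (\<Sum>k\<in>K. e k * b k i)\<^sup>2) = (\<Sum>k\<in>K. \<Sum>l\<in>K. e k * e l * \<Gamma> k l)"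
          proof -
            have "(\<Sum>i<N. (\<Sum>k\<in>K. e k * b k i)\<^sup>2) = (\<Sum>i<N. \<Sum>k\<in>K. \<Sum>l\<in>K. e k * e l * (b k i * b l i))"
              by (simp add: power2_eq_square sum_product mult_ac)
            also have "\<dots> = (\<Sum>k\<in>K. \<Sum>l\<in>K. \<Sum>i<N. e k * e l * (b k i * b l i))"
              by (subst sum.swap, intro sum.cong refl, rule sum.swap)
            also have "\<dots> = (\<Sum>k\<in>K. \<Sum>l\<in>K. e k * e l * \<Gamma> k l)"
              by (intro sum.cong refl) (simp add: b sum_distrib_left)
            finally show ?thesis .
          qed
          ultimately have le: "(\<Sum>k\<in>K. \<Sum>l\<in>K. e k * e l * \<Gamma> k l) \<le> 100 * D / s" by simp
          have "(\<Sum>k\<in>K. e k * v k)\<^sup>2 \<le> R\<^sup>2 * (\<Sum>k\<in>K. \<Sum>l\<in>K. e k * e l * \<Gamma> k l)"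
            using v by (rule spec)
          also have "\<dots> \<le> R\<^sup>2 * (100 * D / s)" by (rule mult_left_mono[OF le]) simp
          also have "\<dots> \<le> \<epsilon>\<^sup>2" by (rule eps)
          finally have "\<bar>\<Sum>k\<in>K. e k * v k\<bar> \<le> \<epsilon>"
            unfolding abs_le_square_iff[symmetric] using eps(2) by simp
          then have "\<bar>\<Sum>p\<in>K'. d p * (sg p * v (fst p))\<bar> \<le> \<epsilon>" by (simp add: K'sum)
          moreover have "(\<Sum>p\<in>K'. c p * (sg p * v (fst p))) = S * (\<Sum>p\<in>K'. d p * (sg p * v (fst p)))"
            using Sp by (simp add: d_def sum_distrib_left)
          ultimately show ?thesis using Sp by (simp add: abs_mult mult.commute)
        qed
        moreover have "(\<Sum>p\<in>K'. c p * (\<epsilon> + sg p * v (fst p))) = \<epsilon> * S + (\<Sum>p\<in>K'. c p * (sg p * v (fst p)))"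
          by (simp add: S_def sum_distrib_left sum.distrib algebra_simps)
        ultimately show "0 \<le> (\<Sum>p\<in>K'. c p * (\<epsilon> + sg p * v (fst p)))" by linarith
      qed
      then obtain w where w: "\<And>p. p \<in> K' \<Longrightarrow> (\<Sum>i<m. sg p * u i (fst p) * w i) \<le> \<epsilon> + sg p * v (fst p)" by blast
      have "\<bar>v k - (\<Sum>i<m. w i * u i k)\<bar> \<le> \<epsilon>" if "k \<in> K" for k
        using w[of "(k, True)"] w[of "(k, False)"] that by (simp add: K'_def sg_def sum_negf mult.commute abs_le_iff)
      then show ?thesis unfolding \<epsilon>_def by blast
    qed
    then show ?thesis unfolding L_def M_def by blast
  qed
qed

subsection \<open>The Bernoulli kernel of order one half\<close>

lemma nn_integral_powr_from_0:
  assumes "a > - 1" "c \<ge> 0"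
  shows "(\<integral>\<^sup>+ t. ennreal (t powr a) * indicator {0..c} t \<partial>lborel) = ennreal (c powr (a + 1) / (a + 1))"
  by (rule nn_integral_has_integral_lebesgue'[OF _ has_integral_powr_from_0[OF assms]]) auto

lemma nn_integral_powr_to_inf:
  assumes "a < - 1" "c > 0"
  shows "(\<integral>\<^sup>+ t. ennreal (t powr a) * indicator {c..} t \<partial>lborel) = ennreal (- (c powr (a + 1)) / (a + 1))"
  by (rule nn_integral_has_integral_lebesgue'[OF _ has_integral_powr_to_inf[OF assms]]) auto

text \<open>The measure whose Laplace transform at \<open>k\<close> is
  \<open>sqrt pi * k powr (- 1/2)\<close>. Writing the coefficients of the kernel in this way sums
  its conditionally convergent series in closed form under an absolutely convergent
  integral.\<close>

definition sqrt_measure :: "real measure" where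
  "sqrt_measure = density lborel (\<lambda>t. ennreal (indicator {0<..} t * t powr (- 1 / 2)))"

lemma sets_sqrt_measure [simp, measurable_cong]: "sets sqrt_measure = sets borel"
  by (simp add: sqrt_measure_def)

lemma nn_integral_sqrt_measure:
  assumes [measurable]: "f \<in> borel_measurable borel"
  shows "integral\<^sup>N sqrt_measure f = (\<integral>\<^sup>+ t. ennreal (indicator {0<..} t * t powr (- 1 / 2)) * f t \<partial>lborel)"
  unfolding sqrt_measure_def by (subst nn_integral_density) auto

lemma AE_sqrt_measure: "AE t in sqrt_measure. t > 0"
  unfolding sqrt_measure_def by (subst AE_density) (auto simp: indicator_def)

lemma nn_integral_exp_sqrt_measure:
  assumes k: "k > 0"
  shows "(\<integral>\<^sup>+ t. ennreal (exp (- k * t)) \<partial>sqrt_measure) = ennreal (sqrt pi * k powr (- 1 / 2))"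
proof -
  let ?g = "\<lambda>t :: real. ennreal (indicator {0..} t * t powr (1 / 2 - 1) / exp t)"
  have "ennreal (sqrt pi) = (\<integral>\<^sup>+ t. ?g t \<partial>lborel)"
    using Gamma_conv_nn_integral_real[of "1 / 2"] by (simp add: Gamma_one_half_real)
  also have "\<dots> = \<bar>k\<bar> * (\<integral>\<^sup>+ t. ?g (0 + k * t) \<partial>lborel)"
    using k by (intro nn_integral_real_affine) auto
  also have "(\<integral>\<^sup>+ t. ?g (0 + k * t) \<partial>lborel) =
     (\<integral>\<^sup>+ t. ennreal (k powr (- 1 / 2)) * (ennreal (indicator {0<..} t * t powr (- 1 / 2)) * ennreal (exp (- k * t))) \<partial>lborel)"
  proof (rule nn_integral_cong_AE, use AE_lborel_singleton[of 0] in eventually_elim)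
    fix t :: real assume t: "t \<noteq> 0"
    show "?g (0 + k * t) = ennreal (k powr (- 1 / 2)) * (ennreal (indicator {0<..} t * t powr (- 1 / 2)) * ennreal (exp (- k * t)))"
    proof (cases "t > 0")
      case True
      then have "k * t \<ge> 0" using k by simp
      moreover have "(k * t) powr (1 / 2 - 1) = k powr (- 1 / 2) * t powr (- 1 / 2)" by (simp add: powr_mult)
      moreover have "1 / exp (k * t) = exp (- k * t)" by (simp add: exp_minus inverse_eq_divide)
      ultimately have "?g (0 + k * t) = ennreal (k powr (- 1 / 2) * (t powr (- 1 / 2) * exp (- k * t)))"
        by (simp add: exp_minus inverse_eq_divide)
      then show ?thesis using True by (simp add: ennreal_mult)
    next
      case False
      then have "\<not> k * t \<ge> 0" using k t by (simp add: zero_le_mult_iff)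
      then show ?thesis using False by simp
    qed
  qed
  also have "\<dots> = ennreal (k powr (- 1 / 2)) * (\<integral>\<^sup>+ t. ennreal (exp (- k * t)) \<partial>sqrt_measure)"
    by (subst nn_integral_cmult) (auto simp: nn_integral_sqrt_measure)
  also have "ennreal \<bar>k\<bar> * (ennreal (k powr (- 1 / 2)) * (\<integral>\<^sup>+ t. ennreal (exp (- k * t)) \<partial>sqrt_measure)) =
      ennreal (k powr (1 / 2)) * (\<integral>\<^sup>+ t. ennreal (exp (- k * t)) \<partial>sqrt_measure)"
  proof -
    have "k * k powr (- 1 / 2) = k powr (1 / 2)" using k powr_mult_base[of k "- 1 / 2"] by simp
    then have "ennreal \<bar>k\<bar> * ennreal (k powr (- 1 / 2)) = ennreal (k powr (1 / 2))"
      using k by (simp add: ennreal_mult[symmetric])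
    then show ?thesis by (simp only: mult.assoc[symmetric])
  qed
  finally have eq: "ennreal (sqrt pi) = ennreal (k powr (1 / 2)) * (\<integral>\<^sup>+ t. ennreal (exp (- k * t)) \<partial>sqrt_measure)" .
  have "ennreal (sqrt pi * k powr (- 1 / 2)) = ennreal (k powr (- 1 / 2)) * ennreal (sqrt pi)"
    by (simp add: ennreal_mult mult.commute)
  also have "\<dots> = (ennreal (k powr (- 1 / 2)) * ennreal (k powr (1 / 2))) * (\<integral>\<^sup>+ t. ennreal (exp (- k * t)) \<partial>sqrt_measure)"
    unfolding eq by (simp add: mult.assoc)
  also have "ennreal (k powr (- 1 / 2)) * ennreal (k powr (1 / 2)) = 1"
    using k by (simp add: ennreal_mult[symmetric] powr_add[symmetric])
  finally show ?thesis by simp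
qed

text \<open>Split at \<open>t = s\<close>: the inner part contributes the factor 2, the outer part
  \<open>1 / (b - 1/2)\<close>, which is at most 2.\<close>

lemma nn_integral_min_powr_sqrt_measure:
  assumes b: "b \<ge> 1" and s: "s > 0"
  shows "(\<integral>\<^sup>+ t. ennreal (min (t powr - b) (s powr - b)) \<partial>sqrt_measure) \<le> ennreal (4 * s powr (1 / 2 - b))"
proof -
  have "(\<integral>\<^sup>+ t. ennreal (min (t powr - b) (s powr - b)) \<partial>sqrt_measure) \<le>
    (\<integral>\<^sup>+ t. ennreal (s powr - b) * (ennreal (t powr (- 1 / 2)) * indicator {0..s} t) +
       ennreal (t powr (- 1 / 2 - b)) * indicator {s..} t \<partial>lborel)"
  proof (subst nn_integral_sqrt_measure, simp, rule nn_integral_mono)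
    fix t :: real
    consider "t \<le> 0" | "0 < t" "t \<le> s" | "s < t" by linarith
    then show "ennreal (indicator {0<..} t * t powr (- 1 / 2)) * ennreal (min (t powr - b) (s powr - b)) \<le>
      ennreal (s powr - b) * (ennreal (t powr (- 1 / 2)) * indicator {0..s} t) +
       ennreal (t powr (- 1 / 2 - b)) * indicator {s..} t"
    proof cases
      case 2
      have "ennreal (t powr (- 1 / 2)) * ennreal (min (t powr - b) (s powr - b)) \<le> ennreal (t powr (- 1 / 2)) * ennreal (s powr - b)"
        by (intro mult_left_mono ennreal_leI) auto
      then show ?thesis using 2 by (auto simp: mult.commute intro: order_trans)
    next
      case 3
      have "ennreal (t powr (- 1 / 2)) * ennreal (min (t powr - b) (s powr - b)) \<le> ennreal (t powr (- 1 / 2)) * ennreal (t powr - b)"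
        by (intro mult_left_mono ennreal_leI) auto
      also have "\<dots> = ennreal (t powr (- 1 / 2 - b))"
        by (simp add: ennreal_mult[symmetric] powr_add[symmetric])
      finally show ?thesis using 3 s by simp
    qed auto
  qed
  also have "\<dots> = ennreal (s powr - b) * ennreal (s powr (- 1 / 2 + 1) / (- 1 / 2 + 1)) + ennreal (- (s powr (- 1 / 2 - b + 1)) / (- 1 / 2 - b + 1))"
    using b s nn_integral_powr_from_0[of "- 1 / 2" s] nn_integral_powr_to_inf[of "- 1 / 2 - b" s]
    by (subst nn_integral_add) (auto simp: nn_integral_cmult)
  also have "\<dots> = ennreal (s powr - b * (s powr (- 1 / 2 + 1) / (- 1 / 2 + 1)) + - (s powr (- 1 / 2 - b + 1)) / (- 1 / 2 - b + 1))"

  proof -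
    have "- (s powr (- 1 / 2 - b + 1)) / (- 1 / 2 - b + 1) \<ge> 0" using b by (intro divide_nonpos_nonpos) auto
    then show ?thesis by (subst ennreal_plus) (auto simp: ennreal_mult[symmetric])
  qed
  also have "\<dots> \<le> ennreal (4 * s powr (1 / 2 - b))"
  proof (rule ennreal_leI)
    have e: "s powr - b * s powr (1 / 2) = s powr (1 / 2 - b)" by (simp add: powr_add[symmetric])
    have "- (s powr (- 1 / 2 - b + 1)) / (- 1 / 2 - b + 1) = s powr (1 / 2 - b) / (b - 1 / 2)"
      by (simp add: minus_divide_divide[of "s powr (1 / 2 - b)" "b - 1 / 2", symmetric] del: minus_divide_divide)
    also have "\<dots> \<le> s powr (1 / 2 - b) / (1 / 2)" using b by (intro divide_left_mono) auto
    finally show "s powr - b * (s powr (- 1 / 2 + 1) / (- 1 / 2 + 1)) + - (s powr (- 1 / 2 - b + 1)) / (- 1 / 2 - b + 1) \<le> 4 * s powr (1 / 2 - b)"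
      using e by simp
  qed
  finally show ?thesis .
qed

text \<open>Distance to the singularity, measured on the unit circle: periodic and 1-Lipschitz in
  \<open>v\<close> without any case distinction modulo \<open>2 * pi\<close>.\<close>

definition chord :: "real \<Rightarrow> real" where
  "chord v = norm (1 - cis v)"

lemma chord_nonneg [simp]: "chord v \<ge> 0" by (simp add: chord_def)

lemma chord_le_2: "chord v \<le> 2"
  using norm_triangle_ineq4[of 1 "cis v"] by (simp add: chord_def)

text \<open>Damping moves \<open>z\<close> by \<open>1 - exp (- t)\<close>, which is itself at most
  the damped distance to 1; the triangle inequality then costs only a factor 2.\<close>

lemma one_minus_damped_ge:
  fixes z :: complex
  assumes z: "norm z = 1" and t: "t > 0"
  shows "norm (1 - exp (- t) *\<^sub>R z) \<ge> 1 - exp (- t)" "norm (1 - exp (- t) *\<^sub>R z) \<ge> norm (1 - z) / 2"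
proof -
  show 1: "norm (1 - exp (- t) *\<^sub>R z) \<ge> 1 - exp (- t)"
    using norm_triangle_ineq2[of 1 "exp (- t) *\<^sub>R z"] z by simp
  have "1 - z = (1 - exp (- t) *\<^sub>R z) - (1 - exp (- t)) *\<^sub>R z" by (simp add: algebra_simps)
  then have "norm (1 - z) \<le> norm (1 - exp (- t) *\<^sub>R z) + norm ((1 - exp (- t)) *\<^sub>R z)"
    by (metis norm_triangle_ineq4)
  also have "norm ((1 - exp (- t)) *\<^sub>R z) = 1 - exp (- t)" using z t by simp
  finally show "norm (1 - exp (- t) *\<^sub>R z) \<ge> norm (1 - z) / 2" using 1 by simp
qed

text \<open>Sum over \<open>k \<ge> 1\<close> of the powers \<open>(exp (- t) * z) ^ k\<close>: the
  integrand that results when the factors \<open>k powr (- 1/2)\<close> are written as Laplace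
  transforms.\<close>

definition damped :: "complex \<Rightarrow> real \<Rightarrow> complex" where
  "damped z t = exp (- t) *\<^sub>R z / (1 - exp (- t) *\<^sub>R z)"

lemma damped_measurable [measurable]: "damped z \<in> borel_measurable borel"
  unfolding damped_def by measurable

lemma exp_neg_le_div:
  assumes "t > (0::real)"
  shows "exp (- t) \<le> (1 - exp (- t)) / t"
proof -
  have "t \<le> exp t - 1" using exp_ge_add_one_self[of t] by linarith
  then have "t * exp (- t) \<le> (exp t - 1) * exp (- t)" by (intro mult_right_mono) auto
  also have "\<dots> = 1 - exp (- t)" by (simp add: algebra_simps exp_minus)
  finally show ?thesis using assms by (simp add: field_simps)
qed

lemma exp_neg_div_le_min:
  fixes z :: complex
  assumes z: "norm z = 1" "z \<noteq> 1" and t: "t > 0"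
  shows "exp (- t) / norm (1 - exp (- t) *\<^sub>R z) \<le> 2 * min (t powr - 1) (norm (1 - z) powr - 1)"
proof -
  note g = one_minus_damped_ge[OF z(1) t]
  have pos: "norm (1 - z) > 0" using z by simp
  have p: "norm (1 - exp (- t) *\<^sub>R z) > 0" using g(2) pos by linarith
  have e1: "exp (- t) < 1" using t by simp
  have "exp (- t) / norm (1 - exp (- t) *\<^sub>R z) \<le> exp (- t) / (1 - exp (- t))"
    using g(1) e1 p by (intro divide_left_mono) auto
  also have "\<dots> \<le> 1 / t" using exp_neg_le_div[OF t] e1 t by (simp add: field_simps)
  finally have 1: "exp (- t) / norm (1 - exp (- t) *\<^sub>R z) \<le> 1 / t" .
  have "exp (- t) / norm (1 - exp (- t) *\<^sub>R z) \<le> 1 / (norm (1 - z) / 2)"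
    using g(2) e1 p pos by (intro frac_le) auto
  then have 2: "exp (- t) / norm (1 - exp (- t) *\<^sub>R z) \<le> 2 * (1 / norm (1 - z))" by simp
  have "1 / t \<le> 2 * (1 / t)" using t by (simp add: field_simps)
  with 1 have "exp (- t) / norm (1 - exp (- t) *\<^sub>R z) \<le> 2 * (1 / t)" by linarith
  with 2 show ?thesis using t pos by (simp add: powr_minus_divide min_def)
qed

lemma damped_bound:
  fixes z :: complex
  assumes "norm z = 1" "z \<noteq> 1" and "t > 0"
  shows "norm (damped z t) \<le> 2 * min (t powr - 1) (norm (1 - z) powr - 1)"
  using exp_neg_div_le_min[OF assms] assms(1) by (simp add: damped_def norm_divide)

text \<open>Over a common denominator the difference is \<open>exp (- t) * (z - w)\<close> divided
  by both damped distances, each bounded below by \<open>1 - exp (- t)\<close> and by half the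
  distance of the point to 1. Taking \<open>s\<close> as the geometric mean of the two distances
  gives a bound of the form integrated before.\<close>

lemma damped_diff_bound:
  fixes z w :: complex
  assumes z: "norm z = 1" "z \<noteq> 1" and w: "norm w = 1" "w \<noteq> 1" and t: "t > 0"
    and s: "s = sqrt (norm (1 - z) * norm (1 - w))"
  shows "norm (damped z t - damped w t) \<le> 4 * norm (z - w) * min (t powr - 2) (s powr - 2)"
proof -
  note gz = one_minus_damped_ge[OF z(1) t] and gw = one_minus_damped_ge[OF w(1) t]
  let ?r = "exp (- t)"
  define A where "A = norm (1 - ?r *\<^sub>R z)"
  define B where "B = norm (1 - ?r *\<^sub>R w)"
  have pz: "norm (1 - z) > 0" and pw: "norm (1 - w) > 0" using z w by auto
  have AB: "A > 0" "B > 0" using gz(2) gw(2) pz pw unfolding A_def B_def by linarith+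
  have ne: "1 - ?r *\<^sub>R z \<noteq> 0" "1 - ?r *\<^sub>R w \<noteq> 0" using AB by (auto simp: A_def B_def)
  have "damped z t - damped w t = (?r *\<^sub>R (z - w)) / ((1 - ?r *\<^sub>R z) * (1 - ?r *\<^sub>R w))"
    unfolding damped_def using ne by (simp add: field_simps scaleR_conv_of_real)
  then have eq: "norm (damped z t - damped w t) = norm (z - w) * (?r / (A * B))"
    by (simp add: norm_divide norm_mult A_def B_def)
  have r1: "0 < 1 - ?r" using t by simp
  have "?r / (A * B) \<le> 4 * t powr - 2"
  proof -
    have "(1 - ?r) * (1 - ?r) \<le> A * B" using gz(1) gw(1) r1 unfolding A_def B_def by (intro mult_mono) auto
    then have "?r / (A * B) \<le> ?r / ((1 - ?r) * (1 - ?r))" using r1 AB by (intro divide_left_mono) auto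
    also have "\<dots> \<le> 4 / t\<^sup>2"
    proof -
      \<comment> \<open>The square root of \<open>exp (- t)\<close> is given to each of the two
        factors \<open>1 - exp (- t)\<close>, which are thereby compared with
        \<open>t / 2\<close>.\<close>
      let ?q = "exp (- (t / 2))"
      have q: "?q * ?q = ?r" by (simp add: exp_add[symmetric])
      have "?q \<le> (1 - ?q) / (t / 2)" using t by (intro exp_neg_le_div) auto
      then have "t / 2 * ?q \<le> 1 - ?q" using t by (simp add: field_simps)
      also have "\<dots> \<le> (1 - ?q) * (1 + ?q)" using t by (simp add: field_simps)
      also have "\<dots> = 1 - ?r" using q by (simp add: algebra_simps)
      finally have "(t / 2 * ?q) * (t / 2 * ?q) \<le> (1 - ?r) * (1 - ?r)" using t by (intro mult_mono) auto
      also have "(t / 2 * ?q) * (t / 2 * ?q) = t\<^sup>2 / 4 * ?r" unfolding q[symmetric] by (simp add: power2_eq_square)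
      finally show ?thesis using r1 t by (simp add: divide_simps mult_ac)
    qed
    also have "\<dots> = 4 * t powr - 2" using t by (simp add: powr_minus_divide)
    finally show ?thesis .
  qed
  moreover have "?r / (A * B) \<le> 4 * s powr - 2"
  proof -
    have "norm (1 - z) / 2 * (norm (1 - w) / 2) \<le> A * B"
      using gz(2) gw(2) unfolding A_def B_def by (intro mult_mono) auto
    then have "?r / (A * B) \<le> 1 / (norm (1 - z) / 2 * (norm (1 - w) / 2))"
      using pz pw t by (intro frac_le) auto
    also have "\<dots> = 4 / s\<^sup>2" using pz pw by (simp add: s)
    also have "\<dots> = 4 * s powr - 2" using pz pw s by (simp add: powr_minus_divide)
    finally show ?thesis .
  qed
  ultimately have "?r / (A * B) \<le> 4 * min (t powr - 2) (s powr - 2)" by (simp add: min_def)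
  then have "norm (z - w) * (?r / (A * B)) \<le> norm (z - w) * (4 * min (t powr - 2) (s powr - 2))"
    by (intro mult_left_mono) auto
  then show ?thesis unfolding eq by (simp add: mult_ac)
qed

lemma integrable_min_powr:
  assumes "b \<ge> 1" "s > 0"
  shows "integrable sqrt_measure (\<lambda>t. min (t powr - b) (s powr - b))"
    "(LINT t|sqrt_measure. min (t powr - b) (s powr - b)) \<le> 4 * s powr (1 / 2 - b)"
proof -
  note le = nn_integral_min_powr_sqrt_measure[OF assms]
  show int: "integrable sqrt_measure (\<lambda>t. min (t powr - b) (s powr - b))"
    using le by (intro integrableI_bounded) (auto simp: less_top[symmetric] top_unique)
  show "(LINT t|sqrt_measure. min (t powr - b) (s powr - b)) \<le> 4 * s powr (1 / 2 - b)"
    using le by (simp add: integral_eq_nn_integral enn2real_leI)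
qed

text \<open>On the unit circle away from 1 this is \<open>sqrt pi\<close> times the polylogarithm of
  order 1/2.\<close>

definition polylog_half :: "complex \<Rightarrow> complex" where
  "polylog_half z = (LINT t|sqrt_measure. damped z t)"

lemma integrable_damped:
  assumes "norm z = 1" "z \<noteq> 1"
  shows "integrable sqrt_measure (damped z)"
proof (rule Bochner_Integration.integrable_bound)
  show "integrable sqrt_measure (\<lambda>t. 2 * min (t powr - 1) (norm (1 - z) powr - 1))"
    using assms by (intro integrable_mult_right integrable_min_powr) auto
  show "AE t in sqrt_measure. norm (damped z t) \<le> norm (2 * min (t powr - 1) (norm (1 - z) powr - 1))"
    using AE_sqrt_measure by eventually_elim (use damped_bound[OF assms] in force)
qed auto

text \<open>The partial geometric sums equal \<open>damped z t * (1 - (exp (- t) * z) ^ n)\<close>,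
  so cancellation keeps them below twice the bound for \<open>damped\<close>. That majorant is
  integrable although the series does not converge absolutely, and dominated convergence
  applies.\<close>

lemma polylog_half_sums:
  assumes z: "norm z = 1" "z \<noteq> 1"
  shows "(\<lambda>k. (sqrt pi * real (Suc k) powr (- 1 / 2)) *\<^sub>R z ^ Suc k) sums polylog_half z"
proof -
  let ?w = "\<lambda>t. exp (- t) *\<^sub>R z"
  define s where "s = (\<lambda>n t. \<Sum>k<n. ?w t ^ Suc k)"
  have lim: "(\<lambda>n. LINT t|sqrt_measure. s n t) \<longlonglongrightarrow> (LINT t|sqrt_measure. damped z t)"
  proof (rule integral_dominated_convergence)
    show "damped z \<in> borel_measurable sqrt_measure" by simp
    show "s n \<in> borel_measurable sqrt_measure" for n unfolding s_def by measurable
    show "integrable sqrt_measure (\<lambda>t. 4 * min (t powr - 1) (norm (1 - z) powr - 1))"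
      using z by (intro integrable_mult_right integrable_min_powr) auto
    have s_eq: "s n t = damped z t * (1 - ?w t ^ n)" if "t > 0" for n t
    proof -
      have "norm (?w t) < 1" using that z by simp
      then have "?w t \<noteq> 1" by (metis less_irrefl norm_one)
      then have "(\<Sum>k<n. ?w t ^ k) = (1 - ?w t ^ n) / (1 - ?w t)" by (simp only: sum_gp_strict if_False)
      moreover have "s n t = ?w t * (\<Sum>k<n. ?w t ^ k)" by (simp add: s_def sum_distrib_left)
      ultimately show ?thesis by (simp add: damped_def)
    qed
    have wn: "norm (?w t) < 1" if "t > 0" for t using that z by simp
    show "AE t in sqrt_measure. (\<lambda>n. s n t) \<longlonglongrightarrow> damped z t"
      using AE_sqrt_measure
    proof eventually_elim
      case (elim t)
      have "(\<lambda>n. damped z t * (1 - ?w t ^ n)) \<longlonglongrightarrow> damped z t * (1 - 0)"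
        by (intro tendsto_intros LIMSEQ_power_zero wn[OF elim])
      then show ?case using s_eq[OF elim] by simp
    qed
    show "AE t in sqrt_measure. norm (s n t) \<le> 4 * min (t powr - 1) (norm (1 - z) powr - 1)" for n
      using AE_sqrt_measure
    proof eventually_elim
      case (elim t)
      have "norm (1 - ?w t ^ n) \<le> 1 + norm (?w t) ^ n"
        using norm_triangle_ineq4[of 1 "?w t ^ n"] by (simp add: norm_power power_mult_distrib)
      also have "\<dots> \<le> 2" using wn[OF elim] power_le_one[of "norm (?w t)" n] by (simp del: norm_scaleR)
      finally have "norm (damped z t) * norm (1 - ?w t ^ n) \<le> (2 * min (t powr - 1) (norm (1 - z) powr - 1)) * 2"
        using damped_bound[OF z elim] by (intro mult_mono) auto
      then show ?case using s_eq[OF elim] by (simp add: norm_mult)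
    qed
  qed
  have "(LINT t|sqrt_measure. s n t) = (\<Sum>k<n. (sqrt pi * real (Suc k) powr (- 1 / 2)) *\<^sub>R z ^ Suc k)" for n
  proof -
    have w: "?w t ^ Suc k = exp (- real (Suc k) * t) *\<^sub>R z ^ Suc k" for t k
    proof -
      have "?w t ^ Suc k = (exp (- t) ^ Suc k) *\<^sub>R z ^ Suc k" by (simp only: scaleR_power)
      also have "exp (- t) ^ Suc k = exp (- real (Suc k) * t)" by (simp only: exp_of_nat_mult[symmetric]) (simp add: algebra_simps)
      finally show ?thesis .
    qed
    have nn: "(\<integral>\<^sup>+ t. ennreal (exp (- real (Suc k) * t)) \<partial>sqrt_measure) = ennreal (sqrt pi * real (Suc k) powr (- 1 / 2))" for k
      by (rule nn_integral_exp_sqrt_measure) simp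
    have int: "integrable sqrt_measure (\<lambda>t. exp (- real (Suc k) * t))" for k
      by (rule integrableI_nonneg) (use nn[of k] in \<open>auto simp del: of_nat_Suc\<close>)
    have val: "(LINT t|sqrt_measure. exp (- real (Suc k) * t)) = sqrt pi * real (Suc k) powr (- 1 / 2)" for k
      using nn[of k] by (subst integral_eq_nn_integral) (auto simp del: of_nat_Suc)
    have "(LINT t|sqrt_measure. s n t) = (\<Sum>k<n. LINT t|sqrt_measure. ?w t ^ Suc k)"
      unfolding s_def w by (intro Bochner_Integration.integral_sum integrable_scaleR_left int)
    also have "\<dots> = (\<Sum>k<n. (sqrt pi * real (Suc k) powr (- 1 / 2)) *\<^sub>R z ^ Suc k)"
      unfolding w using int val by (intro sum.cong refl) (simp only: integral_scaleR_left)
    finally show ?thesis .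
  qed
  then show ?thesis using lim unfolding sums_def polylog_half_def by simp
qed

lemma polylog_half_bound:
  assumes z: "norm z = 1" "z \<noteq> 1"
  shows "norm (polylog_half z) \<le> 8 * norm (1 - z) powr (- 1 / 2)"
proof -
  have p: "norm (1 - z) > 0" using z by simp
  have "norm (polylog_half z) \<le> (LINT t|sqrt_measure. norm (damped z t))"
    unfolding polylog_half_def by (rule integral_norm_bound)
  also have "\<dots> \<le> (LINT t|sqrt_measure. 2 * min (t powr - 1) (norm (1 - z) powr - 1))"
  proof (rule integral_mono_AE)
    show "AE t in sqrt_measure. norm (damped z t) \<le> 2 * min (t powr - 1) (norm (1 - z) powr - 1)"
      using AE_sqrt_measure by eventually_elim (use damped_bound[OF z] in simp)
    show "integrable sqrt_measure (\<lambda>t. norm (damped z t))"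
      by (intro integrable_norm integrable_damped z)
    show "integrable sqrt_measure (\<lambda>t. 2 * min (t powr - 1) (norm (1 - z) powr - 1))"
      using p by (intro integrable_mult_right integrable_min_powr) auto
  qed
  also have "\<dots> = 2 * (LINT t|sqrt_measure. min (t powr - 1) (norm (1 - z) powr - 1))"
    by (rule integral_mult_right_zero)
  also have "\<dots> \<le> 2 * (4 * norm (1 - z) powr (1 / 2 - 1))"
    using p by (intro mult_left_mono integrable_min_powr(2)) auto
  finally show ?thesis by simp
qed

lemma polylog_half_diff_bound:
  assumes z: "norm z = 1" "z \<noteq> 1" and w: "norm w = 1" "w \<noteq> 1"
  shows "norm (polylog_half z - polylog_half w)
    \<le> 16 * norm (z - w) * (norm (1 - z) * norm (1 - w)) powr (- 3 / 4)"
proof -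
  define s where "s = sqrt (norm (1 - z) * norm (1 - w))"
  have p: "s > 0" using z w by (simp add: s_def)
  have "polylog_half z - polylog_half w = (LINT t|sqrt_measure. damped z t - damped w t)"
    unfolding polylog_half_def using integrable_damped[OF z] integrable_damped[OF w] by simp
  then have "norm (polylog_half z - polylog_half w) \<le> (LINT t|sqrt_measure. norm (damped z t - damped w t))"
    using integral_norm_bound by metis
  also have "\<dots> \<le> (LINT t|sqrt_measure. 4 * norm (z - w) * min (t powr - 2) (s powr - 2))"
  proof (rule integral_mono_AE)
    show "AE t in sqrt_measure. norm (damped z t - damped w t) \<le> 4 * norm (z - w) * min (t powr - 2) (s powr - 2)"
      using AE_sqrt_measure by eventually_elim (use damped_diff_bound[OF z w] s_def in simp)
    show "integrable sqrt_measure (\<lambda>t. norm (damped z t - damped w t))"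
      by (intro integrable_norm Bochner_Integration.integrable_diff integrable_damped z w)
    show "integrable sqrt_measure (\<lambda>t. 4 * norm (z - w) * min (t powr - 2) (s powr - 2))"
      using p by (intro integrable_mult_right integrable_min_powr) auto
  qed
  also have "\<dots> = 4 * norm (z - w) * (LINT t|sqrt_measure. min (t powr - 2) (s powr - 2))"
    by (rule integral_mult_right_zero)
  also have "\<dots> \<le> 4 * norm (z - w) * (4 * s powr (1 / 2 - 2))"
    using p by (intro mult_left_mono integrable_min_powr(2)) auto
  also have "s powr (1 / 2 - 2) = (norm (1 - z) * norm (1 - w)) powr (- 3 / 4)"
    unfolding s_def by (simp add: powr_half_sqrt[symmetric] powr_powr)
  finally show ?thesis by simp
qed

text \<open>The value at the multiples of \<open>2 * pi\<close>, where the series diverges, is normalized to \<open>0\<close>.\<close>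

definition half_kernel :: "real \<Rightarrow> real" where
  "half_kernel v = (if cis v = 1 then 0 else bernoulli_kernel1 (1 / 2) v)"

lemma chord_eq_0_iff: "chord v = 0 \<longleftrightarrow> cis v = 1"
  by (auto simp: chord_def)

lemma half_kernel_eq:
  assumes v: "chord v \<noteq> 0"
  shows "half_kernel v = 1 + 2 / sqrt pi * Re (cis (- pi / 4) * polylog_half (cis v))"
proof -
  have ne: "cis v \<noteq> 1" using v by (simp add: chord_eq_0_iff)
  have "(\<lambda>k. (sqrt pi * real (Suc k) powr (- 1 / 2)) *\<^sub>R cis v ^ Suc k) sums polylog_half (cis v)"
    by (rule polylog_half_sums) (use ne in auto)
  then have "(\<lambda>k. Re (cis (- pi / 4) * ((sqrt pi * real (Suc k) powr (- 1 / 2)) *\<^sub>R cis v ^ Suc k)))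
     sums Re (cis (- pi / 4) * polylog_half (cis v))"
    by (intro sums_Re sums_mult)
  moreover have "Re (cis (- pi / 4) * ((sqrt pi * real (Suc k) powr (- 1 / 2)) *\<^sub>R cis v ^ Suc k))
     = sqrt pi * (real (Suc k) powr (- (1 / 2)) * cos (real (Suc k) * v - 1 / 2 * pi / 2))" for k
  proof -
    have "cis (- pi / 4) * cis v ^ Suc k = cis (real (Suc k) * v - 1 / 2 * pi / 2)"
    proof -
      have "cis (- pi / 4) * cis v ^ Suc k = cis (- pi / 4) * cis (real (Suc k) * v)" by (simp only: Complex.DeMoivre)
      also have "\<dots> = cis (- pi / 4 + real (Suc k) * v)" by (rule cis_mult)
      also have "- pi / 4 + real (Suc k) * v = real (Suc k) * v - 1 / 2 * pi / 2" by simp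
      finally show ?thesis .
    qed
    then have "Re (cis (- pi / 4) * cis v ^ Suc k) = cos (real (Suc k) * v - 1 / 2 * pi / 2)"
      by (simp only: cis.simps)
    then show ?thesis by (simp only: mult_scaleR_right scaleR_complex.simps minus_divide_left mult.assoc)
  qed
  ultimately have "(\<lambda>k. sqrt pi * (real (Suc k) powr (- (1 / 2)) * cos (real (Suc k) * v - 1 / 2 * pi / 2)))
     sums Re (cis (- pi / 4) * polylog_half (cis v))" by (simp only:)
  then have "(\<lambda>k. inverse (sqrt pi) * (sqrt pi * (real (Suc k) powr (- (1 / 2)) * cos (real (Suc k) * v - 1 / 2 * pi / 2))))
     sums (inverse (sqrt pi) * Re (cis (- pi / 4) * polylog_half (cis v)))" by (rule sums_mult)
  moreover have "inverse (sqrt pi) * (sqrt pi * a) = a" for a by simp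
  ultimately have "(\<lambda>k. real (Suc k) powr (- (1 / 2)) * cos (real (Suc k) * v - 1 / 2 * pi / 2))
     sums (inverse (sqrt pi) * Re (cis (- pi / 4) * polylog_half (cis v)))" by (simp only:)
  from sums_unique[OF this] have "bernoulli_kernel1 (1 / 2) v = 1 + 2 * (inverse (sqrt pi) * Re (cis (- pi / 4) * polylog_half (cis v)))"
    unfolding bernoulli_kernel1_def by (simp only:)
  then show ?thesis using ne by (simp only: half_kernel_def if_False divide_inverse mult.assoc)
qed

lemma two_div_sqrt_pi_le: "2 / sqrt pi \<le> 2"
proof -
  have "sqrt 1 \<le> sqrt pi" using pi_gt3 by (intro real_sqrt_le_mono) linarith
  then show ?thesis by (simp add: divide_simps)
qed

lemma half_kernel_bound: "\<bar>half_kernel v\<bar> \<le> 18 * chord v powr (- 1 / 2)"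
proof (cases "chord v = 0")
  case True
  then show ?thesis by (simp add: half_kernel_def chord_eq_0_iff)
next
  case False
  then have p: "chord v > 0" by (simp add: less_le)
  have "\<bar>Re (cis (- pi / 4) * polylog_half (cis v))\<bar> \<le> norm (cis (- pi / 4) * polylog_half (cis v))"
    by (rule abs_Re_le_cmod)
  also have "\<dots> \<le> 8 * chord v powr (- 1 / 2)"
    using polylog_half_bound[of "cis v"] False by (simp add: norm_mult chord_def)
  finally have "2 / sqrt pi * \<bar>Re (cis (- pi / 4) * polylog_half (cis v))\<bar> \<le> 2 * (8 * chord v powr (- 1 / 2))"
    by (intro mult_mono two_div_sqrt_pi_le) auto
  \<comment> \<open>Absorbs the constant term 1 of the kernel, since the chord never exceeds 2;
    together with 16 from the polylogarithm this gives 18.\<close>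
  moreover have "1 \<le> 2 * chord v powr (- 1 / 2)"
  proof -
    have "chord v powr (1 / 2) \<le> 4 powr (1 / 2)" using chord_le_2[of v] p by (intro powr_mono2) auto
    also have "4 powr (1 / 2) = (2::real)" by (simp add: powr_half_sqrt)
    finally show ?thesis using p by (simp add: powr_minus field_simps)
  qed
  moreover have "\<bar>half_kernel v\<bar> \<le> 1 + 2 / sqrt pi * \<bar>Re (cis (- pi / 4) * polylog_half (cis v))\<bar>"
  proof -
    have "\<bar>1 + c * q\<bar> \<le> 1 + c * \<bar>q\<bar>" if "c \<ge> 0" for c q :: real
      using abs_triangle_ineq[of 1 "c * q"] that by (simp add: abs_mult)
    from this[of "2 / sqrt pi" "Re (cis (- pi / 4) * polylog_half (cis v))"] show ?thesis
      unfolding half_kernel_eq[OF False] by (simp only: zero_le_divide_iff) simp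
  qed
  ultimately show ?thesis by simp
qed

lemma norm_cis_diff_le: "norm (cis a - cis b) \<le> \<bar>a - b\<bar>"
proof -
  have "cis a - cis b = cis b * (cis (a - b) - 1)" by (simp add: cis_mult right_diff_distrib)
  then have "norm (cis a - cis b) = norm (exp (\<i> * of_real (a - b)) - 1)"
    by (simp add: norm_mult cis_conv_exp)
  also have "\<dots> = 2 * \<bar>sin ((a - b) / 2)\<bar>" by (rule dist_exp_i_1)
  also have "\<dots> \<le> 2 * \<bar>(a - b) / 2\<bar>" by (intro mult_left_mono abs_sin_x_le_abs_x) auto
  finally show ?thesis by simp
qed

lemma chord_diff_le: "\<bar>chord a - chord b\<bar> \<le> \<bar>a - b\<bar>"
  using norm_triangle_ineq3[of "1 - cis a" "1 - cis b"] norm_cis_diff_le[of b a]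
  by (simp add: chord_def abs_minus_commute)

lemma half_kernel_diff_bound:
  assumes "chord v \<noteq> 0" "chord w \<noteq> 0"
  shows "\<bar>half_kernel v - half_kernel w\<bar> \<le> 32 * \<bar>v - w\<bar> * (chord v * chord w) powr (- 3 / 4)"
proof -
  let ?d = "cis (- pi / 4) * (polylog_half (cis v) - polylog_half (cis w))"
  have "half_kernel v - half_kernel w = 2 / sqrt pi * Re ?d"
    unfolding half_kernel_eq[OF assms(1)] half_kernel_eq[OF assms(2)] by (simp add: algebra_simps)
  then have "\<bar>half_kernel v - half_kernel w\<bar> = 2 / sqrt pi * \<bar>Re ?d\<bar>"
    by (simp only: abs_mult) simp
  also have "\<dots> \<le> 2 * (16 * \<bar>v - w\<bar> * (chord v * chord w) powr (- 3 / 4))"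
  proof (intro mult_mono two_div_sqrt_pi_le)
    have "\<bar>Re ?d\<bar> \<le> norm ?d" by (rule abs_Re_le_cmod)
    also have "\<dots> \<le> 16 * norm (cis v - cis w) * (chord v * chord w) powr (- 3 / 4)"
      using polylog_half_diff_bound[of "cis v" "cis w"] assms by (simp add: norm_mult chord_def)
    also have "\<dots> \<le> 16 * \<bar>v - w\<bar> * (chord v * chord w) powr (- 3 / 4)"
      by (intro mult_right_mono mult_left_mono norm_cis_diff_le) auto
    finally show "\<bar>Re ?d\<bar> \<le> 16 * \<bar>v - w\<bar> * (chord v * chord w) powr (- 3 / 4)" .
  qed auto
  finally show ?thesis by simp
qed

lemma half_kernel_measurable [measurable]: "half_kernel \<in> borel_measurable borel"
proof -
  have [measurable]: "Measurable.pred borel (\<lambda>v. cis v = 1)"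
  proof -
    have "closed {v. cis v = 1}" by (intro closed_Collect_eq continuous_intros)
    then have "{v. cis v = 1} \<in> sets borel" by (rule borel_closed)
    then show ?thesis by (simp add: pred_def)
  qed
  show ?thesis unfolding half_kernel_def bernoulli_kernel1_def by measurable
qed

lemma chord_measurable [measurable]: "chord \<in> borel_measurable borel"
  unfolding chord_def by (intro borel_measurable_continuous_onI continuous_intros)

lemma cis_periodic: "cis (v + 2 * pi) = cis v"
  by (simp add: complex_eq_iff)

subsection \<open>Integrals over the circle\<close>

definition circle :: "real measure" where
  "circle = uniform_measure lborel {0..2 * pi}"

lemma sets_circle [simp, measurable_cong]: "sets circle = sets borel"
  by (simp add: circle_def)

lemma space_circle [simp]: "space circle = UNIV"
  by (simp add: circle_def)

lemma prob_space_circle: "prob_space circle"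
  unfolding circle_def by (rule prob_space_uniform_measure) auto

lemma nn_integral_circle:
  assumes [measurable]: "f \<in> borel_measurable borel"
  shows "integral\<^sup>N circle f = (\<integral>\<^sup>+ y. f y * indicator {0..2 * pi} y \<partial>lborel) / ennreal (2 * pi)"
  unfolding circle_def by (subst nn_integral_uniform_measure) auto

lemma AE_circle: "AE y in circle. y \<in> {0..2 * pi}"
  unfolding circle_def by (rule AE_uniform_measureI) auto

lemma AE_circle_chord: "AE y in circle. chord (x - y) \<noteq> 0"
proof -
  have "{y. chord (x - y) = 0} \<subseteq> (\<lambda>n. x - 2 * pi * of_int n) ` UNIV"
  proof
    fix y assume "y \<in> {y. chord (x - y) = 0}"
    then have "cis (x - y) = 1" by (simp add: chord_eq_0_iff)
    then have "cos (x - y) = 1" by (metis cis.sel(1) one_complex.sel(1))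
    then obtain n :: int where "x - y = of_int n * 2 * pi" by (auto simp: cos_one_2pi_int)
    then have "y = x - 2 * pi * of_int n" by (simp add: algebra_simps)
    then show "y \<in> (\<lambda>n. x - 2 * pi * of_int n) ` UNIV" by blast
  qed
  then have "countable {y. chord (x - y) = 0}"
    by (rule countable_subset) auto
  then have "{y. chord (x - y) = 0} \<in> null_sets lborel" by (rule countable_imp_null_set_lborel)
  then have "AE y in lborel. chord (x - y) \<noteq> 0"
    by (intro AE_I'[of "{y. chord (x - y) = 0}"]) auto
  then show ?thesis unfolding circle_def
    by (intro AE_uniform_measureI) auto
qed

lemma chord_eq_sin: "chord v = 2 * \<bar>sin (v / 2)\<bar>"
  unfolding chord_def norm_minus_commute[of 1] cis_conv_exp by (rule dist_exp_i_1)

text \<open>Up to \<open>pi / 3\<close> the derivative \<open>cos t - 1/2\<close> is nonnegative;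
  beyond, \<open>sin t\<close> is at least \<open>sqrt 3 / 2\<close>, which exceeds
  \<open>pi / 4\<close>.\<close>

lemma sin_ge_half:
  assumes t: "0 \<le> t" "t \<le> pi / 2"
  shows "t / 2 \<le> sin t"
proof (cases "t \<le> pi / 3")
  case True
  have "(\<lambda>t. sin t - t / 2) 0 \<le> (\<lambda>t. sin t - t / 2) t"
  proof (rule DERIV_nonneg_imp_nondecreasing[OF t(1)])
    fix x assume x: "0 \<le> x" "x \<le> t"
    have "cos (pi / 3) \<le> cos x" using x True by (intro cos_monotone_0_pi_le) auto
    then show "\<exists>y. ((\<lambda>t. sin t - t / 2) has_real_derivative y) (at x) \<and> 0 \<le> y"
      by (intro exI[of _ "cos x - 1 / 2"]) (auto intro!: derivative_eq_intros simp: cos_60)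
  qed
  then show ?thesis by simp
next
  case False
  have "sin (pi / 3) \<le> sin t" using False t by (intro sin_monotone_2pi_le) auto
  moreover have "17 / 10 \<le> sqrt 3" by (rule real_le_rsqrt) (simp add: power2_eq_square)
  then have "sin (pi / 3) \<ge> 17 / 20" by (simp add: sin_60)
  moreover have "t / 2 \<le> 17 / 20" using t pi_less_4 pi_approx by (simp add: field_simps)
  ultimately show ?thesis by linarith
qed

lemma chord_lower:
  assumes v: "\<bar>v\<bar> \<le> 2 * pi"
  obtains c where "c \<in> {0, 2 * pi, - 2 * pi}" "chord v \<ge> \<bar>v - c\<bar> / 2"
proof -
  have small: "chord w \<ge> \<bar>w\<bar> / 2" if "\<bar>w\<bar> \<le> pi" for w
  proof -
    have "\<bar>w\<bar> / 2 / 2 \<le> sin (\<bar>w\<bar> / 2)" using that by (intro sin_ge_half) auto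
    also have "\<dots> \<le> \<bar>sin (w / 2)\<bar>" by (cases "w \<ge> 0") (auto simp: abs_if)
    finally show ?thesis by (simp add: chord_eq_sin)
  qed
  have per: "chord (w - 2 * pi) = chord w" "chord (w + 2 * pi) = chord w" for w
    using cis_periodic[of w] cis_periodic[of "w - 2 * pi"] by (simp_all add: chord_def)
  consider "\<bar>v\<bar> \<le> pi" | "v > pi" | "v < - pi" by linarith
  then show ?thesis
  proof cases
    case 1
    then show ?thesis using small[of v] that[of 0] by simp
  next
    case 2
    then have "\<bar>v - 2 * pi\<bar> \<le> pi" using v by linarith
    from small[OF this] show ?thesis using per that[of "2 * pi"] by simp
  next
    case 3
    then have "\<bar>v + 2 * pi\<bar> \<le> pi" using v by linarith
    from small[OF this] show ?thesis using per that[of "- 2 * pi"] by simp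
  qed
qed

lemma nn_integral_abs_half:
  fixes G :: "real \<Rightarrow> ennreal"
  assumes [measurable]: "G \<in> borel_measurable borel"
  shows "(\<integral>\<^sup>+ v. G (\<bar>v\<bar> / 2) \<partial>lborel) = 4 * (\<integral>\<^sup>+ v. G v * indicator {0<..} v \<partial>lborel)"
proof -
  let ?I = "\<integral>\<^sup>+ v. G v * indicator {0<..} v \<partial>lborel"
  have "(\<integral>\<^sup>+ v. G (\<bar>v\<bar> / 2) \<partial>lborel) = ennreal \<bar>2\<bar> * (\<integral>\<^sup>+ v. G (\<bar>0 + 2 * v\<bar> / 2) \<partial>lborel)"
    by (rule nn_integral_real_affine) auto
  also have "(\<integral>\<^sup>+ v. G (\<bar>0 + 2 * v\<bar> / 2) \<partial>lborel) =
     (\<integral>\<^sup>+ v. G v * indicator {0<..} v + G (0 + (- 1) * v) * indicator {0<..} (0 + (- 1) * v) \<partial>lborel)"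
  proof (rule nn_integral_cong_AE, use AE_lborel_singleton[of 0] in eventually_elim)
    fix v :: real assume "v \<noteq> 0"
    then show "G (\<bar>0 + 2 * v\<bar> / 2) = G v * indicator {0<..} v + G (0 + (- 1) * v) * indicator {0<..} (0 + (- 1) * v)"
      by (cases "v > 0") (auto simp: abs_mult)
  qed
  also have "\<dots> = ?I + (\<integral>\<^sup>+ v. G (0 + (- 1) * v) * indicator {0<..} (0 + (- 1) * v) \<partial>lborel)"
    by (rule nn_integral_add) auto
  also have "(\<integral>\<^sup>+ v. G (0 + (- 1) * v) * indicator {0<..} (0 + (- 1) * v) \<partial>lborel) = ?I"
    using nn_integral_real_affine[of "\<lambda>v. G v * indicator {0<..} v" "- 1" 0] by simp
  also have "ennreal \<bar>2\<bar> * (?I + ?I) = 4 * ?I"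
    by (simp add: mult_2[symmetric] mult.assoc[symmetric])
  finally show ?thesis .
qed

text \<open>
  For arguments in one period the chord is at least half the distance to one of the three
  multiples \<open>0, \<plusminus>2 * pi\<close>, which reduces integrals over the circle to integrals over the half-line.
\<close>

lemma nn_integral_chord_le:
  fixes G :: "real \<Rightarrow> ennreal"
  assumes G [measurable]: "G \<in> borel_measurable borel"
    and zero: "G 0 = 0" and mono: "\<And>r s. 0 < r \<Longrightarrow> r \<le> s \<Longrightarrow> G s \<le> G r"
    and x: "x \<in> {0..2 * pi}"
  shows "(\<integral>\<^sup>+ y. G (chord (x - y)) * indicator {0..2 * pi} y \<partial>lborel)
    \<le> 12 * (\<integral>\<^sup>+ v. G v * indicator {0<..} v \<partial>lborel)"
    "(\<integral>\<^sup>+ y. G (chord (y - x)) * indicator {0..2 * pi} y \<partial>lborel)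
    \<le> 12 * (\<integral>\<^sup>+ v. G v * indicator {0<..} v \<partial>lborel)"
proof -
  let ?C = "{0, 2 * pi, - 2 * pi}"
  have pt: "G (chord v) \<le> (\<Sum>c\<in>?C. G (\<bar>v - c\<bar> / 2))" if v: "\<bar>v\<bar> \<le> 2 * pi" for v
  proof -
    obtain c where c: "c \<in> ?C" "chord v \<ge> \<bar>v - c\<bar> / 2" using chord_lower[OF v] .
    have "G (chord v) \<le> G (\<bar>v - c\<bar> / 2)"
    proof (cases "v = c")
      case True
      then have "cis v = 1" using c(1) by (auto simp: complex_eq_iff)
      then show ?thesis using zero by (simp add: chord_def)
    next
      case False
      then show ?thesis using c by (intro mono) auto
    qed
    also have "\<dots> \<le> (\<Sum>c\<in>?C. G (\<bar>v - c\<bar> / 2))" using c(1) by (intro member_le_sum) auto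
    finally show ?thesis .
  qed
  have card: "card ?C = 3" using pi_gt_zero by (auto simp: card_insert_if)
  have gen: "(\<integral>\<^sup>+ y. G (chord (a + s * y)) * indicator {0..2 * pi} y \<partial>lborel)
    \<le> 12 * (\<integral>\<^sup>+ v. G v * indicator {0<..} v \<partial>lborel)"
    if s: "s = 1 \<or> s = - 1" and as: "\<And>y. y \<in> {0..2 * pi} \<Longrightarrow> \<bar>a + s * y\<bar> \<le> 2 * pi" for a s
  proof -
    have "(\<integral>\<^sup>+ y. G (chord (a + s * y)) * indicator {0..2 * pi} y \<partial>lborel)
      \<le> (\<integral>\<^sup>+ y. (\<Sum>c\<in>?C. G (\<bar>a + s * y - c\<bar> / 2)) \<partial>lborel)"
    proof (rule nn_integral_mono)
      fix y
      show "G (chord (a + s * y)) * indicator {0..2 * pi} y \<le> (\<Sum>c\<in>?C. G (\<bar>a + s * y - c\<bar> / 2))"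
        using pt[OF as, of y] by (cases "y \<in> {0..2 * pi}") auto
    qed
    also have "\<dots> = (\<Sum>c\<in>?C. \<integral>\<^sup>+ y. G (\<bar>a + s * y - c\<bar> / 2) \<partial>lborel)"
      by (rule nn_integral_sum) auto
    also have "\<dots> = (\<Sum>c\<in>?C. 4 * (\<integral>\<^sup>+ v. G v * indicator {0<..} v \<partial>lborel))"
    proof (rule sum.cong[OF refl])
      fix c
      have "(\<integral>\<^sup>+ v. G (\<bar>v\<bar> / 2) \<partial>lborel) = ennreal \<bar>s\<bar> * (\<integral>\<^sup>+ y. G (\<bar>(a - c) + s * y\<bar> / 2) \<partial>lborel)"
        using s by (intro nn_integral_real_affine) auto
      moreover have "(a - c) + s * y = a + s * y - c" for y by simp
      moreover have "ennreal \<bar>s\<bar> = 1" using s by auto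
      ultimately have "(\<integral>\<^sup>+ v. G (\<bar>v\<bar> / 2) \<partial>lborel) = (\<integral>\<^sup>+ y. G (\<bar>a + s * y - c\<bar> / 2) \<partial>lborel)"
        by simp
      then show "(\<integral>\<^sup>+ y. G (\<bar>a + s * y - c\<bar> / 2) \<partial>lborel) = 4 * (\<integral>\<^sup>+ v. G v * indicator {0<..} v \<partial>lborel)"
        using nn_integral_abs_half[OF G] by simp
    qed
    also have "\<dots> = 12 * (\<integral>\<^sup>+ v. G v * indicator {0<..} v \<partial>lborel)"
      by (simp only: sum_constant card) (simp add: mult.assoc[symmetric])
    finally show ?thesis .
  qed
  show "(\<integral>\<^sup>+ y. G (chord (x - y)) * indicator {0..2 * pi} y \<partial>lborel)
    \<le> 12 * (\<integral>\<^sup>+ v. G v * indicator {0<..} v \<partial>lborel)"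
    using gen[of "- 1" x] x by (auto simp: abs_le_iff)
  show "(\<integral>\<^sup>+ y. G (chord (y - x)) * indicator {0..2 * pi} y \<partial>lborel)
    \<le> 12 * (\<integral>\<^sup>+ v. G v * indicator {0<..} v \<partial>lborel)"
    using gen[of 1 "- x"] x by (auto simp: abs_le_iff)
qed

lemma nn_integral_circle_chord_powr:
  assumes a: "0 \<le> a" "a < 1" and x: "x \<in> {0..2 * pi}"
  shows "(\<integral>\<^sup>+ y. ennreal (chord (x - y) powr - a) \<partial>circle) \<le> ennreal (1 + 12 / (1 - a))"
proof -
  \<comment> \<open>Truncated at 1 to be integrable over the half-line; where the chord is larger,
    the integrand is at most 1.\<close>
  define G where "G = (\<lambda>r :: real. ennreal (r powr - a) * indicator {0<..1} r)"
  have [measurable]: "G \<in> borel_measurable borel" by (simp add: G_def)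
  have "(\<integral>\<^sup>+ y. G (chord (x - y)) * indicator {0..2 * pi} y \<partial>lborel)
    \<le> 12 * (\<integral>\<^sup>+ v. G v * indicator {0<..} v \<partial>lborel)"
    by (rule nn_integral_chord_le(1)[OF _ _ _ x])
      (use a in \<open>auto simp: G_def indicator_def intro!: ennreal_leI powr_mono2'\<close>)
  also have "(\<integral>\<^sup>+ v. G v * indicator {0<..} v \<partial>lborel) \<le> (\<integral>\<^sup>+ v. ennreal (v powr - a) * indicator {0..1} v \<partial>lborel)"
    by (intro nn_integral_mono) (auto simp: G_def indicator_def)
  also have "\<dots> = ennreal (1 / (1 - a))"
    using nn_integral_powr_from_0[of "- a" 1] a by simp
  also have "12 * ennreal (1 / (1 - a)) = ennreal (12 / (1 - a))"
    using a by (simp add: ennreal_mult[symmetric] flip: ennreal_numeral)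
  finally have 1: "(\<integral>\<^sup>+ y. G (chord (x - y)) * indicator {0..2 * pi} y \<partial>lborel) \<le> ennreal (12 / (1 - a))"
    by (simp add: mult_left_mono)
  have "(\<integral>\<^sup>+ y. ennreal (chord (x - y) powr - a) \<partial>circle) \<le> (\<integral>\<^sup>+ y. 1 + G (chord (x - y)) \<partial>circle)"
  proof (rule nn_integral_mono)
    fix y
    let ?r = "chord (x - y)"
    show "ennreal (?r powr - a) \<le> 1 + G ?r"
    proof (cases "?r \<le> 1")
      case True
      then show ?thesis by (cases "?r = 0") (auto simp: G_def less_le)
    next
      case False
      then have "?r powr - a \<le> 1 powr - a" using a by (intro powr_mono2') auto
      then have "ennreal (?r powr - a) \<le> 1" by (simp add: ennreal_le_1)
      then show ?thesis by (simp add: add_increasing2)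
    qed
  qed
  also have "\<dots> = (\<integral>\<^sup>+ y. 1 \<partial>circle) + (\<integral>\<^sup>+ y. G (chord (x - y)) \<partial>circle)"
    by (rule nn_integral_add) auto
  also have "(\<integral>\<^sup>+ y. 1 \<partial>circle) = 1" using prob_space.emeasure_space_1[OF prob_space_circle] by simp
  also have "(\<integral>\<^sup>+ y. G (chord (x - y)) \<partial>circle) \<le> ennreal (12 / (1 - a))"
  proof -
    have "(\<integral>\<^sup>+ y. G (chord (x - y)) \<partial>circle) =
      (\<integral>\<^sup>+ y. G (chord (x - y)) * indicator {0..2 * pi} y \<partial>lborel) / ennreal (2 * pi)"
      by (rule nn_integral_circle) auto
    also have "\<dots> \<le> ennreal (12 / (1 - a)) / ennreal (2 * pi)" by (rule divide_right_mono_ennreal[OF 1])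
    also have "\<dots> = ennreal (12 / (1 - a) / (2 * pi))" using a by (subst divide_ennreal) auto
    also have "\<dots> \<le> ennreal (12 / (1 - a) / 1)"
      using a pi_gt3 by (intro ennreal_leI divide_left_mono) auto
    finally show ?thesis by simp
  qed
  also have "1 + ennreal (12 / (1 - a)) = ennreal (1 + 12 / (1 - a))"
    using a by (subst ennreal_plus) auto
  finally show ?thesis by (simp add: add_left_mono)
qed

text \<open>Profile of the error of averaging \<open>half_kernel\<close> over an interval of length \<open>h\<close>.\<close>

definition profile :: "real \<Rightarrow> real \<Rightarrow> real" where
  "profile h r = r powr (- 1 / 2) * min 1 (h / r)"

lemma profile_nonneg [simp]: "h \<ge> 0 \<Longrightarrow> r \<ge> 0 \<Longrightarrow> profile h r \<ge> 0"
  by (simp add: profile_def)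

text \<open>The profile is \<open>r^(-1/2)\<close> up to \<open>h\<close> and
  \<open>h * r^(-3/2)\<close> beyond; each piece integrates to \<open>2 * sqrt h\<close>, and the
  passage from the half-line to the circle multiplies by 12.\<close>

lemma nn_integral_circle_profile:
  assumes h: "h > 0" and x: "x \<in> {0..2 * pi}"
  shows "(\<integral>\<^sup>+ y. ennreal (profile h (chord (x - y))) \<partial>circle) \<le> ennreal (48 * sqrt h)"
proof -
  define G where "G = (\<lambda>r :: real. ennreal (profile h r))"
  have [measurable]: "G \<in> borel_measurable borel" by (simp add: G_def profile_def)
  have "(\<integral>\<^sup>+ y. G (chord (x - y)) * indicator {0..2 * pi} y \<partial>lborel)
    \<le> 12 * (\<integral>\<^sup>+ v. G v * indicator {0<..} v \<partial>lborel)"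
  proof (rule nn_integral_chord_le(1)[OF _ _ _ x])
    show "G 0 = 0" by (simp add: G_def profile_def)
    fix r s :: real assume "0 < r" "r \<le> s"
    then show "G s \<le> G r" unfolding G_def profile_def using h
      by (intro ennreal_leI mult_mono powr_mono2' min.mono divide_left_mono) auto
  qed auto
  also have "(\<integral>\<^sup>+ v. G v * indicator {0<..} v \<partial>lborel) \<le>
     (\<integral>\<^sup>+ v. ennreal (v powr (- 1 / 2)) * indicator {0..h} v + ennreal h * (ennreal (v powr (- 3 / 2)) * indicator {h..} v) \<partial>lborel)"
  proof (rule nn_integral_mono)
    fix v :: real
    consider "v \<le> 0" | "0 < v" "v \<le> h" | "h < v" by linarith
    then show "G v * indicator {0<..} v \<le> ennreal (v powr (- 1 / 2)) * indicator {0..h} v + ennreal h * (ennreal (v powr (- 3 / 2)) * indicator {h..} v)"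
    proof cases
      case 2
      have "G v \<le> ennreal (v powr (- 1 / 2))" unfolding G_def profile_def
        by (intro ennreal_leI) (simp add: mult_left_le)
      then show ?thesis using 2 by (auto intro: order_trans)
    next
      case 3
      then have "profile h v \<le> v powr (- 1 / 2) * (h * v powr - 1)" using h
        by (auto simp: profile_def powr_minus_divide intro!: mult_left_mono)
      also have "\<dots> = h * v powr (- 3 / 2)" using powr_add[of v "- 1 / 2" "- 1"] by simp
      finally show ?thesis using 3 h by (simp add: G_def ennreal_mult[symmetric] ennreal_leI)
    qed auto
  qed
  also have "\<dots> = ennreal (h powr (1 / 2) / (1 / 2)) + ennreal h * ennreal (- (h powr (- 1 / 2)) / (- 1 / 2))"
    using nn_integral_powr_from_0[of "- 1 / 2" h] nn_integral_powr_to_inf[of "- 3 / 2" h] h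
    by (subst nn_integral_add) (auto simp: nn_integral_cmult)
  also have "\<dots> = ennreal (2 * h powr (1 / 2) + h * (2 * h powr (- 1 / 2)))"
    using h by (simp add: ennreal_mult[symmetric] flip: ennreal_plus)
  also have "2 * h powr (1 / 2) + h * (2 * h powr (- 1 / 2)) = 4 * sqrt h"
    using powr_mult_base[of h "- 1 / 2"] h by (simp add: powr_half_sqrt)
  also have "12 * ennreal (4 * sqrt h) = ennreal (48 * sqrt h)"
    using h by (simp add: ennreal_mult[symmetric] flip: ennreal_numeral)
  finally have 1: "(\<integral>\<^sup>+ y. G (chord (x - y)) * indicator {0..2 * pi} y \<partial>lborel) \<le> ennreal (48 * sqrt h)"
    by (simp add: mult_left_mono)
  have "(\<integral>\<^sup>+ y. G (chord (x - y)) \<partial>circle) =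
    (\<integral>\<^sup>+ y. G (chord (x - y)) * indicator {0..2 * pi} y \<partial>lborel) / ennreal (2 * pi)"
    by (rule nn_integral_circle) auto
  also have "\<dots> \<le> ennreal (48 * sqrt h) / ennreal (2 * pi)" by (rule divide_right_mono_ennreal[OF 1])
  also have "\<dots> = ennreal (48 * sqrt h / (2 * pi))" using h by (subst divide_ennreal) auto
  also have "\<dots> \<le> ennreal (48 * sqrt h / 1)"
    using h pi_gt3 by (intro ennreal_leI divide_left_mono) auto
  finally show ?thesis by (simp add: G_def)
qed

subsection \<open>Dyadic averages of the kernel\<close>

definition mesh :: "nat \<Rightarrow> real" where
  "mesh s = 2 * pi / 2 ^ s"

definition cell_left :: "nat \<Rightarrow> real \<Rightarrow> real" where
  "cell_left s x = mesh s * of_int \<lfloor>x / mesh s\<rfloor>"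

abbreviation cell :: "nat \<Rightarrow> real \<Rightarrow> real set" where
  "cell s x \<equiv> {cell_left s x..cell_left s x + mesh s}"

text \<open>The average is taken in the first variable only: integrated against any density in
  \<open>y\<close> it gives a function of \<open>x\<close> that is constant on dyadic cells.\<close>

definition cell_avg :: "nat \<Rightarrow> real \<Rightarrow> real \<Rightarrow> real" where
  "cell_avg s x y = (LINT v|lborel. indicator (cell s x) v * half_kernel (v - y)) / mesh s"

text \<open>Martingale differences along the dyadic filtration in \<open>x\<close>; scale 0 holds
  the mean over the whole period, so that the sums telescope.\<close>

definition detail :: "nat \<Rightarrow> real \<Rightarrow> real \<Rightarrow> real" where
  "detail s x y = cell_avg s x y - (if s = 0 then 0 else cell_avg (s - 1) x y)"

lemma mesh_pos [simp]: "mesh s > 0"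
  by (simp add: mesh_def)

lemma mesh_simps [simp]: "0 \<le> mesh s" "mesh s \<noteq> 0" "\<bar>mesh s\<bar> = mesh s"
  using mesh_pos[of s] by linarith+

lemma sum_detail: "(\<Sum>s\<le>L. detail s x y) = cell_avg L x y"
  by (induction L) (simp_all add: detail_def)

text \<open>Nested grids: passing to a coarser one is integer division of the cell number, with
  which the floor is compatible.\<close>

lemma cell_left_cell_left:
  assumes "s \<le> L"
  shows "cell_left s (cell_left L x) = cell_left s x"
proof -
  let ?k = "2 ^ (L - s) :: int"
  have m: "mesh s = mesh L * of_int ?k"
  proof -
    have "(2::real) ^ L = 2 ^ s * 2 ^ (L - s)" using assms by (simp flip: power_add)
    then show ?thesis by (simp add: mesh_def)
  qed
  have "\<lfloor>cell_left L x / mesh s\<rfloor> = \<lfloor>of_int \<lfloor>x / mesh L\<rfloor> / (of_int ?k :: real)\<rfloor>"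
    using mesh_pos[of L] unfolding m cell_left_def by (simp add: field_simps)
  also have "\<dots> = \<lfloor>x / mesh L\<rfloor> div ?k" by (rule floor_divide_of_int_eq)
  also have "\<dots> = \<lfloor>(x / mesh L) / of_int ?k\<rfloor>" by (rule floor_divide_real_eq_div[symmetric]) simp
  also have "(x / mesh L) / of_int ?k = x / mesh s" unfolding m by simp
  finally show ?thesis by (simp add: cell_left_def)
qed

lemma cell_avg_cell_left: "s \<le> L \<Longrightarrow> cell_avg s (cell_left L x) y = cell_avg s x y"
  by (simp add: cell_avg_def cell_left_cell_left)

lemma detail_cell_left: "s \<le> L \<Longrightarrow> detail s (cell_left L x) y = detail s x y"
  by (simp add: detail_def cell_avg_cell_left)

lemma mem_cell: "x \<in> cell s x"
proof -
  have "of_int \<lfloor>x / mesh s\<rfloor> \<le> x / mesh s" "x / mesh s \<le> of_int \<lfloor>x / mesh s\<rfloor> + 1" by linarith+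
  then have "mesh s * of_int \<lfloor>x / mesh s\<rfloor> \<le> mesh s * (x / mesh s)"
    "mesh s * (x / mesh s) \<le> mesh s * (of_int \<lfloor>x / mesh s\<rfloor> + 1)"
    by (intro mult_left_mono; simp add: less_imp_le)+
  moreover have "mesh s * (x / mesh s) = x" using mesh_pos[of s] by simp
  ultimately show ?thesis by (simp add: cell_left_def distrib_left)
qed

lemma cell_left_ge_0: "0 \<le> x \<Longrightarrow> 0 \<le> cell_left s x"
  by (simp add: cell_left_def less_imp_le)

lemma floor_mesh_less:
  assumes "x < 2 * pi"
  shows "\<lfloor>x / mesh s\<rfloor> < 2 ^ s"
proof -
  have "x / mesh s < 2 ^ s" using assms by (simp add: mesh_def field_simps)
  then show ?thesis by (simp add: floor_less_iff)
qed

lemma cell_subset: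
  assumes "x \<in> {0..<2 * pi}"
  shows "cell s x \<subseteq> {0..2 * pi}"
proof -
  have "of_int (\<lfloor>x / mesh s\<rfloor> + 1) \<le> (2 ^ s :: real)"
    using floor_mesh_less[of x s] assms by (metis add1_zle_eq of_int_le_iff of_int_numeral of_int_power atLeastLessThan_iff)
  then have "mesh s * of_int (\<lfloor>x / mesh s\<rfloor> + 1) \<le> mesh s * 2 ^ s"
    by (intro mult_left_mono) (auto simp: less_imp_le)
  then have "cell_left s x + mesh s \<le> 2 * pi" by (simp add: cell_left_def algebra_simps mesh_def)
  then show ?thesis using cell_left_ge_0[of x s] assms by auto
qed

text \<open>Where the chord exceeds the mesh \<open>h\<close>, the kernel is at most
  \<open>18 * h^(-1/2)\<close> and the cell contributes \<open>18 * sqrt h\<close>; the part near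
  the singularity is caught by \<open>G\<close> and contributes
  \<open>18 * 24 * sqrt h\<close>.\<close>

lemma nn_integral_cell:
  assumes x: "x \<in> {0..<2 * pi}" and y: "y \<in> {0..2 * pi}"
  shows "(\<integral>\<^sup>+ v. ennreal \<bar>indicator (cell s x) v * half_kernel (v - y)\<bar> \<partial>lborel) \<le> ennreal (450 * sqrt (mesh s))"
proof -
  let ?h = "mesh s"
  define G where "G = (\<lambda>r :: real. ennreal (r powr (- 1 / 2)) * indicator {0<..?h} r)"
  have [measurable]: "G \<in> borel_measurable borel" by (simp add: G_def)
  have "(\<integral>\<^sup>+ v. G (chord (v - y)) * indicator {0..2 * pi} v \<partial>lborel)
    \<le> 12 * (\<integral>\<^sup>+ v. G v * indicator {0<..} v \<partial>lborel)"
    by (rule nn_integral_chord_le(2)[OF _ _ _ y])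
      (auto simp: G_def indicator_def intro!: ennreal_leI powr_mono2')
  also have "(\<integral>\<^sup>+ v. G v * indicator {0<..} v \<partial>lborel) \<le> (\<integral>\<^sup>+ v. ennreal (v powr (- 1 / 2)) * indicator {0..?h} v \<partial>lborel)"
    by (intro nn_integral_mono) (auto simp: G_def indicator_def)
  also have "\<dots> = ennreal (2 * sqrt ?h)"
    using nn_integral_powr_from_0[of "- 1 / 2" ?h] by (simp add: powr_half_sqrt less_imp_le)
  also have "12 * ennreal (2 * sqrt ?h) = ennreal (24 * sqrt ?h)"
    by (simp add: ennreal_mult[symmetric] less_imp_le flip: ennreal_numeral)
  finally have 1: "(\<integral>\<^sup>+ v. G (chord (v - y)) * indicator {0..2 * pi} v \<partial>lborel) \<le> ennreal (24 * sqrt ?h)"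
    by (simp add: mult_left_mono)
  have "(\<integral>\<^sup>+ v. ennreal \<bar>indicator (cell s x) v * half_kernel (v - y)\<bar> \<partial>lborel) \<le>
     (\<integral>\<^sup>+ v. ennreal 18 * (ennreal (?h powr (- 1 / 2)) * indicator (cell s x) v + G (chord (v - y)) * indicator {0..2 * pi} v) \<partial>lborel)"
  proof (rule nn_integral_mono)
    fix v :: real
    let ?r = "chord (v - y)"
    show "ennreal \<bar>indicator (cell s x) v * half_kernel (v - y)\<bar> \<le>
      ennreal 18 * (ennreal (?h powr (- 1 / 2)) * indicator (cell s x) v + G ?r * indicator {0..2 * pi} v)"
    proof (cases "v \<in> cell s x")
      case True
      then have v: "v \<in> {0..2 * pi}" using cell_subset[OF x] by blast
      have "ennreal \<bar>half_kernel (v - y)\<bar> \<le> ennreal (18 * ?r powr (- 1 / 2))"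
        by (intro ennreal_leI half_kernel_bound)
      also have "\<dots> = ennreal 18 * ennreal (?r powr (- 1 / 2))" by (rule ennreal_mult) auto
      also have "ennreal (?r powr (- 1 / 2)) \<le> ennreal (?h powr (- 1 / 2)) + G ?r"
      proof (cases "?r \<le> ?h")
        case True
        then show ?thesis by (cases "?r = 0") (auto simp: G_def less_le)
      next
        case False
        then have "?r powr (- 1 / 2) \<le> ?h powr (- 1 / 2)" by (intro powr_mono2') auto
        then show ?thesis by (simp add: add_increasing2 ennreal_leI)
      qed
      finally show ?thesis using True v by (simp add: mult_left_mono)
    qed simp
  qed
  also have "\<dots> = ennreal 18 * (ennreal (?h powr (- 1 / 2)) * ennreal ?h + (\<integral>\<^sup>+ v. G (chord (v - y)) * indicator {0..2 * pi} v \<partial>lborel))"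
    by (simp add: nn_integral_cmult nn_integral_add less_imp_le)
  also have "\<dots> \<le> ennreal 18 * (ennreal (sqrt ?h) + ennreal (24 * sqrt ?h))"
  proof -
    have "?h powr (- 1 / 2) * ?h = sqrt ?h"
      using powr_mult_base[of ?h "- 1 / 2"] by (simp add: powr_half_sqrt mult.commute less_imp_le)
    then have "ennreal (?h powr (- 1 / 2)) * ennreal ?h = ennreal (sqrt ?h)"
      by (simp add: ennreal_mult[symmetric] less_imp_le)
    then show ?thesis using 1 by (simp add: mult_left_mono add_left_mono)
  qed
  also have "\<dots> = ennreal (18 * (sqrt ?h + 24 * sqrt ?h))"
    by (subst ennreal_mult) (simp_all flip: ennreal_plus)
  also have "18 * (sqrt ?h + 24 * sqrt ?h) = 450 * sqrt ?h" by simp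
  finally show ?thesis .
qed

lemma integrable_cell:
  assumes x: "x \<in> {0..<2 * pi}" and y: "y \<in> {0..2 * pi}"
  shows "integrable lborel (\<lambda>v. indicator (cell s x) v * half_kernel (v - y))"
  using nn_integral_cell[OF assms, of s]
  by (intro integrableI_bounded) (auto simp: less_top[symmetric] top_unique)

lemma cell_avg_bound:
  assumes x: "x \<in> {0..<2 * pi}" and y: "y \<in> {0..2 * pi}"
  shows "\<bar>cell_avg s x y\<bar> \<le> 450 / sqrt (mesh s)"
proof -
  let ?I = "LINT v|lborel. indicator (cell s x) v * half_kernel (v - y)"
  have "ennreal \<bar>?I\<bar> \<le> (\<integral>\<^sup>+ v. ennreal \<bar>indicator (cell s x) v * half_kernel (v - y)\<bar> \<partial>lborel)"
    using integral_norm_bound_ennreal[OF integrable_cell[OF assms, of s]] by simp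
  also have "\<dots> \<le> ennreal (450 * sqrt (mesh s))" by (rule nn_integral_cell[OF assms])
  finally have "\<bar>?I\<bar> \<le> 450 * sqrt (mesh s)" by (simp add: ennreal_le_iff less_imp_le)
  then have "\<bar>?I\<bar> / mesh s \<le> 450 * sqrt (mesh s) / mesh s" by (intro divide_right_mono) (auto simp: less_imp_le)
  also have "\<dots> = 450 / sqrt (mesh s)"
  proof -
    have "sqrt (mesh s) * sqrt (mesh s) = mesh s" by (simp add: less_imp_le)
    then show ?thesis using mesh_pos[of s] by (simp add: divide_simps)
  qed
  finally show ?thesis by (simp add: cell_avg_def abs_divide less_imp_le abs_of_pos)
qed

text \<open>Within two meshes of the singularity, kernel and average are bounded separately. Farther
  away the chord changes by less than half over the cell, so the difference bound of the kernel
  gains the factor \<open>h / r\<close>.\<close>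

lemma cell_avg_error:
  assumes x: "x \<in> {0..<2 * pi}" and y: "y \<in> {0..2 * pi}" and ne: "chord (x - y) \<noteq> 0"
  shows "\<bar>half_kernel (x - y) - cell_avg s x y\<bar> \<le> 1400 * profile (mesh s) (chord (x - y))"
proof -
  let ?h = "mesh s" and ?r = "chord (x - y)"
  have r: "?r > 0" using ne by (simp add: less_le)
  show ?thesis
  proof (cases "?r \<le> 2 * ?h")
    case True
    have q: "450 / sqrt ?h \<le> 675 * ?r powr (- 1 / 2)"
    proof -
      have "sqrt ?r \<le> sqrt (2 * ?h)" using True by simp
      also have "sqrt (2 * ?h) = sqrt 2 * sqrt ?h" by (rule real_sqrt_mult)
      also have "\<dots> \<le> 3 / 2 * sqrt ?h"
        by (intro mult_right_mono real_le_lsqrt) (auto simp: power2_eq_square less_imp_le)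
      finally have "sqrt ?r \<le> 3 / 2 * sqrt ?h" .
      then have "450 / sqrt ?h \<le> 675 / sqrt ?r" using r by (simp add: field_simps)
      also have "\<dots> = 675 * ?r powr (- 1 / 2)" using r by (simp add: powr_minus powr_half_sqrt field_simps)
      finally show ?thesis .
    qed
    have "\<bar>half_kernel (x - y) - cell_avg s x y\<bar> \<le> \<bar>half_kernel (x - y)\<bar> + \<bar>cell_avg s x y\<bar>" by linarith
    also have "\<dots> \<le> 18 * ?r powr (- 1 / 2) + 675 * ?r powr (- 1 / 2)"
      using half_kernel_bound[of "x - y"] cell_avg_bound[OF x y, of s] q by linarith
    \<comment> \<open>\<open>18 + 675\<close> is at most 700, and \<open>r \<le> 2 * h\<close> makes
      the minimum in the profile at least 1/2.\<close>
    also have "\<dots> \<le> 1400 * (?r powr (- 1 / 2) * (1 / 2))" by simp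
    also have "\<dots> \<le> 1400 * profile ?h ?r" unfolding profile_def
      using True r by (intro mult_left_mono) (auto simp: field_simps)
    finally show ?thesis .
  next
    case False
    have bd: "\<bar>half_kernel (x - y) - half_kernel (v - y)\<bar> \<le> 64 * ?h * ?r powr (- 3 / 2)" if v: "v \<in> cell s x" for v
    proof -
      have xv: "\<bar>x - v\<bar> \<le> ?h" using v mem_cell[of x s] by auto
      have "\<bar>chord (x - y) - chord (v - y)\<bar> \<le> \<bar>x - v\<bar>" using chord_diff_le[of "x - y" "v - y"] by simp
      then have half: "chord (v - y) \<ge> ?r / 2" using xv False by linarith
      then have "\<bar>half_kernel (x - y) - half_kernel (v - y)\<bar> \<le> 32 * \<bar>(x - y) - (v - y)\<bar> * (?r * chord (v - y)) powr (- 3 / 4)"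
        using r by (intro half_kernel_diff_bound) auto
      also have "\<dots> \<le> 32 * ?h * (?r * (?r / 2)) powr (- 3 / 4)"
        using xv half r by (intro mult_mono powr_mono2' mult_left_mono) auto
      also have "(?r * (?r / 2)) powr (- 3 / 4) = ?r powr (- 3 / 2) * 2 powr (3 / 4)"
      proof -
        have "?r * (?r / 2) = ?r powr 2 * 2 powr - 1" using r by (simp add: power2_eq_square powr_minus_divide)
        then have "(?r * (?r / 2)) powr (- 3 / 4) = (?r powr 2) powr (- 3 / 4) * (2 powr - 1) powr (- 3 / 4)"
          by (simp only: powr_mult)
        then show ?thesis by (simp only: powr_powr) simp
      qed
      also have "32 * ?h * (?r powr (- 3 / 2) * 2 powr (3 / 4)) \<le> 32 * ?h * (?r powr (- 3 / 2) * 2)"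
        using powr_mono[of "3 / 4" 1 "2::real"] by (intro mult_left_mono) (auto simp: less_imp_le)
      finally show ?thesis by simp
    qed
    let ?B = "64 * ?h * ?r powr (- 3 / 2)"
    have ind: "integrable lborel (\<lambda>v. indicator (cell s x) v :: real)" by (rule integrable_real_indicator) (simp, subst emeasure_lborel_Icc, simp_all)
    have int1: "(LINT v|lborel. indicator (cell s x) v) = ?h" by (simp add: less_imp_le)
    have i1: "integrable lborel (\<lambda>v. indicator (cell s x) v * half_kernel (x - y))"
      using ind by (rule integrable_mult_left)
    have "half_kernel (x - y) - cell_avg s x y =
      (LINT v|lborel. indicator (cell s x) v * half_kernel (x - y) - indicator (cell s x) v * half_kernel (v - y)) / ?h"
      using integrable_cell[OF x y, of s] i1 mesh_pos[of s] int1
      by (simp add: cell_avg_def field_simps del: integral_indicator)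
    then have "\<bar>half_kernel (x - y) - cell_avg s x y\<bar> =
      \<bar>LINT v|lborel. indicator (cell s x) v * half_kernel (x - y) - indicator (cell s x) v * half_kernel (v - y)\<bar> / ?h"
      by (simp add: abs_divide less_imp_le abs_of_pos)
    also have "\<dots> \<le> (LINT v|lborel. indicator (cell s x) v * ?B) / ?h"
    proof (intro divide_right_mono)
      have "\<bar>LINT v|lborel. indicator (cell s x) v * half_kernel (x - y) - indicator (cell s x) v * half_kernel (v - y)\<bar>
        \<le> (LINT v|lborel. \<bar>indicator (cell s x) v * half_kernel (x - y) - indicator (cell s x) v * half_kernel (v - y)\<bar>)"
        by (rule integral_abs_bound)
      also have "\<dots> \<le> (LINT v|lborel. indicator (cell s x) v * ?B)"
      proof (rule integral_mono)
        show "integrable lborel (\<lambda>v. \<bar>indicator (cell s x) v * half_kernel (x - y) - indicator (cell s x) v * half_kernel (v - y)\<bar>)"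
          by (intro integrable_abs Bochner_Integration.integrable_diff i1 integrable_cell x y)
        show "integrable lborel (\<lambda>v. indicator (cell s x) v * ?B)" using ind by (rule integrable_mult_left)
        show "\<bar>indicator (cell s x) v * half_kernel (x - y) - indicator (cell s x) v * half_kernel (v - y)\<bar> \<le> indicator (cell s x) v * ?B" for v
          using bd[of v] by (cases "v \<in> cell s x") auto
      qed
      finally show "\<bar>LINT v|lborel. indicator (cell s x) v * half_kernel (x - y) - indicator (cell s x) v * half_kernel (v - y)\<bar>
        \<le> (LINT v|lborel. indicator (cell s x) v * ?B)" .
    qed (simp add: less_imp_le)
    also have "\<dots> = ?B" using int1 mesh_pos[of s] by (simp del: integral_indicator)
    also have "\<dots> = 64 * (?r powr (- 1 / 2) * (?h / ?r))"
      using r powr_add[of ?r "- 1 / 2" "- 1"] by (simp add: powr_minus_divide)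
    also have "\<dots> = 64 * profile ?h ?r"
    proof -
      have "?h \<le> ?r" using False mesh_pos[of s] by linarith
      then have "?h / ?r \<le> 1" using r by simp
      then show ?thesis unfolding profile_def by (simp only: min_absorb2)
    qed
    also have "\<dots> \<le> 1400 * profile ?h ?r" using profile_nonneg[of ?h ?r] by (simp add: less_imp_le)
    finally show ?thesis .
  qed
qed

lemma cell_avg_measurable [measurable]: "cell_avg s x \<in> borel_measurable borel"
  unfolding cell_avg_def by measurable

lemma detail_measurable [measurable]: "detail s x \<in> borel_measurable borel"
  unfolding detail_def by measurable

lemma sqrt_mesh: "sqrt (mesh s) = sqrt (2 * pi) * 2 powr (- real s / 2)"
proof -
  have "sqrt (mesh s) = sqrt (2 * pi) / sqrt (2 ^ s)" unfolding mesh_def by (rule real_sqrt_divide)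
  also have "sqrt (2 ^ s) = 2 powr (real s / 2)"
    by (simp add: powr_half_sqrt[symmetric] powr_realpow[symmetric] powr_powr)
  finally show ?thesis by (simp add: powr_minus_divide)
qed

lemma sqrt_2pi_bounds: "1 \<le> sqrt (2 * pi)" "sqrt (2 * pi) \<le> 3"
  using pi_gt3 pi_less_4 by (auto intro!: real_le_lsqrt simp: power2_eq_square)

lemma sqrt_mesh_le: "sqrt (mesh s) \<le> 3 * 2 powr (- real s / 2)"
  unfolding sqrt_mesh by (intro mult_right_mono sqrt_2pi_bounds) auto

lemma cell_avg_bound_powr:
  assumes "x \<in> {0..<2 * pi}" "y \<in> {0..2 * pi}"
  shows "\<bar>cell_avg s x y\<bar> \<le> 450 * 2 powr (real s / 2)"
proof -
  have "\<bar>cell_avg s x y\<bar> \<le> 450 / sqrt (mesh s)" by (rule cell_avg_bound[OF assms])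
  also have "\<dots> \<le> 450 / (1 * 2 powr (- real s / 2))"
    unfolding sqrt_mesh by (intro divide_left_mono mult_right_mono sqrt_2pi_bounds) auto
  also have "\<dots> = 450 * 2 powr (real s / 2)" by (simp add: powr_minus_divide)
  finally show ?thesis .
qed

lemma detail_bound:
  assumes "x \<in> {0..<2 * pi}" "y \<in> {0..2 * pi}"
  shows "\<bar>detail s x y\<bar> \<le> 900 * 2 powr (real s / 2)"
proof (cases "s = 0")
  case True
  then show ?thesis using cell_avg_bound_powr[OF assms, of 0] by (simp add: detail_def)
next
  case False
  have "\<bar>detail s x y\<bar> \<le> \<bar>cell_avg s x y\<bar> + \<bar>cell_avg (s - 1) x y\<bar>" using False by (simp add: detail_def)
  also have "\<dots> \<le> 450 * 2 powr (real s / 2) + 450 * 2 powr (real (s - 1) / 2)"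
    by (intro add_mono cell_avg_bound_powr assms)
  also have "2 powr (real (s - 1) / 2) \<le> (2::real) powr (real s / 2)" by (intro powr_mono) auto
  finally show ?thesis by simp
qed

text \<open>Consecutive averages approximate the same kernel value, so a detail is bounded by two
  error profiles, each with integral of the order of the square root of its mesh.\<close>

lemma nn_integral_detail:
  assumes x: "x \<in> {0..<2 * pi}"
  shows "(\<integral>\<^sup>+ y. ennreal \<bar>detail s x y\<bar> \<partial>circle) \<le> ennreal (10 ^ 6 * 2 powr (- real s / 2))"
proof (cases "s = 0")
  case True
  have "(\<integral>\<^sup>+ y. ennreal \<bar>detail s x y\<bar> \<partial>circle) \<le> (\<integral>\<^sup>+ y. ennreal 900 \<partial>circle)"
  proof (rule nn_integral_mono_AE, use AE_circle in eventually_elim)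
    case (elim y)
    show ?case using detail_bound[OF x elim, of s] True by (intro ennreal_leI) simp
  qed
  also have "\<dots> = ennreal 900" using prob_space.emeasure_space_1[OF prob_space_circle] by simp
  finally show ?thesis using True by (auto elim!: order_trans intro: ennreal_leI)
next
  case False
  have x': "x \<in> {0..2 * pi}" using x by auto
  have "(\<integral>\<^sup>+ y. ennreal \<bar>detail s x y\<bar> \<partial>circle) \<le>
    (\<integral>\<^sup>+ y. ennreal 1400 * (ennreal (profile (mesh s) (chord (x - y))) + ennreal (profile (mesh (s - 1)) (chord (x - y)))) \<partial>circle)"
  proof (rule nn_integral_mono_AE, use AE_circle AE_circle_chord[of x] in eventually_elim)
    case (elim y)
    have "\<bar>detail s x y\<bar> \<le> \<bar>half_kernel (x - y) - cell_avg s x y\<bar> + \<bar>half_kernel (x - y) - cell_avg (s - 1) x y\<bar>"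
      using False by (simp add: detail_def)
    also have "\<dots> \<le> 1400 * profile (mesh s) (chord (x - y)) + 1400 * profile (mesh (s - 1)) (chord (x - y))"
      using x elim by (intro add_mono cell_avg_error) auto
    finally have "ennreal \<bar>detail s x y\<bar> \<le> ennreal (1400 * (profile (mesh s) (chord (x - y)) + profile (mesh (s - 1)) (chord (x - y))))"
      by (intro ennreal_leI) simp
    also have "\<dots> = ennreal 1400 * ennreal (profile (mesh s) (chord (x - y)) + profile (mesh (s - 1)) (chord (x - y)))"
      by (rule ennreal_mult) auto
    finally show ?case by simp
  qed
  also have "\<dots> = ennreal 1400 * ((\<integral>\<^sup>+ y. ennreal (profile (mesh s) (chord (x - y))) \<partial>circle) +
      (\<integral>\<^sup>+ y. ennreal (profile (mesh (s - 1)) (chord (x - y))) \<partial>circle))"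
    by (simp add: nn_integral_cmult nn_integral_add profile_def)
  also have "\<dots> \<le> ennreal 1400 * (ennreal (48 * sqrt (mesh s)) + ennreal (48 * sqrt (mesh (s - 1))))"
    by (intro mult_left_mono add_mono nn_integral_circle_profile x' mesh_pos) auto
  also have "\<dots> = ennreal (1400 * (48 * sqrt (mesh s) + 48 * sqrt (mesh (s - 1))))"
    by (subst ennreal_mult) (simp_all flip: ennreal_plus)
  also have "\<dots> \<le> ennreal (10 ^ 6 * 2 powr (- real s / 2))"
  proof (rule ennreal_leI)
    have "mesh (s - 1) = 2 * mesh s" using False by (cases s) (auto simp: mesh_def)
    then have "sqrt (mesh (s - 1)) = sqrt 2 * sqrt (mesh s)" by (simp add: real_sqrt_mult)
    also have "\<dots> \<le> 3 / 2 * sqrt (mesh s)"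
      by (intro mult_right_mono real_le_lsqrt) (auto simp: power2_eq_square less_imp_le)
    finally have "1400 * (48 * sqrt (mesh s) + 48 * sqrt (mesh (s - 1))) \<le> 168000 * sqrt (mesh s)" by simp
    also have "\<dots> \<le> 168000 * (3 * 2 powr (- real s / 2))" by (intro mult_left_mono sqrt_mesh_le) auto
    also have "\<dots> \<le> 10 ^ 6 * 2 powr (- real s / 2)" by simp
    finally show "1400 * (48 * sqrt (mesh s) + 48 * sqrt (mesh (s - 1))) \<le> 10 ^ 6 * 2 powr (- real s / 2)" .
  qed
  finally show ?thesis .
qed

subsection \<open>Tensor products on the torus\<close>

lemma sets_torus [simp, measurable_cong]: "sets torus = sets borel"
  by (simp add: torus_def)

lemma space_torus [simp]: "space torus = UNIV"
  by (simp add: torus_def)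

lemma emeasure_torus_cube: "emeasure lborel (cbox 0 (\<chi> i. 2 * pi) :: (real ^ 'd) set) = ennreal ((2 * pi) ^ CARD('d))"
  by (subst emeasure_lborel_cbox) (auto simp: Basis_vec_def inner_axis UNION_singleton_eq_range
      prod.reindex inj_on_def axis_eq_axis)

lemma prob_space_torus: "prob_space (torus :: (real ^ 'd) measure)"
  unfolding torus_def by (rule prob_space_uniform_measure) (simp_all only: emeasure_torus_cube, simp_all)

lemma nn_integral_torus_prod:
  fixes g :: "'d::finite \<Rightarrow> real \<Rightarrow> ennreal"
  assumes [measurable]: "\<And>j. g j \<in> borel_measurable borel"
  shows "(\<integral>\<^sup>+ y. (\<Prod>j\<in>UNIV. g j (y $ j)) \<partial>torus) = (\<Prod>j\<in>UNIV. \<integral>\<^sup>+ v. g j v \<partial>circle)"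
proof -
  let ?f = "\<lambda>j v. g j v * indicator {0..2 * pi} v"
  \<comment> \<open>The product formula for Lebesgue measure is indexed by basis vectors; the
    description operator recovers the coordinate.\<close>
  let ?B = "\<lambda>b :: real ^ 'd. ?f (THE j. b = axis j 1)"
  have the: "(THE j. (axis i 1 :: real ^ 'd) = axis j 1) = i" for i
    by (auto simp: axis_eq_axis)
  have basis: "(\<Prod>b\<in>Basis. F b) = (\<Prod>j\<in>UNIV. F (axis j 1))" for F :: "real ^ 'd \<Rightarrow> ennreal"
    by (simp add: Basis_vec_def UNION_singleton_eq_range prod.reindex inj_on_def axis_eq_axis)
  have prod_div: "(\<Prod>j\<in>A. a j) / ennreal (c ^ card A) = (\<Prod>j\<in>A. a j / ennreal c)" if "finite A" "c > 0"
    for A :: "'d set" and a and c :: real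
    using that
  proof (induction A rule: finite_induct)
    case (insert x A)
    have "inverse (ennreal (c ^ card (insert x A))) = inverse (ennreal c) * inverse (ennreal (c ^ card A))"
      using insert by (simp add: inverse_ennreal ennreal_mult[symmetric])
    then show ?case using insert by (simp add: divide_ennreal_def mult_ac)
  qed (simp add: divide_ennreal_def)
  have "(\<integral>\<^sup>+ y. (\<Prod>j\<in>UNIV. g j (y $ j)) \<partial>torus) =
    (\<integral>\<^sup>+ y. (\<Prod>j\<in>UNIV. g j (y $ j)) * indicator (cbox 0 (\<chi> i. 2 * pi)) y \<partial>lborel) / ennreal ((2 * pi) ^ CARD('d))"
    unfolding torus_def by (subst nn_integral_uniform_measure) (auto simp: emeasure_torus_cube)
  also have "(\<lambda>y :: real ^ 'd. (\<Prod>j\<in>UNIV. g j (y $ j)) * indicator (cbox 0 (\<chi> i. 2 * pi)) y) =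
     (\<lambda>y. \<Prod>b\<in>Basis. ?B b (y \<bullet> b))"
  proof
    fix y :: "real ^ 'd"
    have "indicator (cbox 0 (\<chi> i. 2 * pi)) y = (\<Prod>j\<in>UNIV. indicator {0..2 * pi} (y $ j) :: ennreal)"
      by (auto simp: indicator_def mem_box_cart) 
    then show "(\<Prod>j\<in>UNIV. g j (y $ j)) * indicator (cbox 0 (\<chi> i. 2 * pi)) y = (\<Prod>b\<in>Basis. ?B b (y \<bullet> b))"
      by (simp add: basis the inner_axis prod.distrib)
  qed
  also have "(\<integral>\<^sup>+ y. (\<Prod>b\<in>Basis. ?B b (y \<bullet> b)) \<partial>(lborel :: (real ^ 'd) measure)) = (\<Prod>b\<in>(Basis :: (real ^ 'd) set). \<integral>\<^sup>+ v. ?B b v \<partial>lborel)"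
    by (rule nn_integral_lborel_prod) auto
  also have "\<dots> = (\<Prod>j\<in>UNIV. \<integral>\<^sup>+ v. ?f j v \<partial>lborel)" by (simp add: basis the)
  also have "\<dots> / ennreal ((2 * pi) ^ CARD('d)) = (\<Prod>j\<in>UNIV. (\<integral>\<^sup>+ v. ?f j v \<partial>lborel) / ennreal (2 * pi))"
    by (rule prod_div) auto
  also have "\<dots> = (\<Prod>j\<in>UNIV. \<integral>\<^sup>+ v. g j v \<partial>circle)" by (simp add: nn_integral_circle)
  finally show ?thesis .
qed

lemma AE_torus_box: "AE y :: real ^ 'd in torus. \<forall>j. y $ j \<in> {0..2 * pi}"
  unfolding torus_def by (rule AE_uniform_measureI) (auto simp: mem_box_cart)

lemma AE_torus_chord: "AE y :: real ^ 'd in torus. \<forall>j. chord (x $ j - y $ j) \<noteq> 0"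
proof (subst AE_all_countable, rule allI)
  fix i :: 'd
  let ?N = "{v. chord (x $ i - v) = 0}"
  have N [measurable]: "?N \<in> sets borel" by measurable
  \<comment> \<open>Fubini with a single nontrivial factor, the indicator of the one-dimensional
    null set in coordinate \<open>i\<close>.\<close>
  have "(\<integral>\<^sup>+ y. (\<Prod>j\<in>UNIV. if j = i then indicator ?N (y $ j) else 1) \<partial>torus) =
    (\<Prod>j\<in>UNIV. \<integral>\<^sup>+ v. (if j = i then indicator ?N v else 1) \<partial>circle)"
    by (rule nn_integral_torus_prod) (auto simp del: borel_measurable_indicator_iff)
  also have "\<dots> = 0"
  proof -
    have "(\<integral>\<^sup>+ v. indicator ?N v \<partial>circle) = (\<integral>\<^sup>+ v. 0 \<partial>circle)"
      by (rule nn_integral_cong_AE, use AE_circle_chord[of "x $ i"] in eventually_elim) (simp add: indicator_def)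
    then have "(\<integral>\<^sup>+ v. (if i = i then indicator ?N v else 1) \<partial>circle) = 0" by simp
    then show ?thesis by (intro prod_zero bexI[of _ i]) auto
  qed
  finally have "(\<integral>\<^sup>+ y. indicator ?N (y $ i) \<partial>(torus :: (real ^ 'd) measure)) = 0" by simp
  then have "AE y in (torus :: (real ^ 'd) measure). indicator ?N (y $ i) = (0 :: ennreal)"
    by (subst (asm) nn_integral_0_iff_AE) auto
  then show "AE y in torus. chord (x $ i - y $ i) \<noteq> 0"
    by eventually_elim (simp add: indicator_def split: if_splits)
qed

text \<open>Half-open, so that dyadic cells partition it and every point has exactly one
  representative modulo the periods.\<close>

definition cube :: "(real ^ 'd) set" where
  "cube = {x. \<forall>j. x $ j \<in> {0..<2 * pi}}"

text \<open>The constant is the product of 900 from \<open>detail_bound\<close> and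
  \<open>10 ^ 6\<close> from \<open>nn_integral_detail\<close>.\<close>

definition decay :: "nat \<Rightarrow> nat \<Rightarrow> real" where
  "decay s t = 9 * 10 ^ 8 * 2 powr (- \<bar>real s - real t\<bar> / 2)"

text \<open>Almost orthogonality of the scales: the sup bound of the coarser detail against the
  \<open>L\<^sub>1\<close> bound of the finer one.\<close>

lemma nn_integral_detail_detail:
  assumes x: "x \<in> {0..<2 * pi}"
  shows "(\<integral>\<^sup>+ y. ennreal (\<bar>detail s x y\<bar> * \<bar>detail t x y\<bar>) \<partial>circle) \<le> ennreal (decay s t)"
proof -
  have le: "(\<integral>\<^sup>+ y. ennreal (\<bar>detail s x y\<bar> * \<bar>detail t x y\<bar>) \<partial>circle) \<le> ennreal (decay s t)" if "s \<le> t" for s t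
  proof -
    have "(\<integral>\<^sup>+ y. ennreal (\<bar>detail s x y\<bar> * \<bar>detail t x y\<bar>) \<partial>circle) \<le>
      (\<integral>\<^sup>+ y. ennreal (900 * 2 powr (real s / 2)) * ennreal \<bar>detail t x y\<bar> \<partial>circle)"
    proof (rule nn_integral_mono_AE, use AE_circle in eventually_elim)
      case (elim y)
      have "\<bar>detail s x y\<bar> * \<bar>detail t x y\<bar> \<le> 900 * 2 powr (real s / 2) * \<bar>detail t x y\<bar>"
        by (intro mult_right_mono detail_bound x elim) auto
      then show ?case by (subst ennreal_mult[symmetric]) (auto intro: ennreal_leI)
    qed
    also have "\<dots> = ennreal (900 * 2 powr (real s / 2)) * (\<integral>\<^sup>+ y. ennreal \<bar>detail t x y\<bar> \<partial>circle)"
      by (rule nn_integral_cmult) auto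
    also have "\<dots> \<le> ennreal (900 * 2 powr (real s / 2)) * ennreal (10 ^ 6 * 2 powr (- real t / 2))"
      by (intro mult_left_mono nn_integral_detail x) auto
    also have "\<dots> = ennreal (decay s t)"
    proof -
      have "2 powr (real s / 2) * 2 powr (- real t / 2) = (2::real) powr (- \<bar>real s - real t\<bar> / 2)"
        using that by (simp add: powr_add[symmetric] field_simps)
      then show ?thesis by (subst ennreal_mult[symmetric]) (auto simp: decay_def)
    qed
    finally show ?thesis .
  qed
  show ?thesis
  proof (cases "s \<le> t")
    case True
    then show ?thesis by (rule le)
  next
    case False
    then show ?thesis using le[of t s] by (simp add: mult.commute decay_def abs_minus_commute)
  qed
qed

lemma sum_power_inj_le:
  fixes q :: real
  assumes "finite T" "inj_on g T" "0 \<le> q" "q < 1"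
  shows "(\<Sum>t\<in>T. q ^ g t) \<le> 1 / (1 - q)"
proof -
  have "(\<Sum>t\<in>T. q ^ g t) = (\<Sum>i\<in>g ` T. q ^ i)" using assms by (simp add: sum.reindex)
  also have "\<dots> \<le> (\<Sum>i. q ^ i)" using assms by (intro sum_le_suminf summable_geometric) auto
  also have "\<dots> = 1 / (1 - q)" using assms by (intro suminf_geometric) auto
  finally show ?thesis .
qed

text \<open>Two geometric series with ratio \<open>1 / sqrt 2 \<le> 5/7\<close>, each at most
  \<open>7/2\<close>, which turns the constant \<open>9 * 10 ^ 8\<close> into
  \<open>63 * 10 ^ 8\<close> independently of \<open>s\<close> and \<open>L\<close>.\<close>

lemma sum_decay_le: "(\<Sum>t\<le>L. decay s t) \<le> 63 * 10 ^ 8"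
proof -
  define q where "q = (2::real) powr (- 1 / 2)"
  have q: "0 \<le> q" "q \<le> 5 / 7"
  proof -
    have "q = 1 / sqrt 2" by (simp add: q_def powr_minus_divide powr_half_sqrt)
    moreover have "7 / 5 \<le> sqrt 2" by (rule real_le_rsqrt) (simp add: power2_eq_square)
    then have "1 / sqrt 2 \<le> 1 / (7 / 5)" by (intro divide_left_mono) auto
    ultimately show "q \<le> 5 / 7" by simp
  qed (simp add: q_def)
  have dec: "decay s t = 9 * 10 ^ 8 * q ^ (if t \<le> s then s - t else t - s)" for t
  proof -
    have "2 powr (- real n / 2) = q ^ n" for n
      by (simp add: q_def powr_realpow[symmetric] powr_powr)
    from this[of "if t \<le> s then s - t else t - s"] show ?thesis
      by (simp add: decay_def of_nat_diff split: if_splits)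
  qed
  have geo: "(\<Sum>t\<in>T. q ^ g t) \<le> 7 / 2" if "finite T" "inj_on g T" for T and g :: "nat \<Rightarrow> nat"
  proof -
    have "(\<Sum>t\<in>T. q ^ g t) \<le> 1 / (1 - q)" using that q by (intro sum_power_inj_le) auto
    also have "\<dots> \<le> 7 / 2" using q by (simp add: field_simps)
    finally show ?thesis .
  qed
  have "(\<Sum>t\<le>L. q ^ (if t \<le> s then s - t else t - s)) =
     (\<Sum>t\<in>{..L} \<inter> {t. t \<le> s}. q ^ (s - t)) + (\<Sum>t\<in>{..L} \<inter> - {t. t \<le> s}. q ^ (t - s))"
    by (simp add: if_distrib[of "\<lambda>i. q ^ i"] sum.If_cases)
  also have "\<dots> \<le> 7 / 2 + 7 / 2" by (intro add_mono geo) (auto simp: inj_on_def)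
  finally show ?thesis unfolding dec by (simp flip: sum_distrib_left)
qed

section \<open>Details indexed by several scales and their sums\<close>

definition box_detail :: "('d \<Rightarrow> nat) \<Rightarrow> real ^ 'd \<Rightarrow> real ^ 'd \<Rightarrow> real" where
  "box_detail s x y = (\<Prod>j\<in>UNIV. detail (s j) (x $ j) (y $ j))"

definition block_kernel :: "('d \<Rightarrow> nat) set \<Rightarrow> real ^ 'd \<Rightarrow> real ^ 'd \<Rightarrow> real" where
  "block_kernel A x y = (\<Sum>s\<in>A. box_detail s x y)"

lemma detail_measurable2 [measurable]: "(\<lambda>y :: real ^ 'd. detail s a (y $ j)) \<in> borel_measurable borel"
  by (rule measurable_compose[OF _ detail_measurable]) measurable

lemma box_detail_measurable [measurable]: "box_detail s x \<in> borel_measurable borel"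
  unfolding box_detail_def by measurable

lemma block_kernel_measurable [measurable]: "block_kernel A x \<in> borel_measurable borel"
  unfolding block_kernel_def by measurable

lemma nn_integral_box_detail:
  fixes x :: "real ^ 'd"
  assumes x: "x \<in> cube"
  shows "(\<integral>\<^sup>+ y. ennreal \<bar>box_detail s x y\<bar> \<partial>torus) \<le> ennreal ((10 ^ 6) ^ CARD('d) * 2 powr (- real (\<Sum>j\<in>UNIV. s j) / 2))"
proof -
  have "(\<integral>\<^sup>+ y. ennreal \<bar>box_detail s x y\<bar> \<partial>torus) =
    (\<integral>\<^sup>+ y. (\<Prod>j\<in>UNIV. ennreal \<bar>detail (s j) (x $ j) (y $ j)\<bar>) \<partial>torus)"
    by (simp add: box_detail_def abs_prod prod_ennreal)
  also have "\<dots> = (\<Prod>j\<in>UNIV. \<integral>\<^sup>+ v. ennreal \<bar>detail (s j) (x $ j) v\<bar> \<partial>circle)"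
    by (rule nn_integral_torus_prod) auto
  also have "\<dots> \<le> (\<Prod>j\<in>UNIV. ennreal (10 ^ 6 * 2 powr (- real (s j) / 2)))"
    using x by (intro prod_mono_ennreal nn_integral_detail) (auto simp: cube_def)
  also have "\<dots> = ennreal (\<Prod>j\<in>UNIV. 10 ^ 6 * 2 powr (- real (s j) / 2))"
    by (rule prod_ennreal) auto
  also have "(\<Prod>j\<in>(UNIV :: 'd set). 10 ^ 6 * 2 powr (- real (s j) / 2)) = (10 ^ 6) ^ CARD('d) * 2 powr (- real (\<Sum>j\<in>UNIV. s j) / 2)"
    by (simp add: prod.distrib powr_sum[symmetric] sum_negf sum_divide_distrib[symmetric])
  finally show ?thesis .
qed

lemma nn_integral_block_kernel:
  fixes x :: "real ^ 'd"
  assumes x: "x \<in> cube" and A: "finite A" "\<And>s. s \<in> A \<Longrightarrow> n \<le> (\<Sum>j\<in>UNIV. s j)"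
  shows "(\<integral>\<^sup>+ y. ennreal \<bar>block_kernel A x y\<bar> \<partial>torus) \<le> ennreal (card A * ((10 ^ 6) ^ CARD('d) * 2 powr (- real n / 2)))"
proof -
  have "(\<integral>\<^sup>+ y. ennreal \<bar>block_kernel A x y\<bar> \<partial>torus) \<le> (\<integral>\<^sup>+ y. (\<Sum>s\<in>A. ennreal \<bar>box_detail s x y\<bar>) \<partial>torus)"
    by (intro nn_integral_mono) (auto simp: block_kernel_def sum_ennreal intro!: ennreal_leI sum_abs)
  also have "\<dots> = (\<Sum>s\<in>A. \<integral>\<^sup>+ y. ennreal \<bar>box_detail s x y\<bar> \<partial>torus)" by (rule nn_integral_sum) auto
  also have "\<dots> \<le> (\<Sum>s\<in>A. ennreal ((10 ^ 6) ^ CARD('d) * 2 powr (- real n / 2)))"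
  proof (rule sum_mono)
    fix s assume "s \<in> A"
    then have "2 powr (- real (\<Sum>j\<in>UNIV. s j) / 2) \<le> (2::real) powr (- real n / 2)"
      using A(2)[of s] by (intro powr_mono) (auto simp flip: of_nat_sum)
    then have "(10 ^ 6) ^ CARD('d) * 2 powr (- real (\<Sum>j\<in>UNIV. s j) / 2) \<le> (10 ^ 6 :: real) ^ CARD('d) * 2 powr (- real n / 2)"
      by (rule mult_left_mono) auto
    then show "(\<integral>\<^sup>+ y. ennreal \<bar>box_detail s x y\<bar> \<partial>torus) \<le> ennreal ((10 ^ 6) ^ CARD('d) * 2 powr (- real n / 2))"
      using nn_integral_box_detail[OF x, of s] by (blast intro: order_trans ennreal_leI)
  qed
  also have "\<dots> = ennreal (\<Sum>s\<in>A. (10 ^ 6) ^ CARD('d) * 2 powr (- real n / 2))" by (rule sum_ennreal) auto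
  finally show ?thesis by simp
qed

lemma nn_integral_box_detail_box_detail:
  fixes x :: "real ^ 'd"
  assumes x: "x \<in> cube"
  shows "(\<integral>\<^sup>+ y. ennreal (\<bar>box_detail s x y\<bar> * \<bar>box_detail t x y\<bar>) \<partial>torus) \<le> ennreal (\<Prod>j\<in>UNIV. decay (s j) (t j))"
proof -
  have "(\<integral>\<^sup>+ y. ennreal (\<bar>box_detail s x y\<bar> * \<bar>box_detail t x y\<bar>) \<partial>torus) =
    (\<integral>\<^sup>+ y. (\<Prod>j\<in>UNIV. ennreal (\<bar>detail (s j) (x $ j) (y $ j)\<bar> * \<bar>detail (t j) (x $ j) (y $ j)\<bar>)) \<partial>torus)"
    by (simp add: box_detail_def abs_prod prod_ennreal prod.distrib)
  also have "\<dots> = (\<Prod>j\<in>UNIV. \<integral>\<^sup>+ v. ennreal (\<bar>detail (s j) (x $ j) v\<bar> * \<bar>detail (t j) (x $ j) v\<bar>) \<partial>circle)"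
    by (rule nn_integral_torus_prod) auto
  also have "\<dots> \<le> (\<Prod>j\<in>UNIV. ennreal (decay (s j) (t j)))"
    using x by (intro prod_mono_ennreal nn_integral_detail_detail) (auto simp: cube_def)
  also have "\<dots> = ennreal (\<Prod>j\<in>UNIV. decay (s j) (t j))"
    by (rule prod_ennreal) (auto simp: decay_def)
  finally show ?thesis .
qed

definition block_const :: "nat \<Rightarrow> real" where
  "block_const d = (63 * 10 ^ 8) ^ d"

text \<open>Expanding the square leaves a double sum over \<open>A\<close> with off-diagonal decay.
  Every row sum is bounded by a constant, so only the outer sum counts the indices and the bound is
  linear in \<open>card A\<close>.\<close>

lemma nn_integral_block_kernel_square:
  fixes x :: "real ^ 'd" and A :: "('d \<Rightarrow> nat) set"
  assumes x: "x \<in> cube" and A: "\<And>s j. s \<in> A \<Longrightarrow> s j \<le> L"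
  shows "(\<integral>\<^sup>+ y. ennreal ((block_kernel A x y)\<^sup>2) \<partial>torus) \<le> ennreal (card A * block_const CARD('d))"
proof -
  have sub: "A \<subseteq> PiE UNIV (\<lambda>_. {..L})" using A by (auto simp: PiE_def)
  then have finA: "finite A" by (rule finite_subset) (intro finite_PiE, auto)
  have "(block_kernel A x y)\<^sup>2 \<le> (\<Sum>s\<in>A. \<Sum>t\<in>A. \<bar>box_detail s x y\<bar> * \<bar>box_detail t x y\<bar>)" for y
  proof -
    have "(block_kernel A x y)\<^sup>2 = \<bar>block_kernel A x y\<bar> * \<bar>block_kernel A x y\<bar>" by (simp add: power2_eq_square)
    also have "\<dots> \<le> (\<Sum>s\<in>A. \<bar>box_detail s x y\<bar>) * (\<Sum>s\<in>A. \<bar>box_detail s x y\<bar>)"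
      unfolding block_kernel_def by (intro mult_mono sum_abs sum_nonneg) auto
    finally show ?thesis by (simp add: sum_product)
  qed
  then have "(\<integral>\<^sup>+ y. ennreal ((block_kernel A x y)\<^sup>2) \<partial>torus) \<le>
    (\<integral>\<^sup>+ y. (\<Sum>s\<in>A. \<Sum>t\<in>A. ennreal (\<bar>box_detail s x y\<bar> * \<bar>box_detail t x y\<bar>)) \<partial>torus)"
    by (intro nn_integral_mono) (simp add: sum_ennreal sum_nonneg ennreal_leI)
  also have "\<dots> = (\<Sum>s\<in>A. \<Sum>t\<in>A. \<integral>\<^sup>+ y. ennreal (\<bar>box_detail s x y\<bar> * \<bar>box_detail t x y\<bar>) \<partial>torus)"
    by (subst nn_integral_sum, measurable, intro sum.cong refl nn_integral_sum, measurable)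
  also have "\<dots> \<le> (\<Sum>s\<in>A. \<Sum>t\<in>A. ennreal (\<Prod>j\<in>UNIV. decay (s j) (t j)))"
    by (intro sum_mono nn_integral_box_detail_box_detail x)
  also have "\<dots> = ennreal (\<Sum>s\<in>A. \<Sum>t\<in>A. \<Prod>j\<in>UNIV. decay (s j) (t j))"
    by (simp add: sum_ennreal sum_nonneg prod_nonneg decay_def)
  also have "\<dots> \<le> ennreal (\<Sum>s\<in>A. block_const CARD('d))"
  proof (intro ennreal_leI sum_mono)
    fix s
    \<comment> \<open>Enlarging the inner sum to the full box turns it into a product of
      one-dimensional sums.\<close>
    have "(\<Sum>t\<in>A. \<Prod>j\<in>UNIV. decay (s j) (t j)) \<le> (\<Sum>t\<in>PiE UNIV (\<lambda>_. {..L}). \<Prod>j\<in>UNIV. decay (s j) (t j))"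
      using sub by (intro sum_mono2 finite_PiE) (auto intro!: prod_nonneg simp: decay_def)
    also have "\<dots> = (\<Prod>j\<in>UNIV. \<Sum>t\<le>L. decay (s j) t)" by (rule prod_sum_PiE[symmetric]) auto
    also have "\<dots> \<le> (\<Prod>j\<in>(UNIV :: 'd set). 63 * 10 ^ 8)"
      by (intro prod_mono conjI sum_decay_le sum_nonneg) (auto simp: decay_def)
    finally show "(\<Sum>t\<in>A. \<Prod>j\<in>UNIV. decay (s j) (t j)) \<le> block_const CARD('d)"
      by (simp add: block_const_def)
  qed
  finally show ?thesis by simp
qed

subsection \<open>Kolmogorov widths of a block of scales\<close>

lemma cauchy_schwarz_integral:
  fixes f g :: "'a \<Rightarrow> real"
  assumes [measurable]: "f \<in> borel_measurable M" "g \<in> borel_measurable M"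
    and f: "integrable M (\<lambda>x. (f x)\<^sup>2)" and g: "integrable M (\<lambda>x. (g x)\<^sup>2)"
  shows "integrable M (\<lambda>x. f x * g x)"
    "(LINT x|M. f x * g x)\<^sup>2 \<le> (LINT x|M. (f x)\<^sup>2) * (LINT x|M. (g x)\<^sup>2)"
proof -
  show fg: "integrable M (\<lambda>x. f x * g x)"
  proof (rule Bochner_Integration.integrable_bound)
    show "integrable M (\<lambda>x. (f x)\<^sup>2 + (g x)\<^sup>2)" using f g by (rule Bochner_Integration.integrable_add)
    show "AE x in M. norm (f x * g x) \<le> norm ((f x)\<^sup>2 + (g x)\<^sup>2)"
    proof (intro AE_I2)
      fix x
      have "0 \<le> (\<bar>f x\<bar> - \<bar>g x\<bar>)\<^sup>2" by simp
      then have "2 * (\<bar>f x\<bar> * \<bar>g x\<bar>) \<le> (f x)\<^sup>2 + (g x)\<^sup>2" by (simp add: power2_eq_square algebra_simps)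
      moreover have "0 \<le> \<bar>f x\<bar> * \<bar>g x\<bar>" by simp
      ultimately have "\<bar>f x\<bar> * \<bar>g x\<bar> \<le> (f x)\<^sup>2 + (g x)\<^sup>2" by linarith
      then show "norm (f x * g x) \<le> norm ((f x)\<^sup>2 + (g x)\<^sup>2)" by (simp add: abs_mult)
    qed
  qed auto
  define a b c where "a = (LINT x|M. (f x)\<^sup>2)" and "b = (LINT x|M. f x * g x)" and "c = (LINT x|M. (g x)\<^sup>2)"
  have q: "0 \<le> t\<^sup>2 * a + 2 * t * b + c" for t
  proof -
    have "0 \<le> (LINT x|M. (t * f x + g x)\<^sup>2)" by (intro integral_nonneg_AE) auto
    also have "(\<lambda>x. (t * f x + g x)\<^sup>2) = (\<lambda>x. t\<^sup>2 * (f x)\<^sup>2 + 2 * t * (f x * g x) + (g x)\<^sup>2)"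
      by (auto simp: power2_eq_square algebra_simps)
    also have "(LINT x|M. t\<^sup>2 * (f x)\<^sup>2 + 2 * t * (f x * g x) + (g x)\<^sup>2) = t\<^sup>2 * a + 2 * t * b + c"
      using f g fg by (simp add: a_def b_def c_def)
    finally show ?thesis .
  qed
  have "b\<^sup>2 \<le> a * c"
  proof (cases "a = 0")
    case True
    have "b = 0"
    proof (rule ccontr)
      assume "b \<noteq> 0"
      define t where "t = - (c + 1) / (2 * b)"
      have "2 * t * b = - (c + 1)" using \<open>b \<noteq> 0\<close> by (simp add: t_def)
      moreover have "t\<^sup>2 * a = 0" using True by simp
      ultimately show False using q[of t] by linarith
    qed
    then show ?thesis using True by simp
  next
    case False
    have "a \<ge> 0" unfolding a_def by (intro integral_nonneg_AE) auto
    then have pos: "a > 0" using False by simp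
    have "(- b / a)\<^sup>2 * a + 2 * (- b / a) * b + c = c - b\<^sup>2 / a"
      using pos by (simp add: power2_eq_square field_simps)
    then have "b\<^sup>2 / a \<le> c" using q[of "- b / a"] by simp
    then show ?thesis using pos by (simp add: field_simps)
  qed
  then show "(LINT x|M. f x * g x)\<^sup>2 \<le> (LINT x|M. (f x)\<^sup>2) * (LINT x|M. (g x)\<^sup>2)"
    by (simp add: a_def b_def c_def)
qed

lemma integrable_square_of_nn_integral:
  fixes f :: "'a \<Rightarrow> real"
  assumes [measurable]: "f \<in> borel_measurable M" and le: "(\<integral>\<^sup>+ x. ennreal ((f x)\<^sup>2) \<partial>M) \<le> ennreal B" and B: "B \<ge> 0"
  shows "integrable M (\<lambda>x. (f x)\<^sup>2)" "(LINT x|M. (f x)\<^sup>2) \<le> B"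
proof -
  show "integrable M (\<lambda>x. (f x)\<^sup>2)"
    using le by (intro integrableI_bounded) (auto simp: less_top[symmetric] top_unique)
  show "(LINT x|M. (f x)\<^sup>2) \<le> B"
    using le B by (simp add: integral_eq_nn_integral enn2real_leI)
qed

text \<open>Lower corner of the dyadic cell of level \<open>L\<close>; kernels built from scales up
  to \<open>L\<close> depend on \<open>x\<close> only through it.\<close>

definition snap :: "nat \<Rightarrow> real ^ 'd \<Rightarrow> real ^ 'd" where
  "snap L x = (\<chi> j. cell_left L (x $ j))"

lemma snap_mem_cube: "x \<in> cube \<Longrightarrow> snap L x \<in> cube"
proof -
  assume x: "x \<in> cube"
  have "cell_left L (x $ j) \<in> {0..<2 * pi}" for j
  proof -
    have xj: "x $ j \<in> {0..<2 * pi}" using x by (simp add: cube_def)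
    have "cell_left L (x $ j) + mesh L \<in> cell L (x $ j)" "cell_left L (x $ j) \<in> cell L (x $ j)" by simp_all
    then have "cell_left L (x $ j) + mesh L \<in> {0..2 * pi}" "cell_left L (x $ j) \<in> {0..2 * pi}"
      using cell_subset[OF xj, of L] by blast+
    then have "cell_left L (x $ j) + mesh L \<le> 2 * pi" "0 \<le> cell_left L (x $ j)" by simp_all
    moreover have "mesh L > 0" by simp
    ultimately show ?thesis unfolding atLeastLessThan_iff by linarith
  qed
  then show ?thesis by (simp add: cube_def snap_def)
qed

lemma block_kernel_snap:
  assumes "\<And>s j. s \<in> A \<Longrightarrow> s j \<le> L"
  shows "block_kernel A (snap L x) y = block_kernel A x y"
  unfolding block_kernel_def box_detail_def snap_def
  using assms by (intro sum.cong prod.cong) (auto simp: detail_cell_left)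

lemma snap_image_subset:
  "snap L ` cube \<subseteq> (\<lambda>l. \<chi> j. mesh L * real (l j)) ` PiE (UNIV :: 'd::finite set) (\<lambda>_. {..<2 ^ L :: nat})"
proof
  fix z :: "real ^ 'd" assume "z \<in> snap L ` cube"
  then obtain x where x: "x \<in> cube" "z = snap L x" by auto
  define l where "l = (\<lambda>j. nat \<lfloor>x $ j / mesh L\<rfloor>)"
  have lb: "l j < 2 ^ L" "z $ j = mesh L * real (l j)" for j
  proof -
    have xj: "0 \<le> x $ j" "x $ j < 2 * pi" using x by (auto simp: cube_def)
    then have nn: "0 \<le> \<lfloor>x $ j / mesh L\<rfloor>" by simp
    have "\<lfloor>x $ j / mesh L\<rfloor> < 2 ^ L" using xj by (intro floor_mesh_less)
    then show "l j < 2 ^ L" using nn by (simp add: l_def nat_less_iff)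
    show "z $ j = mesh L * real (l j)" using nn by (simp add: x(2) snap_def cell_left_def l_def)
  qed
  then have "z = (\<chi> j. mesh L * real (l j))" by (simp add: vec_eq_iff)
  moreover have "l \<in> PiE UNIV (\<lambda>_. {..<2 ^ L})" using lb by auto
  ultimately show "z \<in> (\<lambda>l. \<chi> j. mesh L * real (l j)) ` PiE UNIV (\<lambda>_. {..<2 ^ L})" by blast
qed

lemma finite_snap: "finite (snap L ` (cube :: (real ^ 'd) set))"
  and card_snap: "card (snap L ` (cube :: (real ^ 'd) set)) \<le> 2 ^ (L * CARD('d))"
proof -
  let ?P = "PiE (UNIV :: 'd set) (\<lambda>_. {..<2 ^ L :: nat})"
  have fin: "finite ?P" by (intro finite_PiE) auto
  show "finite (snap L ` (cube :: (real ^ 'd) set))"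
    using snap_image_subset by (rule finite_subset) (use fin in simp)
  have "card (snap L ` (cube :: (real ^ 'd) set)) \<le> card ((\<lambda>l. (\<chi> j. mesh L * real (l j)) :: real ^ 'd) ` ?P)"
    using fin by (intro card_mono snap_image_subset) auto
  also have "\<dots> \<le> card ?P" by (rule card_image_le[OF fin])
  also have "\<dots> = 2 ^ (L * CARD('d))" by (simp add: card_PiE power_mult)
  finally show "card (snap L ` (cube :: (real ^ 'd) set)) \<le> 2 ^ (L * CARD('d))" .
qed

lemma zero_mem_cube: "0 \<in> cube"
  by (simp add: cube_def)

text \<open>All values are attained on the finite grid \<open>K\<close>. There the kernel sections
  have the Gram matrix \<open>\<Gamma>\<close>, and Cauchy-Schwarz against the density is exactly
  the domination hypothesis of \<open>gram_width\<close>. The functions \<open>u\<close> are chosen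
  before the density and its radius.\<close>

lemma block_width:
  fixes A :: "('d::finite \<Rightarrow> nat) set"
  assumes A: "\<And>s j. s \<in> A \<Longrightarrow> s j \<le> L" and m: "m > 0" and D: "D > 0" "card A * block_const CARD('d) \<le> D"
  shows "\<exists>u :: nat \<Rightarrow> real ^ 'd \<Rightarrow> real. \<forall>\<phi> R. \<phi> \<in> borel_measurable borel \<longrightarrow> R \<ge> 0 \<longrightarrow>
    (\<integral>\<^sup>+ y. ennreal ((\<phi> y)\<^sup>2) \<partial>torus) \<le> ennreal (R\<^sup>2) \<longrightarrow>
    (\<exists>w. \<forall>x\<in>cube. \<bar>(LINT y|torus. block_kernel A x y * \<phi> y) - (\<Sum>i<m. w i * u i (snap L x))\<bar>
      \<le> 70 * R * sqrt (D * ln (2 * 2 ^ (L * CARD('d))) / m))"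
proof -
  define K where "K = snap L ` (cube :: (real ^ 'd) set)"
  have K: "finite K" "K \<noteq> {}" "card K \<le> 2 ^ (L * CARD('d))" "K \<subseteq> cube"
    using finite_snap card_snap zero_mem_cube snap_mem_cube unfolding K_def by auto
  define \<Gamma> where "\<Gamma> = (\<lambda>k l :: real ^ 'd. LINT y|torus. block_kernel A k y * block_kernel A l y)"
  have bk: "block_kernel A (snap L x) y = block_kernel A x y" for x y
    by (rule block_kernel_snap) (rule A)
  have sq: "integrable torus (\<lambda>y. (block_kernel A k y)\<^sup>2)" "(LINT y|torus. (block_kernel A k y)\<^sup>2) \<le> D" if "k \<in> K" for k
  proof -
    have "(\<integral>\<^sup>+ y. ennreal ((block_kernel A k y)\<^sup>2) \<partial>torus) \<le> ennreal (card A * block_const CARD('d))"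
      using that K A by (intro nn_integral_block_kernel_square) auto
    also have "\<dots> \<le> ennreal D" by (rule ennreal_leI[OF D(2)])
    finally have le: "(\<integral>\<^sup>+ y. ennreal ((block_kernel A k y)\<^sup>2) \<partial>torus) \<le> ennreal D" .
    show "integrable torus (\<lambda>y. (block_kernel A k y)\<^sup>2)" "(LINT y|torus. (block_kernel A k y)\<^sup>2) \<le> D"
      using D(1) by (intro integrable_square_of_nn_integral[OF _ le], simp, simp)+
  qed
  have int2: "integrable torus (\<lambda>y. block_kernel A k y * block_kernel A l y)" if "k \<in> K" "l \<in> K" for k l
    using sq(1)[OF that(1)] sq(1)[OF that(2)] by (intro cauchy_schwarz_integral(1)) auto
  have quad_int: "integrable torus (\<lambda>y. (\<Sum>k\<in>K. c k * block_kernel A k y)\<^sup>2)"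
    and quad: "(\<Sum>k\<in>K. \<Sum>l\<in>K. c k * c l * \<Gamma> k l) = (LINT y|torus. (\<Sum>k\<in>K. c k * block_kernel A k y)\<^sup>2)" for c
  proof -
    have eq: "(\<Sum>k\<in>K. c k * block_kernel A k y)\<^sup>2 = (\<Sum>k\<in>K. \<Sum>l\<in>K. c k * c l * (block_kernel A k y * block_kernel A l y))" for y
      by (simp add: power2_eq_square sum_product mult_ac)
    show "integrable torus (\<lambda>y. (\<Sum>k\<in>K. c k * block_kernel A k y)\<^sup>2)"
      unfolding eq by (intro Bochner_Integration.integrable_sum integrable_mult_right int2)
    have "(LINT y|torus. (\<Sum>k\<in>K. c k * block_kernel A k y)\<^sup>2) =
      (\<Sum>k\<in>K. \<Sum>l\<in>K. LINT y|torus. c k * c l * (block_kernel A k y * block_kernel A l y))"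
      unfolding eq by (subst Bochner_Integration.integral_sum, intro Bochner_Integration.integrable_sum integrable_mult_right int2, assumption+,
        intro sum.cong refl Bochner_Integration.integral_sum integrable_mult_right int2)
    then show "(\<Sum>k\<in>K. \<Sum>l\<in>K. c k * c l * \<Gamma> k l) = (LINT y|torus. (\<Sum>k\<in>K. c k * block_kernel A k y)\<^sup>2)"
      by (simp add: \<Gamma>_def)
  qed
  have "\<exists>u :: nat \<Rightarrow> real ^ 'd \<Rightarrow> real. \<forall>v R. R \<ge> 0 \<longrightarrow>
    (\<forall>c. (\<Sum>k\<in>K. c k * v k)\<^sup>2 \<le> R\<^sup>2 * (\<Sum>k\<in>K. \<Sum>l\<in>K. c k * c l * \<Gamma> k l)) \<longrightarrow>
    (\<exists>w. \<forall>k\<in>K. \<bar>v k - (\<Sum>i<m. w i * u i k)\<bar> \<le> 70 * R * sqrt (D * ln (2 * real (card K)) / m))"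
  proof (rule gram_width[OF K(1,2) m D(1)])
    show "\<Gamma> k k \<le> D" if "k \<in> K" for k using sq(2)[OF that] by (simp add: \<Gamma>_def power2_eq_square)
    show "\<Gamma> k l = \<Gamma> l k" for k l by (simp add: \<Gamma>_def mult.commute)
    show "0 \<le> (\<Sum>k\<in>K. \<Sum>l\<in>K. c k * c l * \<Gamma> k l)" for c unfolding quad by (intro integral_nonneg_AE) auto
  qed
  then obtain u :: "nat \<Rightarrow> real ^ 'd \<Rightarrow> real" where u: "\<And>v R. R \<ge> 0 \<Longrightarrow>
    (\<forall>c. (\<Sum>k\<in>K. c k * v k)\<^sup>2 \<le> R\<^sup>2 * (\<Sum>k\<in>K. \<Sum>l\<in>K. c k * c l * \<Gamma> k l)) \<Longrightarrow>
    (\<exists>w. \<forall>k\<in>K. \<bar>v k - (\<Sum>i<m. w i * u i k)\<bar> \<le> 70 * R * sqrt (D * ln (2 * real (card K)) / m))" by blast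
  have "\<exists>w. \<forall>x\<in>cube. \<bar>(LINT y|torus. block_kernel A x y * \<phi> y) - (\<Sum>i<m. w i * u i (snap L x))\<bar>
      \<le> 70 * R * sqrt (D * ln (2 * 2 ^ (L * CARD('d))) / m)"
    if phi [measurable]: "\<phi> \<in> borel_measurable borel" and R: "R \<ge> 0"
      and le: "(\<integral>\<^sup>+ y. ennreal ((\<phi> y)\<^sup>2) \<partial>torus) \<le> ennreal (R\<^sup>2)" for \<phi> R
  proof -
    define v where "v = (\<lambda>k. LINT y|torus. block_kernel A k y * \<phi> y)"
    have p2: "integrable torus (\<lambda>y. (\<phi> y)\<^sup>2)" "(LINT y|torus. (\<phi> y)\<^sup>2) \<le> R\<^sup>2"
      by (rule integrable_square_of_nn_integral[OF _ le]; simp)+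
    have "(\<Sum>k\<in>K. c k * v k)\<^sup>2 \<le> R\<^sup>2 * (\<Sum>k\<in>K. \<Sum>l\<in>K. c k * c l * \<Gamma> k l)" for c
    proof -
      have "(\<Sum>k\<in>K. c k * v k) = (\<Sum>k\<in>K. LINT y|torus. c k * (block_kernel A k y * \<phi> y))"
        by (simp add: v_def)
      also have "\<dots> = (LINT y|torus. (\<Sum>k\<in>K. c k * (block_kernel A k y * \<phi> y)))"
        using sq(1) p2(1) by (intro Bochner_Integration.integral_sum[symmetric] integrable_mult_right cauchy_schwarz_integral(1)) auto
      also have "\<dots> = (LINT y|torus. (\<Sum>k\<in>K. c k * block_kernel A k y) * \<phi> y)"
        by (simp only: sum_distrib_right mult.assoc)
      finally have "(\<Sum>k\<in>K. c k * v k)\<^sup>2 = (LINT y|torus. (\<Sum>k\<in>K. c k * block_kernel A k y) * \<phi> y)\<^sup>2" by simp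
      also have "\<dots> \<le> (LINT y|torus. (\<Sum>k\<in>K. c k * block_kernel A k y)\<^sup>2) * (LINT y|torus. (\<phi> y)\<^sup>2)"
        using quad_int p2(1) by (intro cauchy_schwarz_integral(2)) auto
      also have "\<dots> \<le> (LINT y|torus. (\<Sum>k\<in>K. c k * block_kernel A k y)\<^sup>2) * R\<^sup>2"
        using p2(2) by (intro mult_left_mono integral_nonneg_AE) auto
      finally show ?thesis unfolding quad by (simp add: mult.commute)
    qed
    then obtain w where w: "\<And>k. k \<in> K \<Longrightarrow> \<bar>v k - (\<Sum>i<m. w i * u i k)\<bar> \<le> 70 * R * sqrt (D * ln (2 * real (card K)) / m)"
      using u[OF R, of v] by blast
    have "\<bar>(LINT y|torus. block_kernel A x y * \<phi> y) - (\<Sum>i<m. w i * u i (snap L x))\<bar>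
      \<le> 70 * R * sqrt (D * ln (2 * 2 ^ (L * CARD('d))) / m)" if x: "x \<in> cube" for x
    proof -
      have "snap L x \<in> K" using x by (simp add: K_def)
      from w[OF this] have "\<bar>(LINT y|torus. block_kernel A x y * \<phi> y) - (\<Sum>i<m. w i * u i (snap L x))\<bar>
        \<le> 70 * R * sqrt (D * ln (2 * real (card K)) / m)"
        by (simp add: v_def bk)
      also have "\<dots> \<le> 70 * R * sqrt (D * ln (2 * 2 ^ (L * CARD('d))) / m)"
      proof -
        have "real (card K) \<le> 2 ^ (L * CARD('d))" using K(3) by (metis of_nat_le_iff of_nat_numeral of_nat_power)
        moreover have "0 < real (card K)" using K(1,2) by (simp add: card_gt_0_iff)
        ultimately have "ln (2 * real (card K)) \<le> ln (2 * 2 ^ (L * CARD('d)))" by simp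
        then show ?thesis using R D(1) by (intro mult_left_mono real_sqrt_le_mono divide_right_mono) auto
      qed
      finally show ?thesis .
    qed
    then show ?thesis by blast
  qed
  then show ?thesis by blast
qed

subsection \<open>The convolution and its discretization\<close>

text \<open>The midpoint between 1/2, the strength of the singularity, and \<open>1 - 1 / p\<close>,
  below which powers of the chord are integrable to the conjugate exponent. The surplus over 1/2 is
  \<open>smoothness p\<close>, which is available as a power of the mesh.\<close>

definition sing_exponent :: "real \<Rightarrow> real" where
  "sing_exponent p = 3 / 4 - 1 / (2 * p)"

definition smoothness :: "real \<Rightarrow> real" where
  "smoothness p = 1 / 4 - 1 / (2 * p)"

definition sing_weight :: "real \<Rightarrow> real ^ 'd \<Rightarrow> real ^ 'd \<Rightarrow> real" where
  "sing_weight b x y = (\<Prod>j\<in>UNIV. chord (x $ j - y $ j) powr - b)"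

lemma sing_weight_measurable [measurable]: "sing_weight b x \<in> borel_measurable borel"
  unfolding sing_weight_def by measurable

lemma sing_weight_nonneg [simp]: "sing_weight b x y \<ge> 0"
  by (simp add: sing_weight_def prod_nonneg)

definition weight_const :: "real \<Rightarrow> nat \<Rightarrow> real" where
  "weight_const p d = 1 + (1 + 12 / (1 - p / (p - 1) * sing_exponent p)) ^ d"

lemma smoothness_bounds: "p > 2 \<Longrightarrow> 0 < smoothness p" "p > 2 \<Longrightarrow> smoothness p \<le> 1"
  by (auto simp: smoothness_def field_simps)

lemma sing_exponent_eq: "sing_exponent p = 1 / 2 + smoothness p"
  by (simp add: sing_exponent_def smoothness_def)

lemma sing_exponent_conj:
  assumes p: "p > 2"
  shows "0 \<le> p / (p - 1) * sing_exponent p" "p / (p - 1) * sing_exponent p < 1"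
proof -
  have "0 < sing_exponent p" using smoothness_bounds(1)[OF p] by (simp add: sing_exponent_eq)
  then show "0 \<le> p / (p - 1) * sing_exponent p" using p by simp
  have "p * sing_exponent p = 3 * p / 4 - 1 / 2" using p by (simp add: sing_exponent_def field_simps)
  also have "\<dots> < p - 1" using p by simp
  finally show "p / (p - 1) * sing_exponent p < 1" using p by (simp add: field_simps)
qed

lemma weight_const_ge_1: "p > 2 \<Longrightarrow> weight_const p d \<ge> 1"
  using sing_exponent_conj[of p] by (simp add: weight_const_def)

text \<open>Young's inequality separates density and weight: the density contributes at most the 1
  in \<open>weight_const\<close>, and the weight raised to the conjugate exponent factors over the
  coordinates.\<close>

lemma nn_integral_weight:
  fixes x :: "real ^ 'd" and \<phi> :: "real ^ 'd \<Rightarrow> real"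
  assumes p: "p > 2" and phi [measurable]: "\<phi> \<in> borel_measurable borel"
    and le: "(\<integral>\<^sup>+ y. ennreal (\<bar>\<phi> y\<bar> powr p) \<partial>torus) \<le> 1" and x: "x \<in> cube"
  shows "(\<integral>\<^sup>+ y. ennreal (\<bar>\<phi> y\<bar> * sing_weight (sing_exponent p) x y) \<partial>torus) \<le> ennreal (weight_const p CARD('d))"
proof -
  define q where "q = p / (p - 1)"
  define b where "b = sing_exponent p"
  have q: "q > 1" "1 / p + 1 / q = 1" using p by (auto simp: q_def field_simps)
  have bq: "0 \<le> q * b" "q * b < 1" using sing_exponent_conj[OF p] by (auto simp: q_def b_def)
  have "(\<integral>\<^sup>+ y. ennreal (\<bar>\<phi> y\<bar> * sing_weight b x y) \<partial>torus) \<le>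
    (\<integral>\<^sup>+ y. ennreal (\<bar>\<phi> y\<bar> powr p) + (\<Prod>j\<in>UNIV. ennreal (chord (x $ j - y $ j) powr - (q * b))) \<partial>torus)"
  proof (rule nn_integral_mono)
    fix y :: "real ^ 'd"
    have "\<bar>\<phi> y\<bar> * sing_weight b x y \<le> \<bar>\<phi> y\<bar> powr p / p + sing_weight b x y powr q / q"
      using p q by (intro Youngs_inequality) auto
    also have "\<dots> \<le> \<bar>\<phi> y\<bar> powr p / 1 + sing_weight b x y powr q / 1"
      using p q by (intro add_mono divide_left_mono) auto
    also have "sing_weight b x y powr q = (\<Prod>j\<in>UNIV. chord (x $ j - y $ j) powr - (q * b))"
      unfolding sing_weight_def prod_powr_distrib by (simp add: powr_powr mult.commute)
    finally have "\<bar>\<phi> y\<bar> * sing_weight b x y \<le> \<bar>\<phi> y\<bar> powr p + (\<Prod>j\<in>UNIV. chord (x $ j - y $ j) powr - (q * b))" by simp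
    then show "ennreal (\<bar>\<phi> y\<bar> * sing_weight b x y) \<le> ennreal (\<bar>\<phi> y\<bar> powr p) + (\<Prod>j\<in>UNIV. ennreal (chord (x $ j - y $ j) powr - (q * b)))"
      by (subst prod_ennreal) (auto simp: prod_nonneg ennreal_leI simp flip: ennreal_plus)
  qed
  also have "\<dots> = (\<integral>\<^sup>+ y. ennreal (\<bar>\<phi> y\<bar> powr p) \<partial>torus) +
     (\<integral>\<^sup>+ y. (\<Prod>j\<in>UNIV. ennreal (chord (x $ j - y $ j) powr - (q * b))) \<partial>torus)"
    by (rule nn_integral_add) auto
  also have "(\<integral>\<^sup>+ y. (\<Prod>j\<in>UNIV. ennreal (chord (x $ j - y $ j) powr - (q * b))) \<partial>torus) =
     (\<Prod>j\<in>UNIV. \<integral>\<^sup>+ v. ennreal (chord (x $ j - v) powr - (q * b)) \<partial>circle)"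
    by (rule nn_integral_torus_prod) auto
  also have "\<dots> \<le> (\<Prod>j\<in>(UNIV :: 'd set). ennreal (1 + 12 / (1 - q * b)))"
  proof (rule prod_mono_ennreal)
    fix j :: 'd
    have "x $ j \<in> {0..2 * pi}" using x by (auto simp: cube_def less_imp_le)
    then show "(\<integral>\<^sup>+ v. ennreal (chord (x $ j - v) powr - (q * b)) \<partial>circle) \<le> ennreal (1 + 12 / (1 - q * b))"
      using bq by (intro nn_integral_circle_chord_powr)
  qed
  also have "\<dots> = ennreal ((1 + 12 / (1 - q * b)) ^ CARD('d))" using bq by (subst prod_ennreal) auto
  also have "(\<integral>\<^sup>+ y. ennreal (\<bar>\<phi> y\<bar> powr p) \<partial>torus) + ennreal ((1 + 12 / (1 - q * b)) ^ CARD('d)) \<le>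
     1 + ennreal ((1 + 12 / (1 - q * b)) ^ CARD('d))" using le by (rule add_right_mono)
  also have "\<dots> = ennreal (weight_const p CARD('d))" using bq
    unfolding weight_const_def q_def[symmetric] b_def[symmetric] by (subst ennreal_plus) auto
  finally show ?thesis by (simp add: b_def add_left_mono)
qed

lemma integral_weighted_bound:
  fixes x :: "real ^ 'd" and \<phi> :: "real ^ 'd \<Rightarrow> real" and g :: "real ^ 'd \<Rightarrow> real"
  assumes p: "p > 2" and phi [measurable]: "\<phi> \<in> borel_measurable borel"
    and le: "(\<integral>\<^sup>+ y. ennreal (\<bar>\<phi> y\<bar> powr p) \<partial>torus) \<le> 1" and x: "x \<in> cube"
    and g [measurable]: "g \<in> borel_measurable borel" and B: "B \<ge> 0"
    and bound: "AE y in torus. \<bar>g y\<bar> \<le> B * sing_weight (sing_exponent p) x y"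
  shows "integrable torus (\<lambda>y. g y * \<phi> y)"
    "\<bar>LINT y|torus. g y * \<phi> y\<bar> \<le> B * weight_const p CARD('d)"
proof -
  have "(\<integral>\<^sup>+ y. ennreal \<bar>g y * \<phi> y\<bar> \<partial>torus) \<le> (\<integral>\<^sup>+ y. ennreal B * ennreal (\<bar>\<phi> y\<bar> * sing_weight (sing_exponent p) x y) \<partial>torus)"
  proof (rule nn_integral_mono_AE, use bound in eventually_elim)
    case (elim y)
    have "\<bar>g y * \<phi> y\<bar> \<le> (B * sing_weight (sing_exponent p) x y) * \<bar>\<phi> y\<bar>"
      unfolding abs_mult using elim by (rule mult_right_mono) auto
    then have "ennreal \<bar>g y * \<phi> y\<bar> \<le> ennreal (B * (\<bar>\<phi> y\<bar> * sing_weight (sing_exponent p) x y))"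
      by (intro ennreal_leI) (simp add: mult_ac)
    also have "\<dots> = ennreal B * ennreal (\<bar>\<phi> y\<bar> * sing_weight (sing_exponent p) x y)"
      using B by (intro ennreal_mult) auto
    finally show ?case .
  qed
  also have "\<dots> = ennreal B * (\<integral>\<^sup>+ y. ennreal (\<bar>\<phi> y\<bar> * sing_weight (sing_exponent p) x y) \<partial>torus)"
    by (rule nn_integral_cmult) auto
  also have "\<dots> \<le> ennreal B * ennreal (weight_const p CARD('d))"
    by (intro mult_left_mono nn_integral_weight p phi le x) auto
  also have "\<dots> = ennreal (B * weight_const p CARD('d))"
    using B weight_const_ge_1[OF p, of "CARD('d)"] by (intro ennreal_mult[symmetric]) auto
  finally have fin: "(\<integral>\<^sup>+ y. ennreal \<bar>g y * \<phi> y\<bar> \<partial>torus) \<le> ennreal (B * weight_const p CARD('d))" .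
  show int: "integrable torus (\<lambda>y. g y * \<phi> y)"
    using fin by (intro integrableI_bounded) (auto simp: less_top[symmetric] top_unique)
  have "ennreal \<bar>LINT y|torus. g y * \<phi> y\<bar> \<le> (\<integral>\<^sup>+ y. ennreal \<bar>g y * \<phi> y\<bar> \<partial>torus)"
    using integral_norm_bound_ennreal[OF int] by simp
  also note fin
  finally show "\<bar>LINT y|torus. g y * \<phi> y\<bar> \<le> B * weight_const p CARD('d)"
    using B weight_const_ge_1[OF p, of "CARD('d)"] by (simp add: ennreal_le_iff)
qed

definition product_kernel :: "real ^ 'd \<Rightarrow> real ^ 'd \<Rightarrow> real" where
  "product_kernel x y = (\<Prod>j\<in>UNIV. half_kernel (x $ j - y $ j))"

definition product_avg :: "nat \<Rightarrow> real ^ 'd \<Rightarrow> real ^ 'd \<Rightarrow> real" where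
  "product_avg L x y = (\<Prod>j\<in>UNIV. cell_avg L (x $ j) (y $ j))"

lemma product_kernel_measurable [measurable]: "product_kernel x \<in> borel_measurable borel"
  unfolding product_kernel_def by measurable

lemma product_avg_eq_block:
  "product_avg L x y = block_kernel (PiE UNIV (\<lambda>_. {..L})) x y"
  unfolding product_avg_def block_kernel_def box_detail_def sum_detail[symmetric]
  by (rule prod_sum_PiE) auto

lemma product_avg_measurable [measurable]: "product_avg L x \<in> borel_measurable borel"
proof -
  have "product_avg L x = block_kernel (PiE UNIV (\<lambda>_. {..L})) x" by (rule ext) (rule product_avg_eq_block)
  then show ?thesis by simp
qed

text \<open>The chord is at most 2, so a stronger singularity may be allowed at the cost of a factor
  2.\<close>

lemma half_kernel_le_powr:
  assumes b: "0 \<le> b" "b \<le> 1"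
  shows "\<bar>half_kernel v\<bar> \<le> 36 * chord v powr - (1 / 2 + b)"
proof (cases "chord v = 0")
  case True
  then show ?thesis using half_kernel_bound[of v] by simp
next
  case False
  then have r: "chord v > 0" by (simp add: less_le)
  have "chord v powr b \<le> 2 powr 1"
  proof (cases "chord v \<le> 1")
    case True
    then have "chord v powr b \<le> 1" using r b by (intro powr_le1) auto
    then show ?thesis by simp
  next
    case False
    have "chord v powr b \<le> 2 powr b" using chord_le_2 r b by (intro powr_mono2) auto
    also have "\<dots> \<le> 2 powr 1" using b by (intro powr_mono) auto
    finally show ?thesis .
  qed
  moreover have "chord v powr (- 1 / 2) = chord v powr - (1 / 2 + b) * chord v powr b"
    by (simp add: powr_add[symmetric])
  ultimately have "chord v powr (- 1 / 2) \<le> chord v powr - (1 / 2 + b) * 2"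
    by (simp add: mult_left_mono)
  then show ?thesis using half_kernel_bound[of v] by linarith
qed

text \<open>Interpolation \<open>min 1 u \<le> u powr b\<close>: a positive power of the mesh is
  bought with a slightly stronger singularity.\<close>

lemma profile_le_powr:
  assumes b: "0 \<le> b" "b \<le> 1" and h: "h > 0" and r: "r > 0"
  shows "profile h r \<le> h powr b * r powr - (1 / 2 + b)"
proof -
  have "min 1 (h / r) \<le> (h / r) powr b"
  proof (cases "h / r \<le> 1")
    case True
    then have "(h / r) powr 1 \<le> (h / r) powr b" using h r b by (intro powr_mono') auto
    then show ?thesis using True h r by simp
  next
    case False
    then have "1 \<le> (h / r) powr b" using b by (intro ge_one_powr_ge_zero) auto
    then show ?thesis using False by simp
  qed
  then have "profile h r \<le> r powr (- 1 / 2) * (h / r) powr b"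
    unfolding profile_def by (intro mult_left_mono) auto
  also have "\<dots> = h powr b * (r powr (- 1 / 2) * r powr - b)"
    using h r by (simp add: powr_divide powr_minus_divide)
  also have "r powr (- 1 / 2) * r powr - b = r powr - (1 / 2 + b)"
    by (simp add: powr_add[symmetric])
  finally show ?thesis .
qed

lemma product_kernel_bound:
  fixes x :: "real ^ 'd"
  assumes p: "p > 2"
  shows "\<bar>product_kernel x y\<bar> \<le> 36 ^ CARD('d) * sing_weight (sing_exponent p) x y"
proof -
  have "\<bar>product_kernel x y\<bar> \<le> (\<Prod>j\<in>UNIV. 36 * chord (x $ j - y $ j) powr - sing_exponent p)"
    unfolding product_kernel_def abs_prod sing_exponent_eq
    using smoothness_bounds[OF p] by (intro prod_mono conjI half_kernel_le_powr) auto
  then show ?thesis by (simp add: prod.distrib sing_weight_def)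
qed

text \<open>Both products are normalized by their common majorant so that all factors are at most 1;
  the difference of two such products is at most the sum of the differences of the factors.\<close>

lemma product_kernel_avg_diff:
  fixes x :: "real ^ 'd"
  assumes p: "p > 2" and x: "x \<in> cube"
  shows "AE y in torus. \<bar>product_kernel x y - product_avg L x y\<bar>
    \<le> (CARD('d) * 9000 ^ CARD('d) * mesh L powr smoothness p) * sing_weight (sing_exponent p) x y"
  using AE_torus_box AE_torus_chord[of x]
proof eventually_elim
  case (elim y)
  define b where "b = smoothness p"
  have b: "0 \<le> b" "b \<le> 1" using smoothness_bounds[OF p] by (auto simp: b_def)
  define h where "h = mesh L powr b"
  have h: "0 \<le> h" "h \<le> 6.3"
  proof -
    have "mesh L \<le> 2 * pi" by (simp add: mesh_def field_simps)
    also have "\<dots> \<le> 6.3" using pi_approx by simp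
    finally have m: "mesh L \<le> 6.3" .
    show "h \<le> 6.3"
    proof (cases "mesh L \<le> 1")
      case True
      then have "h \<le> 1" unfolding h_def using b by (intro powr_le1) auto
      then show ?thesis by simp
    next
      case False
      then have "h \<le> mesh L powr 1" unfolding h_def using b by (intro powr_mono) auto
      then show ?thesis using m by simp
    qed
  qed (simp add: h_def)
  define w where "w = (\<lambda>j. chord (x $ j - y $ j) powr - (1 / 2 + b))"
  define F where "F = (\<lambda>j. half_kernel (x $ j - y $ j))"
  define E where "E = (\<lambda>j. cell_avg L (x $ j) (y $ j))"
  have w: "w j > 0" for j using elim by (auto simp: w_def)
  have F: "\<bar>F j\<bar> \<le> 36 * w j" for j unfolding F_def w_def by (rule half_kernel_le_powr[OF b])
  have FE: "\<bar>F j - E j\<bar> \<le> 1400 * h * w j" for j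
  proof -
    have "\<bar>F j - E j\<bar> \<le> 1400 * profile (mesh L) (chord (x $ j - y $ j))"
      unfolding F_def E_def using x elim by (intro cell_avg_error) (auto simp: cube_def)
    also have "\<dots> \<le> 1400 * (h * w j)" unfolding h_def w_def
      using elim by (intro mult_left_mono profile_le_powr[OF b]) (auto simp: less_le)
    finally show ?thesis by simp
  qed
  \<comment> \<open>The normalization 9000 exceeds \<open>36 + 1400 * 6.3\<close>, where 6.3 bounds
    the period.\<close>
  have E: "\<bar>E j\<bar> \<le> 9000 * w j" for j
  proof -
    have "\<bar>E j\<bar> \<le> 36 * w j + 1400 * h * w j" using F[of j] FE[of j] by linarith
    also have "\<dots> \<le> 36 * w j + 1400 * 6.3 * w j" using h w[of j] by (intro add_left_mono mult_right_mono) auto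
    also have "\<dots> \<le> 9000 * w j" using w[of j] by simp
    finally show ?thesis .
  qed
  have F': "\<bar>F j\<bar> \<le> 9000 * w j" for j using F[of j] w[of j] by linarith
  have "norm ((\<Prod>j\<in>UNIV. F j / (9000 * w j)) - (\<Prod>j\<in>UNIV. E j / (9000 * w j))) \<le>
    (\<Sum>j\<in>(UNIV :: 'd set). norm (F j / (9000 * w j) - E j / (9000 * w j)))"
    using F' E w by (intro norm_prod_diff) (auto simp: abs_divide divide_le_eq abs_mult abs_of_pos)
  also have "\<dots> \<le> (\<Sum>j\<in>(UNIV :: 'd set). h)"
  proof (rule sum_mono)
    fix j :: 'd
    have "norm (F j / (9000 * w j) - E j / (9000 * w j)) = \<bar>F j - E j\<bar> / (9000 * w j)"
      using w[of j] by (simp add: diff_divide_distrib[symmetric] abs_divide abs_mult)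
    also have "\<dots> \<le> (1400 * h * w j) / (9000 * w j)" using FE[of j] w[of j] by (intro divide_right_mono) auto
    also have "\<dots> \<le> h" using w[of j] h by simp
    finally show "norm (F j / (9000 * w j) - E j / (9000 * w j)) \<le> h" .
  qed
  finally have "\<bar>(\<Prod>j\<in>UNIV. F j / (9000 * w j)) - (\<Prod>j\<in>UNIV. E j / (9000 * w j))\<bar> \<le> CARD('d) * h" by simp
  moreover have "(\<Prod>j\<in>UNIV. G j / (9000 * w j)) = (\<Prod>j\<in>UNIV. G j) / (9000 ^ CARD('d) * (\<Prod>j\<in>UNIV. w j))" for G
    by (simp add: prod_dividef prod.distrib)
  ultimately have "\<bar>(\<Prod>j\<in>UNIV. F j) - (\<Prod>j\<in>UNIV. E j)\<bar> / (9000 ^ CARD('d) * (\<Prod>j\<in>UNIV. w j)) \<le> CARD('d) * h"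
    using w by (simp add: diff_divide_distrib[symmetric] abs_divide abs_mult abs_prod abs_of_pos)
  moreover have "(\<Prod>j\<in>UNIV. w j) > 0" using w by (intro prod_pos) auto
  ultimately have "\<bar>(\<Prod>j\<in>UNIV. F j) - (\<Prod>j\<in>UNIV. E j)\<bar> \<le> CARD('d) * h * (9000 ^ CARD('d) * (\<Prod>j\<in>UNIV. w j))"
    by (simp add: divide_le_eq)
  then show ?case
    by (simp add: product_kernel_def product_avg_def F_def E_def w_def sing_weight_def sing_exponent_eq b_def h_def mult_ac)
qed

lemma convolution_remainder:
  fixes x :: "real ^ 'd" and \<phi> :: "real ^ 'd \<Rightarrow> real"
  assumes p: "p > 2" and phi: "\<phi> \<in> borel_measurable borel"
    and le: "(\<integral>\<^sup>+ y. ennreal (\<bar>\<phi> y\<bar> powr p) \<partial>torus) \<le> 1" and x: "x \<in> cube"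
  shows "integrable torus (\<lambda>y. product_kernel x y * \<phi> y)"
    "\<bar>LINT y|torus. product_kernel x y * \<phi> y\<bar> \<le> 36 ^ CARD('d) * weight_const p CARD('d)"
    "\<bar>(LINT y|torus. product_kernel x y * \<phi> y) - (LINT y|torus. product_avg L x y * \<phi> y)\<bar>
      \<le> CARD('d) * 9000 ^ CARD('d) * mesh L powr smoothness p * weight_const p CARD('d)"
proof -
  note b = integral_weighted_bound[OF p phi le x]
  show i1: "integrable torus (\<lambda>y. product_kernel x y * \<phi> y)"
    by (rule b(1)[of _ "36 ^ CARD('d)"]) (auto intro!: AE_I2 product_kernel_bound[OF p])
  show "\<bar>LINT y|torus. product_kernel x y * \<phi> y\<bar> \<le> 36 ^ CARD('d) * weight_const p CARD('d)"
    by (rule b(2)[of _ "36 ^ CARD('d)"]) (auto intro!: AE_I2 product_kernel_bound[OF p])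
  let ?B = "CARD('d) * 9000 ^ CARD('d) * mesh L powr smoothness p"
  have "integrable torus (\<lambda>y. (product_kernel x y - product_avg L x y) * \<phi> y)"
    by (rule b(1)[of _ ?B]) (use product_kernel_avg_diff[OF p x] in auto)
  then have i2: "integrable torus (\<lambda>y. product_kernel x y * \<phi> y - (product_kernel x y - product_avg L x y) * \<phi> y)"
    using i1 by (intro Bochner_Integration.integrable_diff)
  then have i3: "integrable torus (\<lambda>y. product_avg L x y * \<phi> y)" by (simp add: algebra_simps)
  have "(LINT y|torus. product_kernel x y * \<phi> y) - (LINT y|torus. product_avg L x y * \<phi> y) =
    (LINT y|torus. (product_kernel x y - product_avg L x y) * \<phi> y)"
    using i1 i3 by (simp add: left_diff_distrib)
  moreover have "\<bar>LINT y|torus. (product_kernel x y - product_avg L x y) * \<phi> y\<bar> \<le> ?B * weight_const p CARD('d)"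
    by (rule b(2)[of _ ?B]) (use product_kernel_avg_diff[OF p x] in auto)
  ultimately show "\<bar>(LINT y|torus. product_kernel x y * \<phi> y) - (LINT y|torus. product_avg L x y * \<phi> y)\<bar>
      \<le> CARD('d) * 9000 ^ CARD('d) * mesh L powr smoothness p * weight_const p CARD('d)" by simp
qed

subsection \<open>Approximability of the low, middle and high frequencies\<close>

text \<open>One coordinate is determined by the others and the sum. This is where the exponent
  \<open>d - 1\<close> of the level sizes comes from.\<close>

lemma card_multi_index_sum:
  "finite {s :: 'd::finite \<Rightarrow> nat. (\<Sum>j\<in>UNIV. s j) = n}"
  "card {s :: 'd::finite \<Rightarrow> nat. (\<Sum>j\<in>UNIV. s j) = n} \<le> (n + 1) ^ (CARD('d) - 1)"
proof -
  \<comment> \<open>An arbitrary coordinate, the one to be reconstructed from the sum.\<close>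
  obtain i :: 'd where True by blast
  let ?S = "{s :: 'd \<Rightarrow> nat. (\<Sum>j\<in>UNIV. s j) = n}"
  let ?P = "PiE (UNIV - {i}) (\<lambda>_. {..n})"
  have le: "s j \<le> n" if "s \<in> ?S" for s j
    using that member_le_sum[of j UNIV s] by auto
  have sub: "(\<lambda>s. restrict s (UNIV - {i})) ` ?S \<subseteq> ?P" using le by (intro image_subsetI restrict_PiE_iff[THEN iffD2]) simp
  have inj: "inj_on (\<lambda>s. restrict s (UNIV - {i})) ?S"
  proof (rule inj_onI)
    fix s t assume st: "s \<in> ?S" "t \<in> ?S" and eq: "restrict s (UNIV - {i}) = restrict t (UNIV - {i})"
    have o: "s j = t j" if "j \<noteq> i" for j using fun_cong[OF eq, of j] that by simp
    have "(\<Sum>j\<in>UNIV. s j) = s i + (\<Sum>j\<in>UNIV - {i}. s j)" "(\<Sum>j\<in>UNIV. t j) = t i + (\<Sum>j\<in>UNIV - {i}. t j)"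
      by (simp_all add: sum.remove)
    moreover have "(\<Sum>j\<in>UNIV - {i}. s j) = (\<Sum>j\<in>UNIV - {i}. t j)" using o by (intro sum.cong) auto
    ultimately have "s i = t i" using st by simp
    then show "s = t" using o by (intro ext) metis
  qed
  have finP: "finite ?P" by (intro finite_PiE) auto
  show "finite ?S" using inj sub finP by (rule inj_on_finite)
  have "card ?S \<le> card ?P" using inj sub finP by (rule card_inj_on_le)
  also have "\<dots> = (n + 1) ^ (CARD('d) - 1)" by (simp add: card_PiE card_Diff_singleton)
  finally show "card ?S \<le> (n + 1) ^ (CARD('d) - 1)" .
qed

definition box_indices :: "nat \<Rightarrow> ('d::finite \<Rightarrow> nat) set" where
  "box_indices L = PiE UNIV (\<lambda>_. {..L})"

lemma box_indices_simps [simp]: "finite (box_indices L)" "s \<in> box_indices L \<Longrightarrow> s j \<le> L"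
proof -
  show "finite (box_indices L)" unfolding box_indices_def by (intro finite_PiE) auto
  show "s \<in> box_indices L \<Longrightarrow> s j \<le> L" by (auto simp: box_indices_def)
qed

lemma card_box_indices: "card (box_indices L :: ('d::finite \<Rightarrow> nat) set) = (L + 1) ^ CARD('d)"
  by (simp add: box_indices_def card_PiE)

lemma sum_over_levels_le:
  fixes h :: "nat \<Rightarrow> nat"
  assumes N: "finite N"
  shows "(\<Sum>s\<in>{s \<in> box_indices L. (\<Sum>j\<in>UNIV. s j) \<in> N}. h (\<Sum>j\<in>(UNIV :: 'd::finite set). s j))
    \<le> (\<Sum>n\<in>N. (n + 1) ^ (CARD('d) - 1) * h n)"
proof -
  let ?A = "{s :: 'd \<Rightarrow> nat. s \<in> box_indices L \<and> (\<Sum>j\<in>UNIV. s j) \<in> N}"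
  let ?g = "\<lambda>s :: 'd \<Rightarrow> nat. \<Sum>j\<in>UNIV. s j"
  have "(\<Sum>s\<in>?A. h (?g s)) = (\<Sum>n\<in>N. \<Sum>s\<in>{s \<in> ?A. ?g s = n}. h (?g s))"
    using N by (intro sum.group[symmetric]) auto
  also have "\<dots> \<le> (\<Sum>n\<in>N. (n + 1) ^ (CARD('d) - 1) * h n)"
  proof (rule sum_mono)
    fix n
    have "(\<Sum>s\<in>{s \<in> ?A. ?g s = n}. h (?g s)) = card {s \<in> ?A. ?g s = n} * h n" by simp
    also have "card {s \<in> ?A. ?g s = n} \<le> card {s :: 'd \<Rightarrow> nat. ?g s = n}"
      using card_multi_index_sum(1) by (intro card_mono) auto
    also have "\<dots> \<le> (n + 1) ^ (CARD('d) - 1)" by (rule card_multi_index_sum(2))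
    finally show "(\<Sum>s\<in>{s \<in> ?A. ?g s = n}. h (?g s)) \<le> (n + 1) ^ (CARD('d) - 1) * h n" by simp
  qed
  finally show ?thesis by simp
qed

text \<open>A real-valued, uniform version of the width estimate. The functions \<open>u\<close> are
  common to all \<open>f\<close> and enter only through their values on the grid, so no
  measurability has to be carried along.\<close>

definition approximable :: "nat \<Rightarrow> nat \<Rightarrow> real \<Rightarrow> (real ^ 'd \<Rightarrow> real) set \<Rightarrow> bool" where
  "approximable L n \<epsilon> F \<longleftrightarrow> (\<exists>u :: nat \<Rightarrow> real ^ 'd \<Rightarrow> real. \<forall>f\<in>F. \<exists>c.
     \<forall>x\<in>cube. \<bar>f x - (\<Sum>i<n. c i * u i (snap L x))\<bar> \<le> \<epsilon>)"

lemma approximable_perturb: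
  assumes "approximable L n \<epsilon> F" "\<And>f. f \<in> F' \<Longrightarrow> \<exists>g\<in>F. \<forall>x\<in>cube. \<bar>f x - g x\<bar> \<le> \<delta>"
  shows "approximable L n (\<delta> + \<epsilon>) F'"
proof -
  obtain u where u: "\<And>f. f \<in> F \<Longrightarrow> \<exists>c. \<forall>x\<in>cube. \<bar>f x - (\<Sum>i<n. c i * u i (snap L x))\<bar> \<le> \<epsilon>"
    using assms(1) unfolding approximable_def by blast
  have "\<exists>c. \<forall>x\<in>cube. \<bar>f x - (\<Sum>i<n. c i * u i (snap L x))\<bar> \<le> \<delta> + \<epsilon>" if f: "f \<in> F'" for f
  proof -
    obtain g where g: "g \<in> F" "\<forall>x\<in>cube. \<bar>f x - g x\<bar> \<le> \<delta>" using assms(2)[OF f] by blast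
    obtain c where c: "\<forall>x\<in>cube. \<bar>g x - (\<Sum>i<n. c i * u i (snap L x))\<bar> \<le> \<epsilon>" using u[OF g(1)] by blast
    have "\<bar>f x - (\<Sum>i<n. c i * u i (snap L x))\<bar> \<le> \<delta> + \<epsilon>" if "x \<in> cube" for x
      using g(2) c that by fastforce
    then show ?thesis by blast
  qed
  then show ?thesis unfolding approximable_def by blast
qed

lemma approximable_add:
  assumes "approximable L n1 \<epsilon>1 F1" "approximable L n2 \<epsilon>2 F2"
    and "\<And>f. f \<in> F \<Longrightarrow> \<exists>f1\<in>F1. \<exists>f2\<in>F2. \<forall>x\<in>cube. f x = f1 x + f2 x"
  shows "approximable L (n1 + n2) (\<epsilon>1 + \<epsilon>2) F"
proof -
  obtain u1 where u1: "\<And>f. f \<in> F1 \<Longrightarrow> \<exists>c. \<forall>x\<in>cube. \<bar>f x - (\<Sum>i<n1. c i * u1 i (snap L x))\<bar> \<le> \<epsilon>1"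
    using assms(1) unfolding approximable_def by blast
  obtain u2 where u2: "\<And>f. f \<in> F2 \<Longrightarrow> \<exists>c. \<forall>x\<in>cube. \<bar>f x - (\<Sum>i<n2. c i * u2 i (snap L x))\<bar> \<le> \<epsilon>2"
    using assms(2) unfolding approximable_def by blast
  define u where "u = (\<lambda>i. if i < n1 then u1 i else u2 (i - n1))"
  have "\<exists>c. \<forall>x\<in>cube. \<bar>f x - (\<Sum>i<n1 + n2. c i * u i (snap L x))\<bar> \<le> \<epsilon>1 + \<epsilon>2" if f: "f \<in> F" for f
  proof -
    obtain f1 f2 where f12: "f1 \<in> F1" "f2 \<in> F2" "\<forall>x\<in>cube. f x = f1 x + f2 x" using assms(3)[OF f] by blast
    obtain c1 where c1: "\<forall>x\<in>cube. \<bar>f1 x - (\<Sum>i<n1. c1 i * u1 i (snap L x))\<bar> \<le> \<epsilon>1" using u1[OF f12(1)] by blast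
    obtain c2 where c2: "\<forall>x\<in>cube. \<bar>f2 x - (\<Sum>i<n2. c2 i * u2 i (snap L x))\<bar> \<le> \<epsilon>2" using u2[OF f12(2)] by blast
    define c where "c = (\<lambda>i. if i < n1 then c1 i else c2 (i - n1))"
    have split: "(\<Sum>i<n1 + n2. g i) = (\<Sum>i<n1. g i) + (\<Sum>i<n2. g (n1 + i))" for g :: "nat \<Rightarrow> real"
      by (induction n2) (simp_all add: add.assoc)
    have "(\<Sum>i<n1 + n2. c i * u i z) = (\<Sum>i<n1. c1 i * u1 i z) + (\<Sum>i<n2. c2 i * u2 i z)" for z
      unfolding split by (simp add: c_def u_def)
    then have "\<bar>f x - (\<Sum>i<n1 + n2. c i * u i (snap L x))\<bar> \<le> \<epsilon>1 + \<epsilon>2" if "x \<in> cube" for x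
      using f12(3) c1 c2 that by (fastforce simp: abs_le_iff)
    then show ?thesis by blast
  qed
  then show ?thesis unfolding approximable_def by blast
qed

lemma approximable_zero:
  assumes "\<And>f x. f \<in> F \<Longrightarrow> x \<in> cube \<Longrightarrow> \<bar>f x\<bar> \<le> \<epsilon>"
  shows "approximable L 0 \<epsilon> F"
  unfolding approximable_def using assms by auto

lemma approximable_zero_n:
  assumes "\<epsilon> \<ge> 0"
  shows "approximable L n \<epsilon> {\<lambda>_. 0}"
  unfolding approximable_def using assms by (intro exI[of _ "\<lambda>_ _. 0"]) auto

lemma approximable_mono:
  assumes F: "approximable L n \<epsilon> F" and n: "n \<le> n'" and e: "\<epsilon> \<le> \<epsilon>'"
  shows "approximable L n' \<epsilon>' F"
proof -
  have "approximable L (n + (n' - n)) (\<epsilon> + (\<epsilon>' - \<epsilon>)) F"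
    by (rule approximable_add[OF F approximable_zero_n]) (use e in auto)
  then show ?thesis using n by simp
qed

lemma approximable_span:
  assumes I: "finite I"
    and span: "\<And>f. f \<in> F \<Longrightarrow> \<exists>c. \<forall>x\<in>cube. f x = (\<Sum>i\<in>I. c i * U i (snap L x))"
  shows "approximable L (card I) 0 F"
proof -
  obtain g where g: "bij_betw g {..<card I} I"
    using ex_bij_betw_nat_finite[OF I] by (auto simp: atLeast0LessThan)
  have "\<exists>c. \<forall>x\<in>cube. \<bar>f x - (\<Sum>i<card I. c i * U (g i) (snap L x))\<bar> \<le> 0" if "f \<in> F" for f
  proof -
    obtain c where c: "\<forall>x\<in>cube. f x = (\<Sum>i\<in>I. c i * U i (snap L x))"
      using span[OF \<open>f \<in> F\<close>] by (elim exE)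
    have "(\<Sum>i\<in>I. c i * U i z) = (\<Sum>i<card I. c (g i) * U (g i) z)" for z
      by (rule sum.reindex_bij_betw[OF g, symmetric])
    then show ?thesis using c by (intro exI[of _ "c \<circ> g"]) simp
  qed
  then show ?thesis unfolding approximable_def by (intro exI[of _ "\<lambda>i. U (g i)"]) blast
qed

definition unit_ball :: "real \<Rightarrow> (real ^ 'd \<Rightarrow> real) set" where
  "unit_ball p = {\<phi>. \<phi> \<in> borel_measurable borel \<and> (\<integral>\<^sup>+ y. ennreal (\<bar>\<phi> y\<bar> powr p) \<partial>torus) \<le> 1}"

definition block_op :: "('d \<Rightarrow> nat) set \<Rightarrow> (real ^ 'd \<Rightarrow> real) \<Rightarrow> real ^ 'd \<Rightarrow> real" where
  "block_op A \<phi> x = (LINT y|torus. block_kernel A x y * \<phi> y)"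

text \<open>The pointwise bound of a square by 1 plus the power \<open>p\<close> takes the place of
  Jensen's inequality; hence the radius \<open>sqrt 2\<close>.\<close>

lemma nn_integral_square_unit_ball:
  fixes \<phi> :: "real ^ 'd \<Rightarrow> real"
  assumes p: "p > 2" and phi: "\<phi> \<in> unit_ball p"
  shows "(\<integral>\<^sup>+ y. ennreal ((\<phi> y)\<^sup>2) \<partial>torus) \<le> ennreal ((sqrt 2)\<^sup>2)"
proof -
  have [measurable]: "\<phi> \<in> borel_measurable borel" using phi by (simp add: unit_ball_def)
  have "(\<integral>\<^sup>+ y. ennreal ((\<phi> y)\<^sup>2) \<partial>torus) \<le> (\<integral>\<^sup>+ y. 1 + ennreal (\<bar>\<phi> y\<bar> powr p) \<partial>torus)"
  proof (rule nn_integral_mono)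
    fix y
    have "(\<phi> y)\<^sup>2 \<le> 1 + \<bar>\<phi> y\<bar> powr p"
    proof (cases "\<bar>\<phi> y\<bar> \<le> 1")
      case True
      then have "(\<phi> y)\<^sup>2 \<le> 1" by (simp add: abs_square_le_1)
      then show ?thesis by (simp add: add_increasing2)
    next
      case False
      then have "\<bar>\<phi> y\<bar> powr 2 \<le> \<bar>\<phi> y\<bar> powr p" using p by (intro powr_mono) auto
      then show ?thesis using False by simp
    qed
    then show "ennreal ((\<phi> y)\<^sup>2) \<le> 1 + ennreal (\<bar>\<phi> y\<bar> powr p)"
      by (simp add: ennreal_leI flip: ennreal_plus ennreal_1)
  qed
  also have "\<dots> = (\<integral>\<^sup>+ y. 1 \<partial>(torus :: (real ^ 'd) measure)) + (\<integral>\<^sup>+ y. ennreal (\<bar>\<phi> y\<bar> powr p) \<partial>torus)"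
    by (rule nn_integral_add) auto
  also have "\<dots> \<le> 1 + 1"
    using phi prob_space.emeasure_space_1[OF prob_space_torus[where 'd = 'd]]
    by (intro add_mono) (auto simp: unit_ball_def)
  finally show ?thesis by simp
qed

lemma block_kernel_square_integrable:
  fixes x :: "real ^ 'd"
  assumes A: "A \<subseteq> box_indices L" and x: "x \<in> cube"
  shows "integrable torus (\<lambda>y. (block_kernel A x y)\<^sup>2)"
proof -
  have "(\<integral>\<^sup>+ y. ennreal ((block_kernel A x y)\<^sup>2) \<partial>torus) \<le> ennreal (card A * block_const CARD('d))"
    by (rule nn_integral_block_kernel_square[OF x, where L = L]) (use A in auto)
  then show ?thesis by (rule integrable_square_of_nn_integral(1)[rotated]) (auto simp: block_const_def)
qed

lemma block_op_integrable:
  fixes x :: "real ^ 'd"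
  assumes "A \<subseteq> box_indices L" "x \<in> cube"
    and "\<phi> \<in> borel_measurable borel" "integrable torus (\<lambda>y. (\<phi> y)\<^sup>2)"
  shows "integrable torus (\<lambda>y. block_kernel A x y * \<phi> y)"
  using assms by (intro cauchy_schwarz_integral(1) block_kernel_square_integrable) auto

text \<open>No error arises: a detail with indices \<open>s\<close> is constant in \<open>x\<close>
  on each of \<open>2 ^ (\<Sum>j\<in>UNIV. s j)\<close> boxes, so the image lies in the span of
  their indicators.\<close>

lemma low_block_approximable:
  fixes A :: "('d::finite \<Rightarrow> nat) set"
  assumes p: "p > 2" and A: "A \<subseteq> box_indices L"
  shows "approximable L (\<Sum>s\<in>A. 2 ^ (\<Sum>j\<in>UNIV. s j)) 0 (block_op A ` unit_ball p)"
proof -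
  have fin: "finite A" using A by (rule finite_subset) simp
  define I where "I = (SIGMA s:A. PiE UNIV (\<lambda>j. {..<2 ^ s j :: nat}))"
  have finI: "finite I" unfolding I_def using fin by (intro finite_SigmaI finite_PiE) auto
  have card: "card I = (\<Sum>s\<in>A. 2 ^ (\<Sum>j\<in>UNIV. s j))"
    unfolding I_def using fin by (subst card_SigmaI) (auto intro!: finite_PiE simp: card_PiE power_sum)
  define corner where "corner = (\<lambda>(s :: 'd \<Rightarrow> nat) l. (\<chi> j. mesh (s j) * real (l j)) :: real ^ 'd)"
  \<comment> \<open>Indicator of the box with number \<open>l\<close> at scales \<open>s\<close>,
    recognized by its lower corner.\<close>
  define U where "U = (\<lambda>(s, l) (x :: real ^ 'd). if (\<chi> j. cell_left (s j) (x $ j)) = corner s l then 1 else 0 :: real)"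
  have "approximable L (card I) 0 (block_op A ` unit_ball p)"
  proof (rule approximable_span[OF finI, where U = U])
    fix f assume "f \<in> block_op A ` (unit_ball p :: (real ^ 'd \<Rightarrow> real) set)"
    then obtain \<phi> where phi: "\<phi> \<in> unit_ball p" "f = block_op A \<phi>" by auto
    have m: "\<phi> \<in> borel_measurable borel" using phi by (simp add: unit_ball_def)
    have sq: "integrable torus (\<lambda>y. (\<phi> y)\<^sup>2)"
      by (rule integrable_square_of_nn_integral(1)[OF _ nn_integral_square_unit_ball[OF p phi(1)]]) (use m in auto)
    define c where "c = (\<lambda>(s, l). LINT y|torus. box_detail s (corner s l) y * \<phi> y)"
    have "f x = (\<Sum>i\<in>I. c i * U i (snap L x))" if x: "x \<in> cube" for x
    proof -
      have single: "(LINT y|torus. box_detail s x y * \<phi> y) = (\<Sum>l\<in>PiE UNIV (\<lambda>j. {..<2 ^ s j}). c (s, l) * U (s, l) (snap L x))"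
        if s: "s \<in> A" for s
      proof -
        define l0 where "l0 = (\<lambda>j. nat \<lfloor>x $ j / mesh (s j)\<rfloor>)"
        have l0: "l0 j < 2 ^ s j" "cell_left (s j) (x $ j) = mesh (s j) * real (l0 j)" for j
        proof -
          have xj: "0 \<le> x $ j" "x $ j < 2 * pi" using x by (auto simp: cube_def)
          then have nn: "0 \<le> \<lfloor>x $ j / mesh (s j)\<rfloor>" by simp
          have "\<lfloor>x $ j / mesh (s j)\<rfloor> < 2 ^ s j" using xj by (intro floor_mesh_less)
          then show "l0 j < 2 ^ s j" using nn by (simp add: l0_def nat_less_iff)
          show "cell_left (s j) (x $ j) = mesh (s j) * real (l0 j)" using nn by (simp add: cell_left_def l0_def)
        qed
        have l0P: "l0 \<in> PiE UNIV (\<lambda>j. {..<2 ^ s j})" using l0 by auto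
        have snp: "cell_left (s j) (snap L x $ j) = cell_left (s j) (x $ j)" for j
          using A s by (subst snap_def) (auto simp: subset_iff intro!: cell_left_cell_left)
        have Ueq: "U (s, l) (snap L x) = (if l = l0 then 1 else 0)" for l
          by (auto simp: U_def snp l0 corner_def vec_eq_iff fun_eq_iff)
        have "(\<Sum>l\<in>PiE UNIV (\<lambda>j. {..<2 ^ s j}). c (s, l) * U (s, l) (snap L x)) = c (s, l0)"
          unfolding Ueq using l0P by (simp add: finite_PiE if_distrib cong: if_cong)
        moreover have "box_detail s (corner s l0) y = box_detail s x y" for y
          unfolding box_detail_def corner_def vec_lambda_beta l0(2)[symmetric] by (simp add: detail_cell_left)
        ultimately show ?thesis by (simp add: c_def)
      qed
      have "f x = (\<Sum>s\<in>A. LINT y|torus. box_detail s x y * \<phi> y)"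
        unfolding phi(2) block_op_def block_kernel_def sum_distrib_right
      proof (rule Bochner_Integration.integral_sum)
        fix s assume s: "s \<in> A"
        have "integrable torus (\<lambda>y. block_kernel {s} x y * \<phi> y)"
          by (rule block_op_integrable[OF _ x m sq]) (use A s in auto)
        then show "integrable torus (\<lambda>y. box_detail s x y * \<phi> y)" by (simp add: block_kernel_def)
      qed
      also have "\<dots> = (\<Sum>s\<in>A. \<Sum>l\<in>PiE UNIV (\<lambda>j. {..<2 ^ s j}). c (s, l) * U (s, l) (snap L x))"
        by (intro sum.cong refl single)
      also have "\<dots> = (\<Sum>i\<in>I. c i * U i (snap L x))"
        unfolding I_def using fin by (subst sum.Sigma) (auto intro!: finite_PiE)
      finally show ?thesis .
    qed
    then show "\<exists>c. \<forall>x\<in>cube. f x = (\<Sum>i\<in>I. c i * U i (snap L x))" by blast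
  qed
  then show ?thesis unfolding card .
qed

lemma block_approximable_L2:
  fixes A :: "('d::finite \<Rightarrow> nat) set"
  assumes A: "A \<subseteq> box_indices L" and m: "m > 0" and D: "D > 0" "card A * block_const CARD('d) \<le> D"
    and R: "R \<ge> 0"
    and F: "\<And>\<phi>. \<phi> \<in> F \<Longrightarrow> \<phi> \<in> borel_measurable borel \<and> (\<integral>\<^sup>+ y. ennreal ((\<phi> y)\<^sup>2) \<partial>torus) \<le> ennreal (R\<^sup>2)"
  shows "approximable L m (70 * R * sqrt (D * ln (2 * 2 ^ (L * CARD('d))) / m)) (block_op A ` F)"
proof -
  obtain u where "\<And>\<phi> R. \<phi> \<in> borel_measurable borel \<Longrightarrow> R \<ge> 0 \<Longrightarrow>
    (\<integral>\<^sup>+ y. ennreal ((\<phi> y)\<^sup>2) \<partial>torus) \<le> ennreal (R\<^sup>2) \<Longrightarrow>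
    (\<exists>w. \<forall>x\<in>cube. \<bar>block_op A \<phi> x - (\<Sum>i<m. w i * u i (snap L x))\<bar>
      \<le> 70 * R * sqrt (D * ln (2 * 2 ^ (L * CARD('d))) / m))"
  proof -
    have "\<exists>u :: nat \<Rightarrow> real ^ 'd \<Rightarrow> real. \<forall>\<phi> R. \<phi> \<in> borel_measurable borel \<longrightarrow> R \<ge> 0 \<longrightarrow>
      (\<integral>\<^sup>+ y. ennreal ((\<phi> y)\<^sup>2) \<partial>torus) \<le> ennreal (R\<^sup>2) \<longrightarrow>
      (\<exists>w. \<forall>x\<in>cube. \<bar>(LINT y|torus. block_kernel A x y * \<phi> y) - (\<Sum>i<m. w i * u i (snap L x))\<bar>
        \<le> 70 * R * sqrt (D * ln (2 * 2 ^ (L * CARD('d))) / m))"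
      by (rule block_width) (use A m D in auto)
    then show ?thesis using that unfolding block_op_def by blast
  qed
  then show ?thesis unfolding approximable_def using F R by (intro exI[of _ u]) blast
qed

text \<open>The part of the density below \<open>t\<close> is treated as a perturbation and uses no
  approximating functions. Above \<open>t\<close> the inequality
  \<open>u^2 \<le> t powr (2 - p) * u powr p\<close> makes the \<open>L_2\<close> radius at most
  \<open>t powr (1 - p / 2)\<close>, a gain that grows with \<open>t\<close> precisely because
  \<open>p > 2\<close>.\<close>

lemma high_block_approximable:
  fixes A :: "('d::finite \<Rightarrow> nat) set"
  assumes p: "p > 2" and A: "A \<subseteq> box_indices L"
    and n: "\<And>s. s \<in> A \<Longrightarrow> n \<le> (\<Sum>j\<in>UNIV. s j)"
    and m: "m > 0" and D: "D > 0" "card A * block_const CARD('d) \<le> D" and t: "t > 0"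
  shows "approximable L m (t * (card A * ((10 ^ 6) ^ CARD('d) * 2 powr (- real n / 2))) +
     70 * t powr (1 - p / 2) * sqrt (D * ln (2 * 2 ^ (L * CARD('d))) / m)) (block_op A ` unit_ball p)"
proof -
  have finA: "finite A" using A by (rule finite_subset) simp
  define lo where "lo = (\<lambda>\<phi> (y :: real ^ 'd). if \<bar>\<phi> y\<bar> \<le> t then \<phi> y else 0 :: real)"
  define hi where "hi = (\<lambda>\<phi> (y :: real ^ 'd). if \<bar>\<phi> y\<bar> \<le> t then 0 else \<phi> y :: real)"
  let ?B = "card A * ((10 ^ 6) ^ CARD('d) * 2 powr (- real n / 2))"
  have meas: "\<phi> \<in> borel_measurable borel" if "\<phi> \<in> unit_ball p" for \<phi> :: "real ^ 'd \<Rightarrow> real"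
    using that by (simp add: unit_ball_def)
  have lo_meas: "lo \<phi> \<in> borel_measurable borel" and hi_meas: "hi \<phi> \<in> borel_measurable borel" if "\<phi> \<in> unit_ball p" for \<phi>
    unfolding lo_def hi_def using meas[OF that] by measurable
  have hi_L2: "(\<integral>\<^sup>+ y. ennreal ((hi \<phi> y)\<^sup>2) \<partial>torus) \<le> ennreal ((t powr (1 - p / 2))\<^sup>2)" if phi: "\<phi> \<in> unit_ball p" for \<phi>
  proof -
    note [measurable] = meas[OF phi]
    have "(\<integral>\<^sup>+ y. ennreal ((hi \<phi> y)\<^sup>2) \<partial>torus) \<le> (\<integral>\<^sup>+ y. ennreal (t powr (2 - p)) * ennreal (\<bar>\<phi> y\<bar> powr p) \<partial>torus)"
    proof (rule nn_integral_mono)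
      fix y
      have "(hi \<phi> y)\<^sup>2 \<le> t powr (2 - p) * \<bar>\<phi> y\<bar> powr p"
      proof (cases "\<bar>\<phi> y\<bar> \<le> t")
        case False
        then have pos: "\<bar>\<phi> y\<bar> > 0" using t by linarith
        have "(hi \<phi> y)\<^sup>2 = \<bar>\<phi> y\<bar> powr 2" using False pos by (simp add: hi_def)
        also have "\<dots> = \<bar>\<phi> y\<bar> powr (2 - p) * \<bar>\<phi> y\<bar> powr p" by (simp flip: powr_add)
        also have "\<dots> \<le> t powr (2 - p) * \<bar>\<phi> y\<bar> powr p"
          using False t p by (intro mult_right_mono powr_mono2') auto
        finally show ?thesis .
      qed (simp add: hi_def)
      then show "ennreal ((hi \<phi> y)\<^sup>2) \<le> ennreal (t powr (2 - p)) * ennreal (\<bar>\<phi> y\<bar> powr p)"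
        by (subst ennreal_mult[symmetric]) (auto intro: ennreal_leI)
    qed
    also have "\<dots> = ennreal (t powr (2 - p)) * (\<integral>\<^sup>+ y. ennreal (\<bar>\<phi> y\<bar> powr p) \<partial>torus)"
      by (rule nn_integral_cmult) auto
    also have "\<dots> \<le> ennreal (t powr (2 - p)) * 1"
      using phi by (intro mult_left_mono) (auto simp: unit_ball_def)
    also have "t powr (2 - p) = (t powr (1 - p / 2))\<^sup>2"
      by (simp add: power2_eq_square flip: powr_add)
    finally show ?thesis by simp
  qed
  have "approximable L m (70 * t powr (1 - p / 2) * sqrt (D * ln (2 * 2 ^ (L * CARD('d))) / m)) (block_op A ` (hi ` unit_ball p))"
    by (rule block_approximable_L2[OF A m D]) (use hi_L2 hi_meas in auto)
  then show ?thesis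
  proof (rule approximable_perturb)
    fix f assume "f \<in> block_op A ` (unit_ball p :: (real ^ 'd \<Rightarrow> real) set)"
    then obtain \<phi> where phi: "\<phi> \<in> unit_ball p" "f = block_op A \<phi>" by auto
    have "\<bar>block_op A \<phi> x - block_op A (hi \<phi>) x\<bar> \<le> t * ?B" if x: "x \<in> cube" for x
    proof -
      note [measurable] = lo_meas[OF phi(1)] hi_meas[OF phi(1)]
      have "integrable torus (\<lambda>y. (\<phi> y)\<^sup>2)" "integrable torus (\<lambda>y. (hi \<phi> y)\<^sup>2)"
        by (rule integrable_square_of_nn_integral(1)[OF _ nn_integral_square_unit_ball[OF p phi(1)]], use meas[OF phi(1)] in auto)
          (rule integrable_square_of_nn_integral(1)[OF _ hi_L2[OF phi(1)]], auto)
      then have i: "integrable torus (\<lambda>y. block_kernel A x y * \<phi> y)" "integrable torus (\<lambda>y. block_kernel A x y * hi \<phi> y)"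
        using meas[OF phi(1)] A x by (auto intro!: block_op_integrable)
      have "block_op A \<phi> x - block_op A (hi \<phi>) x = (LINT y|torus. block_kernel A x y * \<phi> y - block_kernel A x y * hi \<phi> y)"
        using i by (simp add: block_op_def)
      also have "\<dots> = (LINT y|torus. block_kernel A x y * lo \<phi> y)"
        by (rule Bochner_Integration.integral_cong) (auto simp: lo_def hi_def)
      finally have eq: "block_op A \<phi> x - block_op A (hi \<phi>) x = (LINT y|torus. block_kernel A x y * lo \<phi> y)" .
      have int: "integrable torus (\<lambda>y. block_kernel A x y * lo \<phi> y)"
      proof -
        have "integrable torus (\<lambda>y. block_kernel A x y * \<phi> y - block_kernel A x y * hi \<phi> y)"
          using i by (rule Bochner_Integration.integrable_diff)
        also have "(\<lambda>y. block_kernel A x y * \<phi> y - block_kernel A x y * hi \<phi> y) = (\<lambda>y. block_kernel A x y * lo \<phi> y)"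
          by (auto simp: lo_def hi_def)
        finally show ?thesis .
      qed
      have "ennreal \<bar>LINT y|torus. block_kernel A x y * lo \<phi> y\<bar> \<le> (\<integral>\<^sup>+ y. ennreal \<bar>block_kernel A x y * lo \<phi> y\<bar> \<partial>torus)"
        using integral_norm_bound_ennreal[OF int] by simp
      also have "\<dots> \<le> (\<integral>\<^sup>+ y. ennreal t * ennreal \<bar>block_kernel A x y\<bar> \<partial>torus)"
      proof (rule nn_integral_mono)
        fix y
        have "\<bar>block_kernel A x y * lo \<phi> y\<bar> \<le> \<bar>block_kernel A x y\<bar> * t"
          unfolding abs_mult using t by (intro mult_left_mono) (auto simp: lo_def)
        then show "ennreal \<bar>block_kernel A x y * lo \<phi> y\<bar> \<le> ennreal t * ennreal \<bar>block_kernel A x y\<bar>"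
          using t by (subst ennreal_mult[symmetric]) (auto intro: ennreal_leI simp: mult.commute)
      qed
      also have "\<dots> = ennreal t * (\<integral>\<^sup>+ y. ennreal \<bar>block_kernel A x y\<bar> \<partial>torus)" by (rule nn_integral_cmult) auto
      also have "\<dots> \<le> ennreal t * ennreal ?B"
        by (intro mult_left_mono nn_integral_block_kernel x finA n) auto
      also have "\<dots> = ennreal (t * ?B)" using t by (intro ennreal_mult[symmetric]) auto
      finally show ?thesis unfolding eq using t by (subst (asm) ennreal_le_iff) auto
    qed
    then show "\<exists>g\<in>block_op A ` hi ` unit_ball p. \<forall>x\<in>cube. \<bar>f x - g x\<bar> \<le> t * ?B"
      using phi by blast
  qed
qed

section \<open>Assembling the three ranges\<close>

definition conv_op :: "(real ^ 'd \<Rightarrow> real) \<Rightarrow> real ^ 'd \<Rightarrow> real" where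
  "conv_op \<phi> x = (LINT y|torus. product_kernel x y * \<phi> y)"

lemma block_kernel_union:
  assumes "finite A" "finite B" "A \<inter> B = {}"
  shows "block_kernel (A \<union> B) x y = block_kernel A x y + block_kernel B x y"
  unfolding block_kernel_def using assms by (rule sum.union_disjoint)

text \<open>In order: discretization error, the exactly reproduced low block (the literal 0), the
  middle block, and for the high block the bounded part and the large part of the density.\<close>

definition width_error :: "real \<Rightarrow> nat \<Rightarrow> nat \<Rightarrow> nat \<Rightarrow> nat \<Rightarrow> nat \<Rightarrow> real \<Rightarrow> real" where
  "width_error p d n0 J L m t = (let \<Lambda> = ln (2 * 2 ^ (L * d)) in
      real d * 9000 ^ d * mesh L powr smoothness p * weight_const p d +
      (0 + (70 * sqrt 2 * sqrt (J * (n0 + J + 1) ^ (d - 1) * block_const d * \<Lambda> / m) +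
      (t * ((L + 1) ^ d * ((10 ^ 6) ^ d * 2 powr (- real (n0 + J) / 2))) +
        70 * t powr (1 - p / 2) * sqrt ((L + 1) ^ d * block_const d * \<Lambda> / m)))))"

text \<open>The product of one-dimensional averages is the block of all indices in the box and
  splits by the size of \<open>|s|\<close>. The low block takes the first summand of the dimension,
  the other two take \<open>m1\<close> functions each; replacing the kernel by its averages is one
  more perturbation.\<close>

lemma conv_op_approximable:
  fixes n0 J L m1 :: nat
  assumes p: "p > 2" and J: "J \<ge> 1" and m1: "m1 > 0" and t: "t > 0"
  defines "d \<equiv> CARD('d::finite)"
  shows "approximable L ((n0 + 1) ^ (d - 1) * 2 ^ (n0 + 1) + (m1 + m1))
    (width_error p d n0 J L m1 t)
    (conv_op ` (unit_ball p :: (real ^ 'd \<Rightarrow> real) set))"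
proof -
  define \<Lambda> where "\<Lambda> = (ln (2 * 2 ^ (L * d)) :: real)"
  let ?U = "unit_ball p :: (real ^ 'd \<Rightarrow> real) set"
  let ?g = "\<lambda>s :: 'd \<Rightarrow> nat. \<Sum>j\<in>UNIV. s j"
  define A1 where "A1 = {s \<in> box_indices L. ?g s \<in> {..n0}}"
  define A2 where "A2 = {s \<in> box_indices L. ?g s \<in> {n0<..n0 + J}}"
  define A3 where "A3 = {s \<in> box_indices L. ?g s > n0 + J}"
  have sub: "A1 \<subseteq> box_indices L" "A2 \<subseteq> box_indices L" "A3 \<subseteq> box_indices L"
    by (auto simp: A1_def A2_def A3_def)
  have fin: "finite A1" "finite A2" "finite A3" using sub by (auto intro: finite_subset)
  have bc: "block_const d > 0" by (simp add: block_const_def)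
  have "\<Lambda> \<ge> 0" by (simp add: \<Lambda>_def ln_mult)
  have "(\<Sum>s\<in>A1. 2 ^ ?g s) \<le> (\<Sum>n\<in>{..n0}. (n + 1) ^ (d - 1) * 2 ^ n)"
    unfolding A1_def d_def by (rule sum_over_levels_le) simp
  also have "\<dots> \<le> (\<Sum>n\<in>{..n0}. (n0 + 1) ^ (d - 1) * 2 ^ n)"
    by (intro sum_mono mult_right_mono power_mono) auto
  also have "\<dots> = (n0 + 1) ^ (d - 1) * (\<Sum>n\<in>{..n0}. 2 ^ n)" by (simp only: sum_distrib_left)
  also have "(\<Sum>n\<in>{..n0}. 2 ^ n) = (2 ^ (n0 + 1) - 1 :: nat)" by (induction n0) auto
  finally have c1: "(\<Sum>s\<in>A1. 2 ^ ?g s) \<le> (n0 + 1) ^ (d - 1) * 2 ^ (n0 + 1)"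
    by (elim order_trans) (intro mult_left_mono, auto)
  have "card A2 = (\<Sum>s\<in>A2. 1)" by simp
  also have "\<dots> \<le> (\<Sum>n\<in>{n0<..n0 + J}. (n + 1) ^ (d - 1) * 1)"
    unfolding A2_def d_def by (rule sum_over_levels_le) simp
  also have "\<dots> \<le> (\<Sum>n\<in>{n0<..n0 + J}. (n0 + J + 1) ^ (d - 1))"
    by (intro sum_mono) (auto intro!: power_mono)
  also have "\<dots> = J * (n0 + J + 1) ^ (d - 1)" by simp
  finally have c2: "card A2 \<le> J * (n0 + J + 1) ^ (d - 1)" .
  have "card A3 \<le> card (box_indices L :: ('d \<Rightarrow> nat) set)" using sub by (intro card_mono) auto
  then have c3: "card A3 \<le> (L + 1) ^ d" by (simp add: card_box_indices d_def)
  have a1: "approximable L ((n0 + 1) ^ (d - 1) * 2 ^ (n0 + 1)) 0 (block_op A1 ` ?U)"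
    by (rule approximable_mono[OF low_block_approximable[OF p sub(1)] c1]) simp
  have a2: "approximable L m1 (70 * sqrt 2 * sqrt (J * (n0 + J + 1) ^ (d - 1) * block_const d * \<Lambda> / m1)) (block_op A2 ` ?U)"
    unfolding \<Lambda>_def d_def
  proof (rule block_approximable_L2[OF sub(2) m1])
    show "0 < real (J * (n0 + J + 1) ^ (CARD('d) - 1)) * block_const CARD('d)"
      using J bc by (intro mult_pos_pos) (auto simp: d_def)
    show "real (card A2) * block_const CARD('d) \<le> real (J * (n0 + J + 1) ^ (CARD('d) - 1)) * block_const CARD('d)"
      using c2 bc by (intro mult_right_mono) (auto simp only: d_def of_nat_le_iff less_imp_le)
    show "\<phi> \<in> borel_measurable borel \<and> (\<integral>\<^sup>+ y. ennreal ((\<phi> y)\<^sup>2) \<partial>torus) \<le> ennreal ((sqrt 2)\<^sup>2)" if "\<phi> \<in> ?U" for \<phi>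
      using that nn_integral_square_unit_ball[OF p that] by (simp add: unit_ball_def)
  qed auto
  have a3: "approximable L m1 (t * ((L + 1) ^ d * ((10 ^ 6) ^ d * 2 powr (- real (n0 + J) / 2))) +
        70 * t powr (1 - p / 2) * sqrt ((L + 1) ^ d * block_const d * \<Lambda> / m1)) (block_op A3 ` ?U)"
  proof (rule approximable_mono[OF _ order_refl])
    show "approximable L m1 (t * (card A3 * ((10 ^ 6) ^ CARD('d) * 2 powr (- real (n0 + J) / 2))) +
        70 * t powr (1 - p / 2) * sqrt (real ((L + 1) ^ d) * block_const d * ln (2 * 2 ^ (L * CARD('d))) / m1)) (block_op A3 ` ?U)"
    proof (rule high_block_approximable[OF p sub(3) _ m1 _ _ t])
      show "0 < real ((L + 1) ^ d) * block_const d" using bc by (intro mult_pos_pos) auto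
      show "real (card A3) * block_const CARD('d) \<le> real ((L + 1) ^ d) * block_const d"
        using c3 bc by (intro mult_mono) (auto simp only: d_def of_nat_le_iff less_imp_le of_nat_0_le_iff)
    qed (auto simp: A3_def)
    have "real (card A3) \<le> real ((L + 1) ^ d)" using c3 by (simp only: of_nat_le_iff)
    then show "t * (card A3 * ((10 ^ 6) ^ CARD('d) * 2 powr (- real (n0 + J) / 2))) +
        70 * t powr (1 - p / 2) * sqrt (real ((L + 1) ^ d) * block_const d * ln (2 * 2 ^ (L * CARD('d))) / m1)
      \<le> t * ((L + 1) ^ d * ((10 ^ 6) ^ d * 2 powr (- real (n0 + J) / 2))) +
        70 * t powr (1 - p / 2) * sqrt ((L + 1) ^ d * block_const d * \<Lambda> / m1)"
      unfolding \<Lambda>_def d_def using t by (intro add_mono mult_left_mono mult_right_mono) auto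
  qed
  have un: "A1 \<union> (A2 \<union> A3) = box_indices L" by (auto simp: A1_def A2_def A3_def)
  let ?F = "(\<lambda>\<phi> x. LINT y|torus. product_avg L x y * \<phi> y) ` ?U"
  have split: "\<exists>f1\<in>block_op A1 ` ?U. \<exists>f2\<in>{f. \<exists>\<phi>\<in>?U. \<forall>x\<in>cube. f x = block_op A2 \<phi> x + block_op A3 \<phi> x}.
      \<forall>x\<in>cube. f x = f1 x + f2 x" if f: "f \<in> ?F" for f
  proof -
    obtain \<phi> where phi: "\<phi> \<in> ?U" "f = (\<lambda>x. LINT y|torus. product_avg L x y * \<phi> y)" using f by auto
    have m: "\<phi> \<in> borel_measurable borel" using phi by (simp add: unit_ball_def)
    have sq: "integrable torus (\<lambda>y. (\<phi> y)\<^sup>2)"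
      by (rule integrable_square_of_nn_integral(1)[OF _ nn_integral_square_unit_ball[OF p phi(1)]]) (use m in auto)
    have "f x = block_op A1 \<phi> x + (block_op A2 \<phi> x + block_op A3 \<phi> x)" if x: "x \<in> cube" for x
    proof -
      have i: "integrable torus (\<lambda>y. block_kernel A x y * \<phi> y)" if "A \<subseteq> box_indices L" for A
        using that x m sq by (rule block_op_integrable)
      have "product_avg L x y * \<phi> y = block_kernel A1 x y * \<phi> y + (block_kernel A2 x y * \<phi> y + block_kernel A3 x y * \<phi> y)" for y
      proof -
        have "product_avg L x y = block_kernel (A1 \<union> (A2 \<union> A3)) x y" by (simp add: product_avg_eq_block un box_indices_def)
        also have "\<dots> = block_kernel A1 x y + (block_kernel A2 x y + block_kernel A3 x y)"
        proof -
          have "A1 \<inter> (A2 \<union> A3) = {}" "A2 \<inter> A3 = {}" by (auto simp: A1_def A2_def A3_def)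
          then show ?thesis using fin by (simp add: block_kernel_union)
        qed
        finally show ?thesis by (simp add: distrib_right)
      qed
      then show ?thesis using i[OF sub(1)] i[OF sub(2)] i[OF sub(3)] by (simp add: phi(2) block_op_def)
    qed
    then show ?thesis using phi(1)
      by (intro bexI[of _ "block_op A1 \<phi>"] bexI[of _ "\<lambda>x. block_op A2 \<phi> x + block_op A3 \<phi> x"]) auto
  qed
  have a23: "approximable L (m1 + m1) (70 * sqrt 2 * sqrt (J * (n0 + J + 1) ^ (d - 1) * block_const d * \<Lambda> / m1) +
      (t * ((L + 1) ^ d * ((10 ^ 6) ^ d * 2 powr (- real (n0 + J) / 2))) +
        70 * t powr (1 - p / 2) * sqrt ((L + 1) ^ d * block_const d * \<Lambda> / m1)))
      {f. \<exists>\<phi>\<in>?U. \<forall>x\<in>cube. f x = block_op A2 \<phi> x + block_op A3 \<phi> x}"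
    by (rule approximable_add[OF a2 a3]) blast
  have "approximable L ((n0 + 1) ^ (d - 1) * 2 ^ (n0 + 1) + (m1 + m1))
     (0 + (70 * sqrt 2 * sqrt (J * (n0 + J + 1) ^ (d - 1) * block_const d * \<Lambda> / m1) +
      (t * ((L + 1) ^ d * ((10 ^ 6) ^ d * 2 powr (- real (n0 + J) / 2))) +
        70 * t powr (1 - p / 2) * sqrt ((L + 1) ^ d * block_const d * \<Lambda> / m1)))) ?F"
    by (rule approximable_add[OF a1 a23 split])
  note all = this
  have pert: "\<exists>g\<in>?F. \<forall>x\<in>cube. \<bar>f x - g x\<bar> \<le> real d * 9000 ^ d * mesh L powr smoothness p * weight_const p d"
    if f: "f \<in> conv_op ` ?U" for f
  proof -
    obtain \<phi> where phi: "\<phi> \<in> ?U" "f = conv_op \<phi>" using f by auto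
    then show ?thesis
      unfolding d_def conv_op_def using convolution_remainder(3)[OF p, of \<phi>]
      by (intro bexI[of _ "\<lambda>x. LINT y|torus. product_avg L x y * \<phi> y"]) (auto simp: unit_ball_def)
  qed
  show ?thesis 
    using approximable_perturb[OF all pert] unfolding width_error_def Let_def \<Lambda>_def[symmetric]
    by (simp only: of_nat_mult of_nat_power of_nat_add of_nat_1)
qed

lemma conv_op_bound:
  fixes \<phi> :: "real ^ 'd \<Rightarrow> real"
  assumes "p > 2" "\<phi> \<in> unit_ball p" "x \<in> cube"
  shows "\<bar>conv_op \<phi> x\<bar> \<le> 36 ^ CARD('d) * weight_const p CARD('d)"
  unfolding conv_op_def using assms by (intro convolution_remainder(2)) (auto simp: unit_ball_def)

text \<open>A level at which the dimension condition holds for the last time before failing; such a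
  level exists since the condition holds at 0 and exponentials outgrow \<open>m\<close>. The
  exponent \<open>n + 2\<close> makes the low block use at most half of \<open>m\<close>.\<close>

lemma level_choice:
  fixes m d :: nat
  assumes "m \<ge> 4"
  obtains n where "(n + 1) ^ (d - 1) * 2 ^ (n + 2) \<le> m" "m < (n + 2) ^ (d - 1) * 2 ^ (n + 3)"
proof -
  let ?P = "\<lambda>n. (n + 1) ^ (d - 1) * 2 ^ (n + 2) \<le> m"
  have "\<exists>n. ?P n \<and> \<not> ?P (Suc n)"
  proof (rule ccontr)
    assume "\<not> ?thesis"
    then have step: "?P n \<Longrightarrow> ?P (Suc n)" for n by blast
    have "?P n" for n
    proof (induction n)
      case 0
      then show ?case using assms by simp
    qed (rule step)
    from this[of m] have "1 * 2 ^ m \<le> m"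
      by (rule order_trans[rotated]) (intro mult_mono power_increasing one_le_power, auto)
    then show False using less_exp[of m] by simp
  qed
  then show ?thesis using that by (auto simp: numeral_3_eq_3 not_le)
qed

definition width_rate :: "nat \<Rightarrow> nat \<Rightarrow> real" where
  "width_rate d m = real m powr (- 1 / 2) * ln (real m) powr (real d / 2) * ln (ln (real m)) powr (3 / 2)"

subsection \<open>Choice of the parameters\<close>

lemma width_rate_sqrt:
  assumes m: "m \<ge> 27" and N: "2 ^ (N + 1) \<le> m" and J: "real J \<le> c * log 2 (N + 1) + 1" and c: "c \<ge> 0"
  shows "sqrt (real J * (real N + real J) ^ d / m) \<le> sqrt ((3 * c + 1) * (3 * c + 3) ^ d) * width_rate d m"
proof -
  define l where "l = ln (real m)"
  have m0: "real m > 0" using m by simp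
  have "exp 1 \<le> (3::real)" using exp_le by simp
  then have "1 \<le> ln (3::real)" by (subst ln_ge_iff) auto
  moreover have "ln (27::real) = 3 * ln 3" using ln_realpow[of "3::real" 3] by simp
  moreover have "ln 27 \<le> l" unfolding l_def using m by simp
  \<comment> \<open>The threshold \<open>27 = 3^3\<close> serves to get \<open>l \<ge> 3\<close>,
    whence \<open>ln l \<ge> ln 3 \<ge> 1\<close>.\<close>
  ultimately have l3: "l \<ge> 3" by linarith
  have ll1: "ln l \<ge> 1"
  proof -
    have "ln 3 \<le> ln l" using l3 by simp
    then show ?thesis using \<open>1 \<le> ln 3\<close> by linarith
  qed
  have lll: "ln l \<le> l" using l3 ln_bound[of l] by simp
  have ln2: "ln (2::real) \<ge> 2 / 3" using ln2_ge_two_thirds .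
  have N1: "real N + 1 \<le> 3 / 2 * l"
  proof -
    have "(2::real) ^ (N + 1) \<le> real m" using N by (metis of_nat_le_iff of_nat_numeral of_nat_power)
    then have "ln ((2::real) ^ (N + 1)) \<le> l" unfolding l_def using m0 by (subst ln_le_cancel_iff) auto
    moreover have "ln ((2::real) ^ (N + 1)) = real (N + 1) * ln 2" by (rule ln_realpow)
    ultimately have "(real N + 1) * ln 2 \<le> l" by (simp add: add.commute)
    moreover have "(real N + 1) * (2 / 3) \<le> (real N + 1) * ln 2" using ln2 by (intro mult_left_mono) auto
    ultimately show ?thesis by simp
  qed
  have J1: "real J \<le> (3 * c + 1) * ln l"
  proof -
    have "ln (real N + 1) \<le> ln (3 / 2 * l)" using N1 l3 by (subst ln_le_cancel_iff) auto
    also have "\<dots> = ln (3 / 2) + ln l" using l3 by (intro ln_mult_pos) auto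
    also have "ln (3 / 2 :: real) \<le> 3 / 2 - 1" by (rule ln_le_minus_one) auto
    finally have "ln (real N + 1) \<le> 3 / 2 * ln l" using ll1 by linarith
    then have "ln (real N + 1) / ln 2 \<le> (3 / 2 * ln l) / (2 / 3)" using ln2 ll1 by (intro frac_le) auto
    also have "\<dots> \<le> 3 * ln l" using ll1 by simp
    finally have "log 2 (real N + 1) \<le> 3 * ln l" by (simp only: log_def)
    then have "c * log 2 (real N + 1) \<le> c * (3 * ln l)" using c by (intro mult_left_mono)
    then show ?thesis using J ll1 by (simp add: algebra_simps)
  qed
  have NJ: "real N + real J \<le> (3 * c + 3) * l"
  proof -
    have "(3 * c + 1) * ln l \<le> (3 * c + 1) * l" using lll c by (intro mult_left_mono) auto
    then show ?thesis using N1 J1 l3 by (simp add: algebra_simps)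
  qed
  have "real J * (real N + real J) ^ d / m \<le> ((3 * c + 1) * ln l) * ((3 * c + 3) * l) ^ d / m"
    using J1 NJ m0 ll1 c by (intro divide_right_mono mult_mono power_mono) auto
  also have "\<dots> = ((3 * c + 1) * (3 * c + 3) ^ d) * (ln l * l ^ d / m)" by (simp add: power_mult_distrib mult_ac)
  finally have "sqrt (real J * (real N + real J) ^ d / m) \<le> sqrt (((3 * c + 1) * (3 * c + 3) ^ d) * (ln l * l ^ d / m))"
    by (rule real_sqrt_le_mono)
  also have "\<dots> = sqrt ((3 * c + 1) * (3 * c + 3) ^ d) * sqrt (ln l * l ^ d / m)" by (rule real_sqrt_mult)
  also have "\<dots> \<le> sqrt ((3 * c + 1) * (3 * c + 3) ^ d) * width_rate d m"
  proof (rule mult_left_mono)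
    have "sqrt (ln l * l ^ d / m) = ln l powr (1 / 2) * (l powr real d) powr (1 / 2) * real m powr (- 1 / 2)"
      using l3 ll1 m0 by (simp add: powr_half_sqrt[symmetric] powr_mult powr_divide powr_realpow powr_minus_divide)
    also have "\<dots> = ln l powr (1 / 2) * (real m powr (- 1 / 2) * l powr (real d / 2))"
      by (simp add: powr_powr)
    \<comment> \<open>The estimate so far has the power 1/2 of \<open>ln l\<close>; raising it to
      3/2 only enlarges the bound because \<open>ln l \<ge> 1\<close>.\<close>
    also have "\<dots> \<le> ln l powr (3 / 2) * (real m powr (- 1 / 2) * l powr (real d / 2))"
      using ll1 by (intro mult_right_mono powr_mono) auto
    finally show "sqrt (ln l * l ^ d / m) \<le> width_rate d m" by (simp add: width_rate_def l_def mult_ac)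
  qed (use c in auto)
  finally show ?thesis .
qed

text \<open>Each of the four error terms is compared with one quantity \<open>Y\<close>, the size of
  the middle term, and \<open>Y\<close> is then converted into the rate.\<close>

lemma parameter_choice:
  fixes d :: nat and p :: real
  assumes d: "d \<ge> 1" and p: "p > 2"
  shows "\<exists>C>0. \<forall>m\<ge>27. \<exists>n0 J L m1 :: nat. \<exists>t. J \<ge> 1 \<and> m1 > 0 \<and> t > 0 \<and>
    (n0 + 1) ^ (d - 1) * 2 ^ (n0 + 1) + (m1 + m1) \<le> m \<and>
    width_error p d n0 J L m1 t
    \<le> C * width_rate d m"
proof -
  define \<beta> where "\<beta> = smoothness p"
  \<comment> \<open>Fineness of the grid: with \<open>L = a * N\<close> and
    \<open>\<beta> * a \<ge> 1/2\<close> the discretization error is \<open>O(2^(-N/2))\<close>,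
    while \<open>L\<close> stays linear in \<open>N\<close>.\<close>
  define a where "a = nat \<lceil>1 / (2 * \<beta>)\<rceil>"
  \<comment> \<open>\<open>4 * d\<close> lets \<open>2^(-J/4)\<close> beat \<open>(N + 1)^d\<close>;
    \<open>8 * d / (p - 2)\<close> lets the \<open>L_2\<close> smallness of the truncated density do
    the same.\<close>
  define c where "c = max (4 * real d) (8 * real d / (p - 2))"
  define bc where "bc = block_const d"
  define wc where "wc = weight_const p d"
  define B1 where "B1 = real d * 9000 ^ d * 7 * wc"
  define B2 where "B2 = 70 * sqrt 2 * sqrt (16 * a * d * bc)"
  define B3 where "B3 = (2 * real a) ^ d * (10 ^ 6) ^ d * 2"
  define B4 where "B4 = 70 * sqrt ((2 * real a) ^ d * bc * (16 * a * d))"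
  define C where "C = (2 * B1 + B2 + 2 * B3 + B4) * sqrt ((3 * c + 1) * (3 * c + 3) ^ d)"
  have beta: "\<beta> > 0" "\<beta> \<le> 1" using smoothness_bounds[OF p] by (auto simp: \<beta>_def)
  have a: "a \<ge> 1" "1 / 2 \<le> \<beta> * a"
  proof -
    have "1 / (2 * \<beta>) \<le> real a" unfolding a_def by (rule real_nat_ceiling_ge)
    then show "1 / 2 \<le> \<beta> * a" using beta by (simp add: field_simps)
    then show "a \<ge> 1" by (cases a) auto
  qed
  have c: "c \<ge> 4 * real d" "c \<ge> 8 * real d / (p - 2)" "c \<ge> 4"
    using d by (auto simp: c_def)
  have bc: "bc > 0" and wc: "wc \<ge> 1" using weight_const_ge_1[OF p] by (auto simp: bc_def block_const_def wc_def)
  have B: "B1 > 0" "B2 \<ge> 0" "B3 \<ge> 0" "B4 \<ge> 0"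
    using d bc wc a by (auto simp: B1_def B2_def B3_def B4_def)
  have "C > 0" unfolding C_def using B c by (intro mult_pos_pos) (auto intro!: add_pos_nonneg)
  moreover have "\<exists>n0 J L m1 :: nat. \<exists>t. J \<ge> 1 \<and> m1 > 0 \<and> t > 0 \<and>
    (n0 + 1) ^ (d - 1) * 2 ^ (n0 + 1) + (m1 + m1) \<le> m \<and>
    width_error p d n0 J L m1 t
    \<le> C * width_rate d m" if m: "m \<ge> 27" for m :: nat
  proof -
    obtain n0 where n0: "(n0 + 1) ^ (d - 1) * 2 ^ (n0 + 2) \<le> m" "m < (n0 + 2) ^ (d - 1) * 2 ^ (n0 + 3)"
      by (rule level_choice[of m d]) (use m in auto)
    define N where "N = n0 + 1"
    define L where "L = a * N"
    define J where "J = nat \<lceil>c * log 2 (N + 1)\<rceil>"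
    define t where "t = (2::real) powr (real J / 4)"
    \<comment> \<open>A quarter each for the middle and the high block; half is reserved for the low
      block.\<close>
    define m1 where "m1 = m div 4"
    define \<Lambda> where "\<Lambda> = ln (2 * 2 ^ (L * d) :: real)"
    define Y where "Y = sqrt (real J * (real N + real J) ^ d / m)"
    have N1: "N \<ge> 1" by (simp add: N_def)
    have m0: "real m > 0" using m by simp
    have log1: "log 2 (N + 1) \<ge> 1"
    proof -
      have "log 2 2 \<le> log 2 (real (N + 1))" using N1 by (subst log_le_cancel_iff) auto
      then show ?thesis by simp
    qed
    have clog: "c * log 2 (N + 1) \<ge> 1" using c log1 mult_mono[of 1 c 1 "log 2 (N + 1)"] by simp
    have Jge: "real J \<ge> c * log 2 (N + 1)" unfolding J_def by (rule real_nat_ceiling_ge)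
    have Jle: "real J \<le> c * log 2 (N + 1) + 1"
      unfolding J_def using clog by (simp add: of_nat_ceiling)
    have J1: "J \<ge> 1" using Jge clog by linarith
    have m1: "real m1 \<ge> m / 8" "m1 > 0"
    proof -
      have "m < 4 * (m1 + 1)" unfolding m1_def by simp
      then have "real m < real (4 * (m1 + 1))" by (simp only: of_nat_less_iff)
      then have "real m < 4 * (real m1 + 1)" by simp
      then show "real m1 \<ge> m / 8" using m by simp
      then show "m1 > 0" using m0 by (cases m1) auto
    qed
    have dim: "(n0 + 1) ^ (d - 1) * 2 ^ (n0 + 1) + (m1 + m1) \<le> m"
    proof -
      have "2 * ((n0 + 1) ^ (d - 1) * 2 ^ (n0 + 1)) \<le> m" using n0(1) by (simp add: mult_ac)
      moreover have "4 * m1 \<le> m" by (simp add: m1_def)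
      ultimately show ?thesis by linarith
    qed
    have twoN: "2 ^ (N + 1) \<le> m"
    proof -
      have "1 * 2 ^ (n0 + 2) \<le> (n0 + 1) ^ (d - 1) * 2 ^ (n0 + 2)" by (intro mult_right_mono one_le_power) auto
      then have "1 * 2 ^ (n0 + 2) \<le> m" using n0(1) by (rule order_trans)
      then show ?thesis unfolding N_def by simp
    qed
    have NJ1: "real N + real J \<ge> real N + 1" using J1 by simp
    have pow1: "(real N + J) ^ d \<ge> 1" using N1 by (intro one_le_power) auto
    have JNJ: "1 \<le> J * (real N + J) ^ d" using J1 pow1 mult_mono[of 1 "real J" 1 "(real N + J) ^ d"] by simp
    have Y0: "Y \<ge> 0" by (simp add: Y_def)
    have Yinv: "sqrt (1 / m) \<le> Y"
      unfolding Y_def using JNJ m0 by (intro real_sqrt_le_mono divide_right_mono) auto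
    \<comment> \<open>From the upper bound on \<open>m\<close> at the chosen level: \<open>m\<close>
      is at most about \<open>2^N\<close> times the size of one level, so \<open>2^(-N)\<close> is
      at most \<open>4 * Y^2\<close>.\<close>
    have G: "2 powr (- real N / 2) \<le> 2 * Y"
    proof -
      have "real m \<le> (real N + 1) ^ (d - 1) * 2 ^ (N + 2)"
      proof -
        have "real m \<le> real ((n0 + 2) ^ (d - 1) * 2 ^ (n0 + 3))" using n0(2) by (simp only: of_nat_le_iff less_imp_le)
        then show ?thesis by (simp add: N_def add_ac power_add)
      qed
      also have "\<dots> \<le> (J * (real N + J) ^ d) * 2 ^ (N + 2)"
      proof (rule mult_right_mono)
        have "(real N + 1) ^ (d - 1) \<le> (real N + J) ^ (d - 1)" using NJ1 by (intro power_mono) auto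
        also have "\<dots> \<le> (real N + J) ^ d" using N1 by (intro power_increasing) auto
        also have "\<dots> \<le> J * (real N + J) ^ d" using J1 pow1 by simp
        finally show "(real N + 1) ^ (d - 1) \<le> J * (real N + J) ^ d" .
      qed auto
      finally have "1 / 2 ^ N \<le> 4 * (J * (real N + J) ^ d / m)" using m0 by (simp add: field_simps)
      then have "sqrt (1 / 2 ^ N) \<le> sqrt (4 * (J * (real N + J) ^ d / m))" by (rule real_sqrt_le_mono)
      also have "\<dots> = 2 * Y" unfolding Y_def by (subst real_sqrt_mult) simp
      also have "sqrt (1 / 2 ^ N) = 2 powr (- real N / 2)"
        by (simp add: powr_half_sqrt[symmetric] powr_divide powr_realpow[symmetric] powr_powr powr_minus_divide)
      finally show ?thesis .
    qed
    have Lam: "0 \<le> \<Lambda>" "\<Lambda> \<le> 2 * real a * real d * real N"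
    proof -
      have eq: "\<Lambda> = ln 2 + real (L * d) * ln 2" unfolding \<Lambda>_def by (subst ln_mult_pos) (auto simp: ln_realpow)
      then show "0 \<le> \<Lambda>" by simp
      have l2: "ln (2::real) \<le> 1" using ln_le_minus_one[of "2::real"] by simp
      have "real (L * d) * ln 2 \<le> real (L * d) * 1" using l2 by (intro mult_left_mono) auto
      then have "\<Lambda> \<le> 1 + real (L * d)" using eq l2 by simp
      moreover have "1 \<le> a * N * d" using a N1 d by simp
      then have "real 1 \<le> real (L * d)" unfolding L_def by (rule of_nat_mono)
      then have "1 \<le> real (L * d)" by simp
      ultimately show "\<Lambda> \<le> 2 * real a * real d * real N" by (simp add: L_def mult_ac)
    qed
    have Lm: "\<Lambda> / m1 \<le> 16 * real a * real d * real N / m"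
    proof -
      have "\<Lambda> / m1 \<le> (2 * real a * real d * real N) / (m / 8)" using Lam m1 m0 by (intro frac_le) auto
      then show ?thesis by simp
    qed
    have Lp: "(real L + 1) ^ d \<le> (2 * real a) ^ d * (real N + 1) ^ d"
    proof -
      have "1 * 1 \<le> real a * real N" using a N1 by (intro mult_mono) auto
      then have "real L + 1 \<le> 2 * real a * (real N + 1)" by (simp add: L_def algebra_simps)
      then show ?thesis unfolding power_mult_distrib[symmetric] by (intro power_mono) auto
    qed
    have powN: "(real N + 1) ^ d = 2 powr (real d * log 2 (N + 1))"
    proof -
      have "(2::real) powr (real d * log 2 (real (N + 1))) = (2 powr log 2 (real (N + 1))) powr real d"
        by (simp only: powr_powr mult.commute)
      also have "2 powr log 2 (real (N + 1)) = real (N + 1)" by (rule powr_log_cancel) auto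
      also have "real (N + 1) powr real d = real (N + 1) ^ d" by (rule powr_realpow) simp
      finally show ?thesis by (simp add: add.commute)
    qed
    have T1: "real d * 9000 ^ d * mesh L powr smoothness p * weight_const p d \<le> 2 * B1 * Y"
    proof -
      have "mesh L powr \<beta> = (2 * pi) powr \<beta> * 2 powr (- (\<beta> * L))"
        by (simp add: mesh_def powr_divide powr_realpow[symmetric] powr_powr powr_minus_divide mult.commute)
      also have "\<dots> \<le> 7 * 2 powr (- real N / 2)"
      proof (intro mult_mono)
        have "(2 * pi) powr \<beta> \<le> (2 * pi) powr 1" using beta pi_gt3 by (intro powr_mono) auto
        also have "\<dots> \<le> 7" using pi_approx by simp
        finally show "(2 * pi) powr \<beta> \<le> 7" .
        have "1 / 2 * real N \<le> \<beta> * a * N" using a by (intro mult_right_mono) auto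
        then show "2 powr (- (\<beta> * L)) \<le> (2::real) powr (- real N / 2)"
          by (intro powr_mono) (auto simp: L_def mult.assoc)
      qed auto
      also have "\<dots> \<le> 7 * (2 * Y)" using G by simp
      finally have "real d * 9000 ^ d * (mesh L powr \<beta>) * wc \<le> real d * 9000 ^ d * (7 * (2 * Y)) * wc"
        using wc by (intro mult_right_mono mult_left_mono) auto
      then show ?thesis by (simp add: B1_def wc_def \<beta>_def mult_ac)
    qed
    have T2: "70 * sqrt 2 * sqrt (J * (n0 + J + 1) ^ (d - 1) * block_const d * \<Lambda> / m1) \<le> B2 * Y"
    proof -
      have "J * (n0 + J + 1) ^ (d - 1) * block_const d * \<Lambda> / m1 = (J * (real N + J) ^ (d - 1) * bc) * (\<Lambda> / m1)"
        by (simp add: N_def bc_def add_ac)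
      also have "\<dots> \<le> (J * (real N + J) ^ (d - 1) * bc) * (16 * real a * real d * (real N + J) / m)"
      proof (rule mult_left_mono)
        have "16 * real a * real d * real N / m \<le> 16 * real a * real d * (real N + J) / m"
          using m0 by (intro divide_right_mono mult_left_mono) auto
        then show "\<Lambda> / m1 \<le> 16 * real a * real d * (real N + J) / m" using Lm by simp
      qed (use bc in auto)
      also have "\<dots> = (16 * a * d * bc) * (J * ((real N + J) ^ (d - 1) * (real N + J)) / m)" by simp
      also have "(real N + J) ^ (d - 1) * (real N + J) = (real N + J) ^ d" using d by (simp add: power_eq_if mult.commute)
      finally have "sqrt (J * (n0 + J + 1) ^ (d - 1) * block_const d * \<Lambda> / m1) \<le> sqrt ((16 * a * d * bc) * (J * (real N + J) ^ d / m))"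
        by (rule real_sqrt_le_mono)
      also have "\<dots> = sqrt (16 * a * d * bc) * Y" unfolding Y_def by (rule real_sqrt_mult)
      finally show ?thesis unfolding B2_def by (simp add: mult.assoc)
    qed
    have T3: "t * ((L + 1) ^ d * ((10 ^ 6) ^ d * 2 powr (- real (n0 + J) / 2))) \<le> 2 * B3 * Y"
    proof -
      \<comment> \<open>The height \<open>t = 2^(J/4)\<close> uses up half of the decay
        \<open>2^(-J/2)\<close>, and the other half remains; the factor \<open>2 powr (1/2)\<close>
        comes from \<open>n0 = N - 1\<close>.\<close>
      have e: "t * 2 powr (- real (n0 + J) / 2) = 2 powr (1 / 2) * (2 powr (- real J / 4) * 2 powr (- real N / 2))"
      proof -
        have "real J / 4 + - real (n0 + J) / 2 = 1 / 2 + (- real J / 4 + - real N / 2)"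
          by (simp add: N_def field_simps)
        then show ?thesis unfolding t_def powr_add[symmetric] by (rule arg_cong)
      qed
      have s: "2 powr (1 / 2) \<le> (2::real)" using powr_mono[of "1 / 2" 1 "2::real"] by simp
      have k: "(real N + 1) ^ d * 2 powr (- real J / 4) \<le> 1"
      proof -
        have "4 * real d * log 2 (N + 1) \<le> c * log 2 (N + 1)" using c log1 by (intro mult_right_mono) auto
        then have "real d * log 2 (N + 1) + - real J / 4 \<le> 0" using Jge by simp
        then have "2 powr (real d * log 2 (N + 1) + - real J / 4) \<le> (2::real) powr 0" by (intro powr_mono) auto
        then show ?thesis unfolding powN powr_add by simp
      qed
      have "t * ((L + 1) ^ d * ((10 ^ 6) ^ d * 2 powr (- real (n0 + J) / 2))) =
        (real L + 1) ^ d * (10 ^ 6) ^ d * (t * 2 powr (- real (n0 + J) / 2))" by (simp add: mult_ac add_ac)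
      also have "\<dots> \<le> ((2 * real a) ^ d * (real N + 1) ^ d) * (10 ^ 6) ^ d * (2 * (2 powr (- real J / 4) * 2 powr (- real N / 2)))"
        unfolding e using Lp s by (intro mult_mono mult_right_mono) auto
      also have "\<dots> = B3 * (((real N + 1) ^ d * 2 powr (- real J / 4)) * 2 powr (- real N / 2))"
        by (simp add: B3_def mult_ac)
      also have "\<dots> \<le> B3 * (1 * (2 * Y))"
        using k G B by (intro mult_left_mono mult_mono) auto
      finally show ?thesis by simp
    qed
    have T4: "70 * t powr (1 - p / 2) * sqrt ((L + 1) ^ d * block_const d * \<Lambda> / m1) \<le> B4 * Y"
    proof -
      \<comment> \<open>Here \<open>t powr (1 - p/2)\<close> equals
        \<open>2^(-J * (p - 2) / 8)\<close>, the origin of the 8 in \<open>c\<close>. The resulting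
        inverse power cancels the square root of \<open>(N + 1)^(2 * d)\<close>, which bounds the
        index count together with the logarithm of the grid size.\<close>
      have tp: "t powr (1 - p / 2) \<le> inverse ((real N + 1) ^ d)"
      proof -
        have "8 * real d / (p - 2) * log 2 (N + 1) \<le> real J"
          using c(2) log1 Jge mult_right_mono[OF c(2), of "log 2 (N + 1)"] by linarith
        then have "8 * real d * log 2 (N + 1) \<le> real J * (p - 2)" using p by (simp add: field_simps)
        then have "real J / 4 * (1 - p / 2) \<le> - (real d * log 2 (N + 1))" by (simp add: field_simps)
        then have "2 powr (real J / 4 * (1 - p / 2)) \<le> (2::real) powr - (real d * log 2 (N + 1))"
          by (intro powr_mono) auto
        then show ?thesis unfolding t_def powr_powr powN powr_minus .
      qed
      have "(L + 1) ^ d * block_const d * \<Lambda> / m1 = ((real L + 1) ^ d * bc) * (\<Lambda> / m1)"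
        by (simp add: bc_def add_ac)
      also have "\<dots> \<le> (((2 * real a) ^ d * (real N + 1) ^ d) * bc) * (16 * real a * real d * real N / m)"
        using Lp Lm bc Lam m1 by (intro mult_mono mult_right_mono) auto
      also have "\<dots> \<le> (((2 * real a) ^ d * (real N + 1) ^ d) * bc) * (16 * real a * real d * (real N + 1) ^ d / m)"
      proof -
        have "real N \<le> (real N + 1) ^ 1" by simp
        also have "\<dots> \<le> (real N + 1) ^ d" using d by (intro power_increasing) auto
        finally show ?thesis using m0 bc by (intro mult_left_mono divide_right_mono) auto
      qed
      also have "\<dots> = ((2 * real a) ^ d * bc * (16 * a * d)) * (((real N + 1) ^ d)\<^sup>2 * (1 / m))"
        by (simp add: power2_eq_square mult_ac)
      finally have "sqrt ((L + 1) ^ d * block_const d * \<Lambda> / m1) \<le>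
         sqrt (((2 * real a) ^ d * bc * (16 * a * d)) * (((real N + 1) ^ d)\<^sup>2 * (1 / m)))"
        by (rule real_sqrt_le_mono)
      also have "\<dots> = sqrt ((2 * real a) ^ d * bc * (16 * a * d)) * ((real N + 1) ^ d * sqrt (1 / m))"
        by (simp only: real_sqrt_mult real_sqrt_abs) simp
      finally have q: "sqrt ((L + 1) ^ d * block_const d * \<Lambda> / m1) \<le> sqrt ((2 * real a) ^ d * bc * (16 * a * d)) * ((real N + 1) ^ d * sqrt (1 / m))" .
      have "70 * t powr (1 - p / 2) * sqrt ((L + 1) ^ d * block_const d * \<Lambda> / m1) \<le>
        70 * inverse ((real N + 1) ^ d) * (sqrt ((2 * real a) ^ d * bc * (16 * a * d)) * ((real N + 1) ^ d * sqrt (1 / m)))"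
        using tp q bc bc[unfolded bc_def] Lam by (intro mult_mono mult_left_mono) auto
      also have "\<dots> = B4 * ((inverse ((real N + 1) ^ d) * (real N + 1) ^ d) * sqrt (1 / m))"
        unfolding B4_def by (simp only: mult_ac)
      also have "\<dots> = B4 * sqrt (1 / m)" by simp
      also have "\<dots> \<le> B4 * Y" using Yinv B by (intro mult_left_mono) auto
      finally show ?thesis .
    qed
    have "real d * 9000 ^ d * mesh L powr smoothness p * weight_const p d +
      (0 + (70 * sqrt 2 * sqrt (J * (n0 + J + 1) ^ (d - 1) * block_const d * \<Lambda> / m1) +
      (t * ((L + 1) ^ d * ((10 ^ 6) ^ d * 2 powr (- real (n0 + J) / 2))) +
        70 * t powr (1 - p / 2) * sqrt ((L + 1) ^ d * block_const d * \<Lambda> / m1))))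
      \<le> 2 * B1 * Y + (0 + (B2 * Y + (2 * B3 * Y + B4 * Y)))"
      by (intro add_mono T1 T2 T3 T4 order_refl)
    also have "\<dots> = (2 * B1 + B2 + 2 * B3 + B4) * Y" by (simp add: algebra_simps)
    also have "\<dots> \<le> (2 * B1 + B2 + 2 * B3 + B4) * (sqrt ((3 * c + 1) * (3 * c + 3) ^ d) * width_rate d m)"
    proof (rule mult_left_mono)
      show "Y \<le> sqrt ((3 * c + 1) * (3 * c + 3) ^ d) * width_rate d m"
      proof -
        have Jle': "real J \<le> c * log 2 (real N + 1) + 1" using Jle by (simp add: add.commute)
        show ?thesis unfolding Y_def using width_rate_sqrt[OF m twoN Jle', of d] c by simp
      qed
    qed (use B in auto)
    also have "\<dots> = C * width_rate d m" by (simp add: C_def)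
    finally have "width_error p d n0 J L m1 t \<le> C * width_rate d m"
      unfolding width_error_def Let_def \<Lambda>_def
      by (simp only: of_nat_mult of_nat_power of_nat_add of_nat_1)
    moreover have "t > 0" by (simp add: t_def)
    ultimately show ?thesis using J1 m1(2) dim by blast
  qed
  ultimately show ?thesis by blast
qed

lemma width_rate_pos: "m \<ge> 3 \<Longrightarrow> width_rate d m > 0"
proof -
  assume m: "m \<ge> 3"
  have "exp 1 < (3::real)" using e_less_272 by simp
  then have "ln (exp 1) < ln (3::real)" by (subst ln_less_cancel_iff) auto
  then have "1 < ln (3::real)" by simp
  also have "\<dots> \<le> ln (real m)" using m by simp
  finally have "ln (real m) > 1" .
  then show ?thesis using m by (simp add: width_rate_def)
qed

lemma conv_op_width:
  assumes p: "p > 2"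
  shows "\<exists>C>0. \<forall>m\<ge>3. \<exists>L. approximable L m (C * width_rate CARD('d) m)
    (conv_op ` (unit_ball p :: (real ^ 'd::finite \<Rightarrow> real) set))"
proof -
  let ?d = "CARD('d)" and ?U = "unit_ball p :: (real ^ 'd \<Rightarrow> real) set"
  have d: "?d \<ge> 1" by (simp add: Suc_leI)
  obtain C1 where C1: "C1 > 0" "\<And>m. m \<ge> 27 \<Longrightarrow> \<exists>n0 J L m1 :: nat. \<exists>t. J \<ge> 1 \<and> m1 > 0 \<and> t > 0 \<and>
    (n0 + 1) ^ (?d - 1) * 2 ^ (n0 + 1) + (m1 + m1) \<le> m \<and>
    width_error p ?d n0 J L m1 t
    \<le> C1 * width_rate ?d m"
    using parameter_choice[OF d p] by blast
  define B where "B = 36 ^ ?d * weight_const p ?d"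
  have B: "B \<ge> 0" using weight_const_ge_1[OF p, of ?d] by (simp add: B_def)
  \<comment> \<open>The finitely many \<open>m\<close> below 27 are covered by the zero approximant;
    summing the required constants is a bound for all of them, and each is finite since the rate is
    positive from \<open>m = 3\<close> on.\<close>
  define C where "C = C1 + (\<Sum>m\<in>{3..<27::nat}. B / width_rate ?d m)"
  have pos: "B / width_rate ?d m \<ge> 0" if "m \<ge> 3" for m using width_rate_pos[OF that, of ?d] B by simp
  have "(\<Sum>m\<in>{3..<27::nat}. B / width_rate ?d m) \<ge> 0" by (intro sum_nonneg pos) simp
  then have CC1: "C1 \<le> C" by (simp add: C_def)
  have "\<exists>L. approximable L m (C * width_rate ?d m) (conv_op ` ?U)" if m: "m \<ge> 3" for m
  proof (cases "m \<ge> 27")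
    case True
    then obtain n0 J L m1 :: nat and t where par: "J \<ge> 1" "m1 > 0" "t > 0"
      "(n0 + 1) ^ (?d - 1) * 2 ^ (n0 + 1) + (m1 + m1) \<le> m"
      "width_error p ?d n0 J L m1 t
      \<le> C1 * width_rate ?d m"
      using C1(2) by blast
    have "C1 * width_rate ?d m \<le> C * width_rate ?d m"
      using CC1 width_rate_pos[OF m, of ?d] by (intro mult_right_mono) auto
    then have "approximable L m (C * width_rate ?d m) (conv_op ` ?U)"
      using par(5) by (intro approximable_mono[OF conv_op_approximable[OF p par(1-3)] par(4)]) linarith
    then show ?thesis by blast
  next
    case False
    have "B / width_rate ?d m \<le> (\<Sum>m\<in>{3..<27::nat}. B / width_rate ?d m)"
      using False m pos by (intro member_le_sum) auto
    then have "B / width_rate ?d m \<le> C" using C1(1) by (simp add: C_def)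
    then have "B \<le> C * width_rate ?d m" using width_rate_pos[OF m, of ?d] by (simp add: divide_le_eq)
    then have "approximable 0 m (C * width_rate ?d m) (conv_op ` ?U)"
      using conv_op_bound[OF p] by (intro approximable_mono[OF approximable_zero[where \<epsilon> = B]]) (auto simp: B_def)
    then show ?thesis by blast
  qed
  then show ?thesis using C1(1) CC1 by (intro exI[of _ C]) auto
qed

subsection \<open>Periodic functions with values in the scalar field\<close>

text \<open>Composition with this representative modulo the periods extends approximants from the
  cube to periodic functions, as membership in \<open>Lp_space\<close> demands.\<close>

definition wrap :: "real ^ 'd \<Rightarrow> real ^ 'd" where
  "wrap x = (\<chi> j. x $ j - 2 * pi * of_int \<lfloor>x $ j / (2 * pi)\<rfloor>)"

lemma wrap_mem_cube: "wrap x \<in> cube"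
proof -
  have "0 \<le> a - 2 * pi * of_int \<lfloor>a / (2 * pi)\<rfloor>" "a - 2 * pi * of_int \<lfloor>a / (2 * pi)\<rfloor> < 2 * pi" for a
  proof -
    have "of_int \<lfloor>a / (2 * pi)\<rfloor> \<le> a / (2 * pi)" "a / (2 * pi) < of_int \<lfloor>a / (2 * pi)\<rfloor> + 1" by linarith+
    then have "2 * pi * of_int \<lfloor>a / (2 * pi)\<rfloor> \<le> 2 * pi * (a / (2 * pi))"
      "2 * pi * (a / (2 * pi)) < 2 * pi * (of_int \<lfloor>a / (2 * pi)\<rfloor> + 1)"
      by (intro mult_left_mono mult_strict_left_mono; simp)+
    moreover have "2 * pi * (a / (2 * pi)) = a" by simp
    ultimately show "0 \<le> a - 2 * pi * of_int \<lfloor>a / (2 * pi)\<rfloor>" "a - 2 * pi * of_int \<lfloor>a / (2 * pi)\<rfloor> < 2 * pi"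
      by (simp_all only: distrib_left)
  qed
  then show ?thesis by (simp add: wrap_def cube_def)
qed

lemma wrap_cube: "x \<in> cube \<Longrightarrow> wrap x = x"
proof -
  assume x: "x \<in> cube"
  have "\<lfloor>x $ j / (2 * pi)\<rfloor> = 0" for j
    using x by (auto simp: cube_def floor_eq_iff)
  then show ?thesis by (simp add: wrap_def vec_eq_iff)
qed

lemma wrap_periodic: "wrap (x + axis j (2 * pi)) = wrap x"
proof -
  have "(a + 2 * pi) / (2 * pi) = a / (2 * pi) + of_int 1" for a :: real by (simp add: field_simps)
  then have "\<lfloor>(a + 2 * pi) / (2 * pi)\<rfloor> = \<lfloor>a / (2 * pi)\<rfloor> + 1" for a :: real by (simp only: floor_add_int)
  then show ?thesis by (auto simp: wrap_def vec_eq_iff axis_def algebra_simps)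
qed

lemma snap_wrap_measurable: "(\<lambda>x :: real ^ 'd. snap L (wrap x)) \<in> borel_measurable borel"
  unfolding borel_measurable_euclidean_space[where 'c = "real ^ 'd"]
  by (auto simp: Basis_vec_def inner_axis snap_def wrap_def cell_left_def)

text \<open>Nothing is known about \<open>u\<close>, but only its finitely many values on the grid
  enter, so the composition is a simple function.\<close>

lemma grid_function_measurable:
  fixes u :: "real ^ 'd \<Rightarrow> real"
  shows "(\<lambda>x. u (snap L (wrap x))) \<in> borel_measurable borel"
proof -
  note [measurable] = snap_wrap_measurable
  let ?K = "snap L ` (cube :: (real ^ 'd) set)"
  have "u (snap L (wrap x)) = (\<Sum>k\<in>?K. u k * indicator {x. snap L (wrap x) = k} x)" for x
  proof -
    have fin: "finite ?K" by (rule finite_snap)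
    have "(\<Sum>k\<in>?K. u k * indicator {x. snap L (wrap x) = k} x) = (\<Sum>k\<in>?K. if k = snap L (wrap x) then u k else 0)"
      by (intro sum.cong) (auto simp: indicator_def)
    also have "\<dots> = u (snap L (wrap x))" using fin wrap_mem_cube[of x] by simp
    finally show ?thesis by simp
  qed
  moreover have "(\<lambda>x. \<Sum>k\<in>?K. u k * indicator {x. snap L (wrap x) = k} x) \<in> borel_measurable borel"
    by measurable
  ultimately show ?thesis by simp
qed

text \<open>The closed box exceeds the half-open cube only where a coordinate equals
  \<open>2 * pi\<close>, and there the chord to the origin vanishes.\<close>

lemma AE_torus_cube: "AE x :: real ^ 'd in torus. x \<in> cube"
  using AE_torus_box AE_torus_chord[of 0]
proof eventually_elim
  case (elim x)
  have "x $ j \<noteq> 2 * pi" for j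
  proof
    assume "x $ j = 2 * pi"
    then have "chord (0 $ j - x $ j) = 0" by (simp add: chord_eq_0_iff complex_eq_iff)
    then show False using elim(2) by blast
  qed
  then show ?case using elim(1) by (auto simp: cube_def less_le)
qed

lemma grid_function_in_Lp_space:
  fixes u :: "real ^ 'd \<Rightarrow> real"
  shows "(\<lambda>x. of_real (u (snap L (wrap x))) :: 'k::{real_normed_field, euclidean_space}) \<in> Lp_space \<infinity>"
proof -
  let ?f = "\<lambda>x. of_real (u (snap L (wrap x))) :: 'k"
  let ?K = "snap L ` (cube :: (real ^ 'd) set)"
  define M where "M = (\<Sum>k\<in>?K. \<bar>u k\<bar>)"
  note [measurable] = grid_function_measurable[of u L]
  have [measurable]: "?f \<in> borel_measurable borel" by measurable
  have "norm (?f x) \<le> M" for x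
  proof -
    have fin: "finite ?K" by (rule finite_snap)
    have "\<bar>u (snap L (wrap x))\<bar> \<le> M"
      unfolding M_def using fin wrap_mem_cube[of x] by (intro member_le_sum) auto
    then show ?thesis by simp
  qed
  then have "esssup torus (\<lambda>x. ennreal (norm (?f x))) \<le> ennreal M"
    by (intro esssup_I AE_I2 ennreal_leI) auto
  then have "Lp_norm \<infinity> ?f < \<infinity>" by (auto simp: Lp_norm_def intro: order_le_less_trans)
  moreover have "periodic ?f" by (simp add: periodic_def wrap_periodic)
  ultimately show ?thesis by (simp add: Lp_space_def)
qed

text \<open>Reduction to real densities and a finite exponent. For \<open>p = \<infinity>\<close>
  the value 4 is an arbitrary choice above 2: the measure is a probability measure, so a density
  bounded by 1 lies in the unit ball of every finite exponent.\<close>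

lemma component_in_unit_ball:
  fixes \<phi> :: "real ^ 'd \<Rightarrow> 'k::{real_normed_field, euclidean_space}"
  assumes p: "2 < p" and phi: "\<phi> \<in> Lp_space p" "Lp_norm p \<phi> \<le> 1" and b: "b \<in> Basis"
    and q: "q = (if p = \<infinity> then 4 else enn2real p)"
  shows "(\<lambda>y. \<phi> y \<bullet> b) \<in> unit_ball q"
proof -
  have [measurable]: "\<phi> \<in> borel_measurable borel" using phi by (simp add: Lp_space_def)
  have "0 < p" using zero_le p by (rule le_less_trans)
  then have q0: "q > 0" using q by (auto simp: enn2real_positive_iff less_top)
  have "(\<integral>\<^sup>+ y. ennreal (norm (\<phi> y) powr q) \<partial>torus) \<le> 1"
  proof (cases "p = \<infinity>")
    case True
    have "esssup torus (\<lambda>x. ennreal (norm (\<phi> x))) \<le> 1" using phi(2) True by (simp add: Lp_norm_def)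
    then have ae: "AE x in torus. ennreal (norm (\<phi> x)) \<le> 1"
      using esssup_AE[of "\<lambda>x. ennreal (norm (\<phi> x))" torus] by (elim eventually_mono) (rule order_trans)
    have "(\<integral>\<^sup>+ y. ennreal (norm (\<phi> y) powr q) \<partial>torus) \<le> (\<integral>\<^sup>+ y. 1 \<partial>(torus :: (real ^ 'd) measure))"
    proof (rule nn_integral_mono_AE, use ae in eventually_elim)
      case (elim y)
      then have "norm (\<phi> y) \<le> 1" by (simp flip: ennreal_1)
      then have "norm (\<phi> y) powr q \<le> 1" using q0 by (intro powr_le1) auto
      then show ?case by (simp add: ennreal_le_1)
    qed
    then show ?thesis using prob_space.emeasure_space_1[OF prob_space_torus[where 'd = 'd]] by simp
  next
    case False
    define I where "I = (\<integral>\<^sup>+ y. ennreal (norm (\<phi> y) powr q) \<partial>torus)"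
    have norm: "(if I = \<infinity> then \<infinity> else ennreal (enn2real I powr (1 / q))) \<le> 1"
      using phi(2) by (simp only: Lp_norm_def Let_def I_def q False if_False)
    then have I: "I \<noteq> \<infinity>" by (auto split: if_splits simp: top_unique)
    then have "ennreal (enn2real I powr (1 / q)) \<le> 1" using norm by simp
    then have le: "enn2real I powr (1 / q) \<le> 1" by (simp flip: ennreal_1)
    have "enn2real I \<le> 1"
    proof (rule ccontr)
      assume "\<not> enn2real I \<le> 1"
      then have "1 powr (1 / q) < enn2real I powr (1 / q)" using q0 by (intro powr_less_mono2) auto
      then show False using le by simp
    qed
    then have "ennreal (enn2real I) \<le> ennreal 1" by (rule ennreal_leI)
    then show ?thesis using I by (simp add: I_def[symmetric] ennreal_enn2real_if)
  qed
  moreover have "(\<integral>\<^sup>+ y. ennreal (\<bar>\<phi> y \<bullet> b\<bar> powr q) \<partial>torus) \<le> (\<integral>\<^sup>+ y. ennreal (norm (\<phi> y) powr q) \<partial>torus)"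
    using b q0 by (intro nn_integral_mono ennreal_leI powr_mono2 Basis_le_norm) auto
  ultimately show ?thesis by (simp add: unit_ball_def)
qed

lemma bernoulli_kernel_measurable [measurable]: "bernoulli_kernel r \<in> borel_measurable borel"
  unfolding bernoulli_kernel_def bernoulli_kernel1_def by measurable

text \<open>The two kernels differ only where some chord vanishes, a null set in \<open>y\<close>.
  Integrability is assembled from the components first, because only then does the inner product
  commute with the integral.\<close>

lemma torus_convolution_inner:
  fixes \<phi> :: "real ^ 'd \<Rightarrow> 'k::{real_normed_field, euclidean_space}"
  assumes q: "q > 2" and phi [measurable]: "\<phi> \<in> borel_measurable borel"
    and comp: "\<And>b. b \<in> Basis \<Longrightarrow> (\<lambda>y. \<phi> y \<bullet> b) \<in> unit_ball q" and x: "x \<in> cube" and b: "b \<in> Basis"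
  shows "torus_convolution \<phi> (bernoulli_kernel (1 / 2)) x \<bullet> b = conv_op (\<lambda>y. \<phi> y \<bullet> b) x"
proof -
  have eq: "torus_convolution \<phi> (bernoulli_kernel (1 / 2)) x = (LINT y|torus. product_kernel x y *\<^sub>R \<phi> y)"
    unfolding torus_convolution_def
  proof (rule integral_cong_AE)
    show "AE y in torus. bernoulli_kernel (1 / 2) (x - y) *\<^sub>R \<phi> y = product_kernel x y *\<^sub>R \<phi> y"
      using AE_torus_chord[of x]
      by eventually_elim (simp add: bernoulli_kernel_def product_kernel_def half_kernel_def chord_eq_0_iff)
  qed measurable
  have int: "integrable torus (\<lambda>y. product_kernel x y * (\<phi> y \<bullet> i))" if "i \<in> Basis" for i
    using convolution_remainder(1)[OF q _ _ x, of "\<lambda>y. \<phi> y \<bullet> i"] comp[OF that] by (simp add: unit_ball_def)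
  have "integrable torus (\<lambda>y. \<Sum>i\<in>Basis. (product_kernel x y * (\<phi> y \<bullet> i)) *\<^sub>R i)"
    by (intro Bochner_Integration.integrable_sum integrable_scaleR_left int)
  also have "(\<lambda>y. \<Sum>i\<in>Basis. (product_kernel x y * (\<phi> y \<bullet> i)) *\<^sub>R i) = (\<lambda>y. product_kernel x y *\<^sub>R \<phi> y)"
    by (simp add: scaleR_scaleR[symmetric] scaleR_sum_right[symmetric] euclidean_representation del: scaleR_scaleR)
  finally have "integrable torus (\<lambda>y. product_kernel x y *\<^sub>R \<phi> y)" .
  then show ?thesis unfolding eq conv_op_def by (subst integral_inner_left[symmetric]) auto
qed

lemma torus_convolution_measurable:
  fixes \<phi> :: "real ^ 'd \<Rightarrow> 'k::{real_normed_field, euclidean_space}"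
  assumes [measurable]: "\<phi> \<in> borel_measurable borel"
  shows "torus_convolution \<phi> (bernoulli_kernel r) \<in> borel_measurable borel"
proof -
  interpret prob_space "torus :: (real ^ 'd) measure" by (rule prob_space_torus)
  show ?thesis unfolding torus_convolution_def by measurable
qed

theorem theorem3p5:
  fixes p :: ennreal
  assumes "CARD('d::finite) \<ge> 2" and "2 < p"
  shows "\<exists>C::real. C > 0 \<and>
    (\<forall>m::nat. m \<ge> 3 \<longrightarrow>
      kolmogorov_width (Lp_space \<infinity>) (Lp_norm \<infinity>) m
          (W_class (1 / 2) p :: (real ^ 'd \<Rightarrow> 'k::{real_normed_field, euclidean_space}) set)
        \<le> ennreal (C * real m powr (- 1 / 2) * ln (real m) powr (real CARD('d) / 2)
                     * ln (ln (real m)) powr (3 / 2)))"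
proof -
  define q where "q = (if p = \<infinity> then 4 else enn2real p)"
  have q: "q > 2"
  proof (cases "p = \<infinity>")
    case False
    then have "p = ennreal (enn2real p)" by (simp add: ennreal_enn2real_if)
    then have "ennreal 2 < ennreal (enn2real p)" using assms(2) by simp
    then show ?thesis using False by (simp add: q_def ennreal_less_iff)
  qed (simp add: q_def)
  obtain C where C: "C > 0" "\<And>m. m \<ge> 3 \<Longrightarrow> \<exists>L. approximable L m (C * width_rate CARD('d) m)
    (conv_op ` (unit_ball q :: (real ^ 'd \<Rightarrow> real) set))"
    using conv_op_width[OF q] by blast
  \<comment> \<open>The scalar is expanded in a basis of \<open>'k\<close>, and the errors of its
    components are added.\<close>
  define C' where "C' = real DIM('k) * C"
  have width: "kolmogorov_width (Lp_space \<infinity>) (Lp_norm \<infinity>) m (W_class (1 / 2) p :: (real ^ 'd \<Rightarrow> 'k) set)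
      \<le> ennreal (C' * width_rate CARD('d) m)" if m: "m \<ge> 3" for m
  proof -
    define \<epsilon> where "\<epsilon> = C * width_rate CARD('d) m"
    obtain L and u :: "nat \<Rightarrow> real ^ 'd \<Rightarrow> real" where u: "\<And>\<phi>. \<phi> \<in> unit_ball q \<Longrightarrow>
      \<exists>c. \<forall>x\<in>cube. \<bar>conv_op \<phi> x - (\<Sum>i<m. c i * u i (snap L x))\<bar> \<le> \<epsilon>"
      using C(2)[OF m] unfolding approximable_def \<epsilon>_def by blast
    \<comment> \<open>The shift by 1 reconciles indices starting at 1 in the width with those
      starting at 0 in \<open>approximable\<close>.\<close>
    define U where "U = (\<lambda>i x. of_real (u (i - 1) (snap L (wrap x))) :: 'k)"
    have U: "U i \<in> Lp_space \<infinity>" for i unfolding U_def by (rule grid_function_in_Lp_space)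
    have [measurable]: "U i \<in> borel_measurable borel" for i using U[of i] by (simp add: Lp_space_def)
    have "(INF c :: nat \<Rightarrow> 'k. Lp_norm \<infinity> (\<lambda>x. f x - (\<Sum>i=1..m. c i * U i x))) \<le> ennreal (C' * width_rate CARD('d) m)"
      if f: "f \<in> (W_class (1 / 2) p :: (real ^ 'd \<Rightarrow> 'k) set)" for f
    proof -
      obtain \<phi> :: "real ^ 'd \<Rightarrow> 'k" where phi: "\<phi> \<in> Lp_space p" "Lp_norm p \<phi> \<le> 1"
        "f = torus_convolution \<phi> (bernoulli_kernel (1 / 2))" using f by (auto simp: W_class_def)
      have meas [measurable]: "\<phi> \<in> borel_measurable borel" using phi by (simp add: Lp_space_def)
      have [measurable]: "f \<in> borel_measurable borel" unfolding phi(3) by (rule torus_convolution_measurable) simp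
      have comp: "(\<lambda>y. \<phi> y \<bullet> b) \<in> unit_ball q" if "b \<in> Basis" for b
        using component_in_unit_ball[OF assms(2) phi(1,2) that q_def] .
      have "\<forall>b\<in>Basis. \<exists>c. \<forall>x\<in>cube. \<bar>conv_op (\<lambda>y. \<phi> y \<bullet> b) x - (\<Sum>i<m. c i * u i (snap L x))\<bar> \<le> \<epsilon>"
        using u comp by blast
      then obtain c where c: "\<And>b x. b \<in> Basis \<Longrightarrow> x \<in> cube \<Longrightarrow>
        \<bar>conv_op (\<lambda>y. \<phi> y \<bullet> b) x - (\<Sum>i<m. c b i * u i (snap L x))\<bar> \<le> \<epsilon>"
        using bchoice[of Basis "\<lambda>b c. \<forall>x\<in>cube. \<bar>conv_op (\<lambda>y. \<phi> y \<bullet> b) x - (\<Sum>i<m. c i * u i (snap L x))\<bar> \<le> \<epsilon>"] by blast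
      \<comment> \<open>The functions are the same for all components, so the real coefficients
        combine into one scalar coefficient and the number of functions stays
        \<open>m\<close>.\<close>
      define c' where "c' = (\<lambda>i. \<Sum>b\<in>Basis. c b (i - 1) *\<^sub>R b :: 'k)"
      have err: "norm (f x - (\<Sum>i=1..m. c' i * U i x)) \<le> C' * width_rate CARD('d) m" if x: "x \<in> cube" for x
      proof -
        have "(\<Sum>i=1..m. c' i * U i x) = (\<Sum>i<m. c' (Suc i) * U (Suc i) x)"
          by (rule sum.reindex_bij_witness[of _ Suc "\<lambda>i. i - 1"]) auto
        also have "\<dots> = (\<Sum>i<m. \<Sum>b\<in>Basis. (c b i * u i (snap L x)) *\<^sub>R b)"
          by (simp add: c'_def U_def wrap_cube[OF x] sum_distrib_right scaleR_conv_of_real mult.assoc)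
            (simp add: mult_ac)
        also have "\<dots> = (\<Sum>b\<in>Basis. (\<Sum>i<m. c b i * u i (snap L x)) *\<^sub>R b)"
          by (subst sum.swap) (simp add: scaleR_sum_left)
        finally have s: "(\<Sum>i=1..m. c' i * U i x) = (\<Sum>b\<in>Basis. (\<Sum>i<m. c b i * u i (snap L x)) *\<^sub>R b)" .
        have "f x = (\<Sum>b\<in>Basis. (f x \<bullet> b) *\<^sub>R b)" by (simp add: euclidean_representation)
        also have "\<dots> = (\<Sum>b\<in>Basis. conv_op (\<lambda>y. \<phi> y \<bullet> b) x *\<^sub>R b)"
          unfolding phi(3) using torus_convolution_inner[OF q meas comp x] by (intro sum.cong) auto
        finally have "f x - (\<Sum>i=1..m. c' i * U i x) =
          (\<Sum>b\<in>Basis. (conv_op (\<lambda>y. \<phi> y \<bullet> b) x - (\<Sum>i<m. c b i * u i (snap L x))) *\<^sub>R b)"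
          unfolding s by (simp add: sum_subtractf scaleR_diff_left)
        also have "norm \<dots> \<le> (\<Sum>b\<in>(Basis :: 'k set). \<epsilon>)"
          by (rule sum_norm_le) (use c x in auto)
        finally show ?thesis by (simp add: C'_def \<epsilon>_def mult.assoc)
      qed
      have "Lp_norm \<infinity> (\<lambda>x. f x - (\<Sum>i=1..m. c' i * U i x)) \<le> ennreal (C' * width_rate CARD('d) m)"
      proof -
        have "AE x in torus. ennreal (norm (f x - (\<Sum>i=1..m. c' i * U i x))) \<le> ennreal (C' * width_rate CARD('d) m)"
          using AE_torus_cube by eventually_elim (intro ennreal_leI err)
        then have "esssup torus (\<lambda>x. ennreal (norm (f x - (\<Sum>i=1..m. c' i * U i x)))) \<le> ennreal (C' * width_rate CARD('d) m)"
          by (intro esssup_I) measurable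
        then show ?thesis by (simp add: Lp_norm_def)
      qed
      then show ?thesis by (intro INF_lower2[of c']) auto
    qed
    then show ?thesis unfolding kolmogorov_width_def using U by (intro INF_lower2[of U] SUP_least) auto
  qed
  show ?thesis
  proof (intro exI conjI allI impI)
    show "C' > 0" using C(1) by (simp add: C'_def)
    fix m :: nat assume "m \<ge> 3"
    then show "kolmogorov_width (Lp_space \<infinity>) (Lp_norm \<infinity>) m (W_class (1 / 2) p :: (real ^ 'd \<Rightarrow> 'k) set)
      \<le> ennreal (C' * real m powr (- 1 / 2) * ln (real m) powr (real CARD('d) / 2) * ln (ln (real m)) powr (3 / 2))"
      using width[of m] by (simp only: width_rate_def mult.assoc)
  qed
qed

end
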